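(* For $d=1,2$, there exist a poset $\mathcal P_d$ of proper subgroups of $\Gamma_d$, ordered by inclusion, and a homotopy equivalence \[ \operatorname{hocolim}_{U\in\mathcal P_d}B(U)\stackrel{\simeq}{\longrightarrow}B(\Gamma_d). \]
   Context: $\Gamma_d=\mathrm{PSL}_2(\mathcal O_d)$ is the Bianchi group, where $\mathcal O_d$ is the ring of integers of the imaginary quadratic field $\mathbb Q(\sqrt{-d})$. $B(G)$ denotes the classifying space of a (discrete) group $G$. The poset $\mathcal P_d$ is regarded as a category whose morphisms are the inclusions between the given subgroups, and the homotopy colimit is that of the functor $U\mapsto B(U)$ on this category, with inclusions inducing the maps. *)

theory Defs
  imports "HOL-Analysis.Analysis" "HOL-Algebra.Coset" "HOL-Homology.Simplices"
begin

section \<open>Bianchi groups\<close>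

definition imag_quadratic_field :: "nat \<Rightarrow> complex set" where
  "imag_quadratic_field d =
     {of_rat a + of_rat b * csqrt (- of_nat d) | a b :: rat. True}"

definition imag_quadratic_integers :: "nat \<Rightarrow> complex set" where
  "imag_quadratic_integers d = {z \<in> imag_quadratic_field d. algebraic_int z}"

definition SL2 :: "complex set \<Rightarrow> (complex ^ 2 ^ 2) monoid" where
  "SL2 R = \<lparr>carrier = {A. (\<forall>i j. A $ i $ j \<in> R) \<and> det A = 1},
            mult = (**), one = mat 1\<rparr>"

text \<open>For a subring of the complex numbers the scalar matrices in \<open>SL2 R\<close> are exactly
  \<open>mat 1\<close> and \<open>- mat 1\<close>.\<close>

definition PSL2 :: "complex set \<Rightarrow> (complex ^ 2 ^ 2) set monoid" where
  "PSL2 R = SL2 R Mod {mat 1, - mat 1}"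

definition bianchi_group :: "nat \<Rightarrow> (complex ^ 2 ^ 2) set monoid" where
  "bianchi_group d = PSL2 (imag_quadratic_integers d)"


section \<open>Quotient spaces\<close>

text \<open>Meant for \<open>r\<close> an equivalence relation on \<open>topspace X\<close>; the points are the equivalence
  classes.\<close>

definition quotient_topology :: "'a topology \<Rightarrow> ('a \<times> 'a) set \<Rightarrow> 'a set topology" where
  "quotient_topology X r =
     topology (\<lambda>\<U>. \<U> \<subseteq> topspace X // r \<and> openin X (\<Union>\<U>))"

lemma openin_quotient_topology:
  assumes r: "equiv (topspace X) r"
  shows "openin (quotient_topology X r) \<U> \<longleftrightarrow> \<U> \<subseteq> topspace X // r \<and> openin X (\<Union>\<U>)"
proof -
  have "istopology (\<lambda>\<U>. \<U> \<subseteq> topspace X // r \<and> openin X (\<Union>\<U>))"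
    unfolding istopology_def
  proof (rule conjI; intro allI impI)
    fix S T
    assume S: "S \<subseteq> topspace X // r \<and> openin X (\<Union>S)"
      and T: "T \<subseteq> topspace X // r \<and> openin X (\<Union>T)"
    have "\<Union>(S \<inter> T) = \<Union>S \<inter> \<Union>T"
    proof
      show "\<Union>S \<inter> \<Union>T \<subseteq> \<Union>(S \<inter> T)"
      proof
        fix x assume "x \<in> \<Union>S \<inter> \<Union>T"
        then obtain a b where ab: "a \<in> S" "b \<in> T" "x \<in> a" "x \<in> b" by blast
        with S T have "a \<in> topspace X // r" "b \<in> topspace X // r" by auto
        from quotient_disj[OF r this] ab have "a = b" by blast
        with ab show "x \<in> \<Union>(S \<inter> T)" by blast
      qed
    qed blast
    with S T show "S \<inter> T \<subseteq> topspace X // r \<and> openin X (\<Union>(S \<inter> T))" by auto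
  next
    fix K assume K: "\<forall>S\<in>K. S \<subseteq> topspace X // r \<and> openin X (\<Union>S)"
    have "\<Union>(\<Union>K) = (\<Union>S\<in>K. \<Union>S)" by blast
    moreover have "openin X (\<Union>S\<in>K. \<Union>S)"
      using K by (intro openin_Union) auto
    ultimately show "\<Union>K \<subseteq> topspace X // r \<and> openin X (\<Union>(\<Union>K))"
      using K by (metis Union_least)
  qed
  then show ?thesis by (simp add: quotient_topology_def)
qed

lemma topspace_quotient_topology:
  assumes r: "equiv (topspace X) r"
  shows "topspace (quotient_topology X r) = topspace X // r"
proof
  show "topspace (quotient_topology X r) \<subseteq> topspace X // r"
    using openin_quotient_topology[OF r] by (metis openin_topspace)
  have "openin (quotient_topology X r) (topspace X // r)"
    by (simp add: openin_quotient_topology[OF r] Union_quotient[OF r])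
  then show "topspace X // r \<subseteq> topspace (quotient_topology X r)"
    by (rule openin_subset)
qed

lemma quotient_map_quotient_topology:
  assumes r: "equiv (topspace X) r"
  shows "quotient_map X (quotient_topology X r) (\<lambda>x. r `` {x})"
  unfolding quotient_map_def topspace_quotient_topology[OF r]
proof (intro conjI allI impI)
  show "(\<lambda>x. r `` {x}) ` topspace X = topspace X // r"
    by (auto simp: quotient_def)
next
  fix \<U> assume U: "\<U> \<subseteq> topspace X // r"
  have "{x \<in> topspace X. r `` {x} \<in> \<U>} = \<Union>\<U>"
  proof (intro equalityI subsetI)
    fix x assume "x \<in> {x \<in> topspace X. r `` {x} \<in> \<U>}"
    then show "x \<in> \<Union>\<U>" using equiv_class_self[OF r] by blast
  next
    fix x assume "x \<in> \<Union>\<U>"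
    then obtain c where c: "c \<in> \<U>" "x \<in> c" by blast
    with U have "c \<in> topspace X // r" by blast
    then obtain y where y: "c = r `` {y}" by (rule quotientE)
    with c have "(y, x) \<in> r" by simp
    with y have "r `` {x} = c" "x \<in> topspace X"
      using equiv_class_eq_iff[OF r] by blast+
    with c show "x \<in> {x \<in> topspace X. r `` {x} \<in> \<U>}" by simp
  qed
  with U show "openin X {x \<in> topspace X. r `` {x} \<in> \<U>} \<longleftrightarrow> openin (quotient_topology X r) \<U>"
    by (simp add: openin_quotient_topology[OF r])
qed


section \<open>Geometric realization of simplicial spaces\<close>

definition simplex_topology :: "nat \<Rightarrow> (nat \<Rightarrow> real) topology" where
  "simplex_topology n = subtopology (powertop_real UNIV) (standard_simplex n)"

text \<open>The coface map of the standard simplices in barycentric coordinates is the library's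
  \<open>simplical_face\<close>; this is the codegeneracy map.\<close>

definition codegeneracy :: "nat \<Rightarrow> (nat \<Rightarrow> real) \<Rightarrow> nat \<Rightarrow> real" where
  "codegeneracy k t =
     (\<lambda>i. if i < k then t i else if i = k then t k + t (Suc k) else t (Suc i))"

text \<open>A simplicial space is given by its spaces \<open>X n\<close> of \<open>n\<close>-simplices, its face operators
  \<open>\<delta> i : X (Suc n) \<rightarrow> X n\<close> and its degeneracy operators \<open>\<sigma> i : X n \<rightarrow> X (Suc n)\<close>; in both
  instances below the dimension of a simplex can be read off from the simplex, so the operators
  do not carry the argument \<open>n\<close>. A simplicial set is a simplicial space with discrete
  \<open>X n\<close>.\<close>

definition simplex_sum ::
  "(nat \<Rightarrow> 'a topology) \<Rightarrow> (nat \<times> 'a \<times> (nat \<Rightarrow> real)) topology" where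
  "simplex_sum X = sum_topology (\<lambda>n. prod_topology (X n) (simplex_topology n)) UNIV"

inductive glue ::
  "(nat \<Rightarrow> 'a topology) \<Rightarrow> (nat \<Rightarrow> 'a \<Rightarrow> 'a) \<Rightarrow> (nat \<Rightarrow> 'a \<Rightarrow> 'a) \<Rightarrow>
   nat \<times> 'a \<times> (nat \<Rightarrow> real) \<Rightarrow> nat \<times> 'a \<times> (nat \<Rightarrow> real) \<Rightarrow> bool"
  for X :: "nat \<Rightarrow> 'a topology" and \<delta> \<sigma> :: "nat \<Rightarrow> 'a \<Rightarrow> 'a" where
  face: "\<lbrakk>x \<in> topspace (X (Suc n)); t \<in> standard_simplex n; i \<le> Suc n\<rbrakk>
    \<Longrightarrow> glue X \<delta> \<sigma> (n, \<delta> i x, t) (Suc n, x, simplical_face i t)"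
| degeneracy: "\<lbrakk>x \<in> topspace (X n); t \<in> standard_simplex (Suc n); i \<le> n\<rbrakk>
    \<Longrightarrow> glue X \<delta> \<sigma> (n, x, codegeneracy i t) (Suc n, \<sigma> i x, t)"

definition glue_rel ::
  "(nat \<Rightarrow> 'a topology) \<Rightarrow> (nat \<Rightarrow> 'a \<Rightarrow> 'a) \<Rightarrow> (nat \<Rightarrow> 'a \<Rightarrow> 'a) \<Rightarrow>
   ((nat \<times> 'a \<times> (nat \<Rightarrow> real)) \<times> (nat \<times> 'a \<times> (nat \<Rightarrow> real))) set" where
  "glue_rel X \<delta> \<sigma> =
     {(p, q) \<in> topspace (simplex_sum X) \<times> topspace (simplex_sum X). equivclp (glue X \<delta> \<sigma>) p q}"

lemma equiv_glue_rel: "equiv (topspace (simplex_sum X)) (glue_rel X \<delta> \<sigma>)"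
proof (rule equivI)
  show "sym (glue_rel X \<delta> \<sigma>)"
    unfolding glue_rel_def sym_def by (blast intro: equivclp_sym)
  show "trans (glue_rel X \<delta> \<sigma>)"
    unfolding glue_rel_def trans_def by (blast intro: transpD[OF transp_equivclp])
  show "refl_on (topspace (simplex_sum X)) (glue_rel X \<delta> \<sigma>)"
    unfolding glue_rel_def refl_on_def by (blast intro: reflpD[OF reflp_equivclp])
qed (unfold glue_rel_def, blast)

definition realization ::
  "(nat \<Rightarrow> 'a topology) \<Rightarrow> (nat \<Rightarrow> 'a \<Rightarrow> 'a) \<Rightarrow> (nat \<Rightarrow> 'a \<Rightarrow> 'a) \<Rightarrow>
   (nat \<times> 'a \<times> (nat \<Rightarrow> real)) set topology" where
  "realization X \<delta> \<sigma> = quotient_topology (simplex_sum X) (glue_rel X \<delta> \<sigma>)"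


section \<open>Classifying spaces\<close>

text \<open>The nerve of a discrete group, as the bar construction: an \<open>n\<close>-simplex
  \<open>[g\<^sub>1, \<dots>, g\<^sub>n]\<close> is a string of \<open>n\<close> composable morphisms of the one-object category.\<close>

definition bar :: "('g, 'm) monoid_scheme \<Rightarrow> nat \<Rightarrow> 'g list topology" where
  "bar G n = discrete_topology {xs. set xs \<subseteq> carrier G \<and> length xs = n}"

definition bar_face :: "('g, 'm) monoid_scheme \<Rightarrow> nat \<Rightarrow> 'g list \<Rightarrow> 'g list" where
  "bar_face G i xs =
     (if i = 0 then tl xs
      else if i = length xs then butlast xs
      else take (i - 1) xs @ [xs ! (i - 1) \<otimes>\<^bsub>G\<^esub> xs ! i] @ drop (i + 1) xs)"

definition bar_degeneracy :: "('g, 'm) monoid_scheme \<Rightarrow> nat \<Rightarrow> 'g list \<Rightarrow> 'g list" where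
  "bar_degeneracy G i xs = take i xs @ [\<one>\<^bsub>G\<^esub>] @ drop i xs"

type_synonym 'g classifying_point = "(nat \<times> 'g list \<times> (nat \<Rightarrow> real)) set"

definition classifying_space :: "('g, 'm) monoid_scheme \<Rightarrow> 'g classifying_point topology" where
  "classifying_space G = realization (bar G) (bar_face G) (bar_degeneracy G)"

text \<open>The map induced by a homomorphism \<open>\<phi>\<close> into \<open>H\<close>; a point of the source is a whole
  equivalence class \<open>c\<close>, all of whose representatives are sent into a single class.\<close>

definition classifying_map ::
  "('h, 'm) monoid_scheme \<Rightarrow> ('g \<Rightarrow> 'h) \<Rightarrow> 'g classifying_point \<Rightarrow> 'h classifying_point" where
  "classifying_map H \<phi> c =
     glue_rel (bar H) (bar_face H) (bar_degeneracy H) ``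
       ((\<lambda>(n, xs, t). (n, map \<phi> xs, t)) ` c)"


section \<open>Homotopy colimits over posets\<close>

text \<open>The Bousfield-Kan homotopy colimit of a functor on a poset \<open>P\<close>, with values \<open>X u\<close> and
  with \<open>F u v : X u \<rightarrow> X v\<close> for \<open>u \<le> v\<close>: the realization of the simplicial replacement,
  whose space of \<open>n\<close>-simplices is the disjoint union of the \<open>X (u 0)\<close> over all chains
  \<open>u 0 \<le> \<dots> \<le> u n\<close> in \<open>P\<close>.\<close>

definition chains_in :: "'i::order set \<Rightarrow> nat \<Rightarrow> 'i list set" where
  "chains_in P n = {us. set us \<subseteq> P \<and> length us = Suc n \<and> sorted_wrt (\<le>) us}"

definition replacement ::
  "'i::order set \<Rightarrow> ('i \<Rightarrow> 'a topology) \<Rightarrow> nat \<Rightarrow> ('i list \<times> 'a) topology" where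
  "replacement P X n = sum_topology (\<lambda>us. X (hd us)) (chains_in P n)"

definition replacement_face ::
  "('i \<Rightarrow> 'i \<Rightarrow> 'a \<Rightarrow> 'a) \<Rightarrow> nat \<Rightarrow> 'i list \<times> 'a \<Rightarrow> 'i list \<times> 'a" where
  "replacement_face F i =
     (\<lambda>(us, x). (take i us @ drop (Suc i) us, if i = 0 then F (us ! 0) (us ! 1) x else x))"

definition replacement_degeneracy :: "nat \<Rightarrow> 'i list \<times> 'a \<Rightarrow> 'i list \<times> 'a" where
  "replacement_degeneracy i = (\<lambda>(us, x). (take (Suc i) us @ drop i us, x))"

definition hocolim ::
  "'i::order set \<Rightarrow> ('i \<Rightarrow> 'a topology) \<Rightarrow> ('i \<Rightarrow> 'i \<Rightarrow> 'a \<Rightarrow> 'a) \<Rightarrow>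
   (nat \<times> ('i list \<times> 'a) \<times> (nat \<Rightarrow> real)) set topology" where
  "hocolim P X F = realization (replacement P X) (replacement_face F) replacement_degeneracy"

text \<open>On sets of subgroups the class order is inclusion, and the inclusion of one
  subgroup in another is the identity on elements.\<close>

definition hocolim_classifying ::
  "('g, 'm) monoid_scheme \<Rightarrow> 'g set set \<Rightarrow>
   (nat \<times> ('g set list \<times> 'g classifying_point) \<times> (nat \<Rightarrow> real)) set topology" where
  "hocolim_classifying G P =
     hocolim P (\<lambda>U. classifying_space (G\<lparr>carrier := U\<rparr>))
       (\<lambda>U V. classifying_map (G\<lparr>carrier := V\<rparr>) (\<lambda>g. g))"

end

theory Submission
  imports Defs "HOL-Computational_Algebra.Primes"
begin

text \<open>The poset consists of the finite intersections of congruence subgroups \<open>H\<^sub>i\<close>, one for each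
  rational prime. These are independent: any finite number of cosets \<open>g\<^sub>i H\<^sub>i\<close> has a common
  element, by the Euclidean algorithm in \<open>\<int>[\<surd>-d]\<close>. Hence the coset poset is the infinite join of
  the discrete sets \<open>\<Gamma> / H\<^sub>i\<close>, which is contractible.

  A homotopy inverse is written down directly. A point of \<open>B(\<Gamma>)\<close> is a step function
  \<open>e : [0, 1) \<rightarrow> \<Gamma>\<close> up to left translation; a point of the homotopy colimit is a pair of such an \<open>e\<close>
  and an increasing step function \<open>V\<close> with values in the poset, such that \<open>e\<close> stays in one coset of
  \<open>V 0\<close>. If \<open>e\<close> takes the value \<open>g\<close> on more than half of \<open>[0, 4\<^sup>-\<^sup>i)\<close>, then \<open>g\<close> is a label
  of \<open>i\<close>, with a weight. The indices of large weight determine \<open>V\<close>, and \<open>e\<close> is replaced by elements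
  chosen in the intersections of the labelled cosets \<open>g H\<^sub>i\<close>; lowering the threshold for the weight
  within one step function makes these discrete choices continuous. The homotopies splice two step
  functions at a moving point of \<open>[0, 1)\<close>.\<close>

section \<open>Step functions of weighted lists\<close>

text \<open>Different cosets of one \<open>H i\<close> are disjoint, so an index may carry at most
  one label; asking for more than half of \<open>[0, 4^-i)\<close> ensures this. Finitely many
  indices would not do: a finite join of discrete sets with several points is not contractible, and
  \<open>e\<close> can spread its values so that none prevails on finitely many windows. But a step
  function with m jumps is constant on three quarters of some window with \<open>i <= m\<close>,
  which yields a weight of at least \<open>4^-m / 2\<close>. Windows with \<open>i > m\<close> have
  weights of at most \<open>4^-m / 4\<close>, half of that, and the threshold starts at one half of
  the maximal weight. So only finitely many labels count. The threshold rises from 1/2 to 3/4 for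
  the group elements and from 3/4 to 1 for the subgroups. Every label behind a subgroup is thus
  behind every chosen element, and all these elements lie in one coset of the first subgroup.
  Splicing needs comparable chains, but the chain made from \<open>e\<close> is unrelated to a given
  \<open>V\<close>. The comparison therefore passes through the intersection of the two chains,
  which requires elements that obey both. They exist because labels are values of
  \<open>e\<close>.\<close>

definition cut :: "(nat \<Rightarrow> real) \<Rightarrow> nat \<Rightarrow> real" where
  "cut t k = sum t {..<k}"

text \<open>The number of the interval \<open>[cut t k, cut t (Suc k))\<close> that contains
  \<open>r\<close>. An interval of length zero contains no point and is never the result, so
  vanishing coordinates are invisible to step functions.\<close>

definition idx :: "(nat \<Rightarrow> real) \<Rightarrow> real \<Rightarrow> nat" where
  "idx t r = (LEAST k. r < cut t (Suc k))"

lemma cut_0 [simp]: "cut t 0 = 0"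
  by (simp add: cut_def)

lemma cut_Suc: "cut t (Suc k) = cut t k + t k"
  by (simp add: cut_def)

lemma standard_simplex_iff_cut:
  "t \<in> standard_simplex n \<longleftrightarrow> (\<forall>i. 0 \<le> t i) \<and> (\<forall>i>n. t i = 0) \<and> cut t (Suc n) = 1"
proof -
  have "t i \<le> 1" if "\<forall>i. 0 \<le> t i" "\<forall>i>n. t i = 0" "sum t {..n} = 1" for i
  proof (cases "i \<le> n")
    case True
    then show ?thesis using that member_le_sum[of i "{..n}" t] by auto
  qed (use that in auto)
  then show ?thesis
    unfolding standard_simplex_def cut_def lessThan_Suc_atMost by auto
qed

lemma cut_mono: "\<forall>i. 0 \<le> t i \<Longrightarrow> j \<le> k \<Longrightarrow> cut t j \<le> cut t k"
  unfolding cut_def by (intro sum_mono2) auto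

lemma idx_eqI:
  assumes "\<forall>i. 0 \<le> t i" "cut t k \<le> r" "r < cut t (Suc k)"
  shows "idx t r = k"
  unfolding idx_def
proof (rule Least_equality)
  show "r < cut t (Suc k)" by fact
  fix j assume "r < cut t (Suc j)"
  then show "k \<le> j"
    using assms cut_mono[of t "Suc j" k] by (meson le_less_trans not_less not_less_eq_eq)
qed

lemma idx_bounds:
  assumes "t \<in> standard_simplex n" "0 \<le> r" "r < 1"
  shows "cut t (idx t r) \<le> r" "r < cut t (Suc (idx t r))" "idx t r \<le> n"
proof -
  have n: "r < cut t (Suc n)" using assms by (simp add: standard_simplex_iff_cut)
  show "r < cut t (Suc (idx t r))" unfolding idx_def by (rule LeastI, rule n)
  show "idx t r \<le> n" unfolding idx_def by (rule Least_le, rule n)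
  show "cut t (idx t r) \<le> r"
  proof (cases "idx t r")
    case (Suc j)
    then have "\<not> r < cut t (Suc j)" unfolding idx_def by (metis lessI not_less_Least)
    with Suc show ?thesis by simp
  qed (use assms in simp)
qed

lemma cut_simplical_face:
  "cut (simplical_face i t) k = (if k \<le> i then cut t k else cut t (k - 1))"
proof (induction k)
  case (Suc k)
  then show ?case
    by (cases k) (auto simp: cut_Suc simplical_face_def split: if_splits)
qed simp

lemma cut_codegeneracy:
  "cut (codegeneracy i t) k = (if k \<le> i then cut t k else cut t (Suc k))"
  by (induction k) (auto simp: cut_Suc codegeneracy_def split: if_splits)

lemma simplical_face_in_simplex:
  assumes "t \<in> standard_simplex n" "i \<le> Suc n"
  shows "simplical_face i t \<in> standard_simplex (Suc n)"
  using assms by (intro simplical_face_in_standard_simplex) auto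

lemma codegeneracy_in_simplex:
  assumes "t \<in> standard_simplex (Suc n)" "i \<le> n"
  shows "codegeneracy i t \<in> standard_simplex n"
  using assms unfolding standard_simplex_iff_cut cut_codegeneracy
  by (auto simp: codegeneracy_def)

lemma zero_coordinate_imp_face:
  assumes "t \<in> standard_simplex (Suc n)" "i \<le> Suc n" "t i = 0"
  obtains t' where "t' \<in> standard_simplex n" "t = simplical_face i t'"
proof
  let ?t = "\<lambda>j. if j < i then t j else t (Suc j)"
  show t: "t = simplical_face i ?t"
    using assms by (force simp: simplical_face_def)
  have "cut t (Suc (Suc n)) = cut ?t (Suc n)"
    using assms(2) by (subst t) (simp add: cut_simplical_face)
  then show "?t \<in> standard_simplex n"
    using assms unfolding standard_simplex_iff_cut by auto
qed

text \<open>The inserted interval has length zero, so no \<open>r\<close> gets the number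
  \<open>i\<close>, and the intervals after it are renumbered.\<close>

lemma idx_simplical_face:
  assumes "t \<in> standard_simplex n" "i \<le> Suc n" "0 \<le> r" "r < 1"
  shows "idx (simplical_face i t) r = (if idx t r < i then idx t r else Suc (idx t r))"
  using idx_bounds[OF assms(1,3,4)] simplical_face_in_simplex[OF assms(1,2)]
  by (intro idx_eqI) (auto simp: cut_simplical_face standard_simplex_iff_cut)

text \<open>The codegeneracy erases the cut point between the intervals \<open>i\<close> and
  \<open>i + 1\<close>, which then share the number \<open>i\<close>.\<close>

lemma idx_codegeneracy:
  assumes "t \<in> standard_simplex (Suc n)" "i \<le> n" "0 \<le> r" "r < 1"
  shows "idx (codegeneracy i t) r = (if idx t r \<le> i then idx t r else idx t r - 1)"
proof (rule idx_eqI)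
  note b = idx_bounds[OF assms(1,3,4)]
  have nn: "\<forall>j. 0 \<le> t j" using assms(1) by (simp add: standard_simplex_iff_cut)
  show "\<forall>j. 0 \<le> codegeneracy i t j"
    using codegeneracy_in_simplex[OF assms(1,2)] by (simp add: standard_simplex_iff_cut)
  show "cut (codegeneracy i t) (if idx t r \<le> i then idx t r else idx t r - 1) \<le> r"
    using b cut_mono[OF nn, of "idx t r - 1" "idx t r"]
    by (auto simp: cut_codegeneracy) 
  show "r < cut (codegeneracy i t) (Suc (if idx t r \<le> i then idx t r else idx t r - 1))"
    using b cut_mono[OF nn, of "Suc (idx t r)" "Suc (Suc (idx t r))"]
    by (auto simp: cut_codegeneracy)
qed

text \<open>The cut points of a reduced weighted list are the jumps of its step function, so they are
  found one after the other.\<close>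

lemma reduced_step_aux:
  assumes t: "t \<in> standard_simplex n" "\<forall>i\<le>n. 0 < t i"
    and t': "t' \<in> standard_simplex n'" "\<forall>i\<le>n'. 0 < t' i"
    and v: "\<forall>i<n. v i \<noteq> v (Suc i)" and v': "\<forall>i<n'. v' i \<noteq> v' (Suc i)"
    and eq: "\<forall>r. 0 \<le> r \<longrightarrow> r < 1 \<longrightarrow> v (idx t r) = v' (idx t' r)"
  shows "j \<le> n \<Longrightarrow> j \<le> n' \<and> cut t j = cut t' j \<and> v j = v' j"
proof (induction j)
  case 0
  have "idx t 0 = 0" "idx t' 0 = 0"
    using assms by (auto intro!: idx_eqI simp: standard_simplex_iff_cut cut_Suc)
  then show ?case using eq[rule_format, of 0] by simp
next
  case (Suc j)
  have nn: "\<forall>i. 0 \<le> t i" "\<forall>i. 0 \<le> t' i" and one: "cut t (Suc n) = 1" "cut t' (Suc n') = 1"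
    using t(1) t'(1) by (auto simp: standard_simplex_iff_cut)
  have IH: "j \<le> n'" "cut t j = cut t' j" "v j = v' j" using Suc by auto
  have pos: "0 < t j" "0 < t' j" "0 < t (Suc j)" using t(2) t'(2) Suc.prems IH by auto
  have c0: "0 \<le> cut t j" using cut_mono[OF nn(1), of 0 j] by simp
  have lt1: "cut t (Suc j) < 1"
    using cut_mono[OF nn(1), of "Suc (Suc j)" "Suc n"] Suc.prems pos one by (auto simp: cut_Suc)
  \<comment> \<open>Were the interval of \<open>t'\<close> longer, then at the point
    \<open>cut t (Suc j)\<close> the first function would already have its next value and the second
    one still the old value.\<close>
  have 1: "cut t' (Suc j) \<le> cut t (Suc j)"
  proof (rule ccontr)
    assume a: "\<not> ?thesis"
    have "idx t (cut t (Suc j)) = Suc j" by (rule idx_eqI) (use nn pos in \<open>auto simp: cut_Suc\<close>)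
    moreover have "idx t' (cut t (Suc j)) = j"
      by (rule idx_eqI) (use nn pos IH a in \<open>auto simp: cut_Suc\<close>)
    ultimately have "v (Suc j) = v j" using eq[rule_format, of "cut t (Suc j)"] lt1 IH c0 pos by (auto simp: cut_Suc)
    then show False using v[rule_format, of j] Suc.prems by simp
  qed
  \<comment> \<open>The jump just found lies before 1, so interval \<open>j\<close> cannot be the
    last one of \<open>t'\<close>.\<close>
  have jn: "Suc j \<le> n'"
  proof (rule ccontr)
    assume "\<not> ?thesis"
    then have "j = n'" using IH(1) by linarith
    with one(2) have "cut t' (Suc j) = 1" by blast
    with 1 lt1 show False by linarith
  qed
  then have pos': "0 < t' (Suc j)" using t'(2) by auto
  have 2: "cut t (Suc j) \<le> cut t' (Suc j)"
  proof (rule ccontr)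
    assume a: "\<not> ?thesis"
    have "idx t' (cut t' (Suc j)) = Suc j" by (rule idx_eqI) (use nn pos' in \<open>auto simp: cut_Suc\<close>)
    moreover have "idx t (cut t' (Suc j)) = j"
      by (rule idx_eqI) (use nn pos IH a in \<open>auto simp: cut_Suc\<close>)
    ultimately have "v j = v' (Suc j)"
      using eq[rule_format, of "cut t' (Suc j)"] lt1 1 IH c0 pos by (auto simp: cut_Suc)
    then show False using v'[rule_format, of j] jn IH by simp
  qed
  have i1: "idx t (cut t (Suc j)) = Suc j" by (rule idx_eqI) (use nn pos in \<open>auto simp: cut_Suc\<close>)
  have i2: "idx t' (cut t (Suc j)) = Suc j"
    by (rule idx_eqI) (use nn pos' 1 2 in \<open>auto simp: cut_Suc\<close>)
  have "v (Suc j) = v' (Suc j)" using eq[rule_format, of "cut t (Suc j)"] lt1 c0 pos i1 i2 by (auto simp: cut_Suc)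
  with jn 1 2 show ?case by auto
qed

lemma reduced_step_unique:
  assumes t: "t \<in> standard_simplex n" "\<forall>i\<le>n. 0 < t i"
    and t': "t' \<in> standard_simplex n'" "\<forall>i\<le>n'. 0 < t' i"
    and v: "\<forall>i<n. v i \<noteq> v (Suc i)" and v': "\<forall>i<n'. v' i \<noteq> v' (Suc i)"
    and eq: "\<forall>r. 0 \<le> r \<longrightarrow> r < 1 \<longrightarrow> v (idx t r) = v' (idx t' r)"
  shows "n' = n" "t' = t" "\<And>j. j \<le> n \<Longrightarrow> v' j = v j"
proof -
  note A = reduced_step_aux[OF assms]
  have eq': "\<forall>r. 0 \<le> r \<longrightarrow> r < 1 \<longrightarrow> v' (idx t' r) = v (idx t r)" using eq by simp
  \<comment> \<open>One direction only bounds \<open>n\<close> by \<open>n'\<close>; exchanging the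
    roles gives the equality.\<close>
  note B = reduced_step_aux[OF t' t v' v eq']
  show n: "n' = n" using A[of n, THEN conjunct1] B[of n', THEN conjunct1] by (meson le_antisym order_refl)
  show "v' j = v j" if "j \<le> n" for j using A[OF that] by simp
  have c: "cut t j = cut t' j" if "j \<le> Suc n" for j
  proof (cases "j = Suc n")
    case True
    then show ?thesis using t(1) t'(1) n by (simp add: standard_simplex_iff_cut)
  qed (use that A[of j] in auto)
  show "t' = t"
  proof
    fix i show "t' i = t i"
    proof (cases "i \<le> n")
      case True
      then show ?thesis using c[of i] c[of "Suc i"] by (simp add: cut_Suc)
    next
      case False
      then show ?thesis using t(1) t'(1) n by (simp add: standard_simplex_iff_cut)
    qed
  qed
qed

text \<open>The vertices of a bar simplex: the string \<open>[g1, ..., gn]\<close> stands for the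
  simplex with vertices 1, g1, g1 g2, ... of the universal cover, taken up to left
  translation.\<close>

definition gval :: "('g, 'm) monoid_scheme \<Rightarrow> 'g list \<Rightarrow> nat \<Rightarrow> 'g" where
  "gval G xs k = foldr (\<otimes>\<^bsub>G\<^esub>) (take k xs) \<one>\<^bsub>G\<^esub>"

lemma gval_subgroup [simp]: "gval (G\<lparr>carrier := U\<rparr>) = gval G"
  by (simp add: gval_def fun_eq_iff)

lemma gval_0 [simp]: "gval G xs 0 = \<one>\<^bsub>G\<^esub>"
  by (simp add: gval_def)

section \<open>Vertices of bar simplices under faces and degeneracies\<close>

context group begin

lemma foldr_closed: "set xs \<subseteq> carrier G \<Longrightarrow> foldr (\<otimes>) xs \<one> \<in> carrier G"
  by (induction xs) auto

lemma foldr_append_one: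
  assumes "set xs \<subseteq> carrier G" "set ys \<subseteq> carrier G"
  shows "foldr (\<otimes>) (xs @ ys) \<one> = foldr (\<otimes>) xs \<one> \<otimes> foldr (\<otimes>) ys \<one>"
proof -
  have *: "foldr (\<otimes>) xs z = foldr (\<otimes>) xs \<one> \<otimes> z" if "z \<in> carrier G" for z
    using assms(1) that by (induction xs) (auto simp: m_assoc foldr_closed)
  show ?thesis using *[OF foldr_closed[OF assms(2)]] by simp
qed

lemma set_take_carrier: "set xs \<subseteq> carrier G \<Longrightarrow> set (take k xs) \<subseteq> carrier G"
  using set_take_subset by fast

lemma set_drop_carrier: "set xs \<subseteq> carrier G \<Longrightarrow> set (drop k xs) \<subseteq> carrier G"
  using set_drop_subset by fast

lemma gval_closed [simp]: "set xs \<subseteq> carrier G \<Longrightarrow> gval G xs k \<in> carrier G"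
  unfolding gval_def using foldr_closed set_take_carrier by blast

lemma gval_Suc:
  assumes "set xs \<subseteq> carrier G" "k < length xs"
  shows "gval G xs (Suc k) = gval G xs k \<otimes> xs ! k"
proof -
  have "xs ! k \<in> carrier G" using assms by auto
  then show ?thesis
    using assms foldr_append_one[of "take k xs" "[xs ! k]"] set_take_carrier[OF assms(1)]
    by (simp add: gval_def take_Suc_conv_app_nth)
qed

text \<open>Face 0 drops the vertex 1 and translates the others so that the first one is 1 again.
  This is the reason why step functions only count up to left translation.\<close>

lemma gval_bar_face_0:
  assumes "set xs \<subseteq> carrier G" "xs \<noteq> []"
  shows "hd xs \<otimes> gval G (bar_face G 0 xs) k = gval G xs (Suc k)"
  using assms by (cases xs) (auto simp: gval_def bar_face_def)

text \<open>Multiplying two neighbouring entries skips one partial product and leaves all later ones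
  unchanged, so vertex \<open>i\<close> is omitted and nothing is translated.\<close>

lemma gval_bar_face:
  assumes xs: "set xs \<subseteq> carrier G" and i: "0 < i" "i \<le> length xs" and k: "k < length xs"
  shows "gval G (bar_face G i xs) k = gval G xs (if k < i then k else Suc k)"
proof (cases "i = length xs")
  case True
  then show ?thesis using assms by (auto simp: gval_def bar_face_def butlast_conv_take min_def)
next
  case False
  then have il: "i < length xs" using i by simp
  have face: "bar_face G i xs = take (i - 1) xs @ [xs ! (i - 1) \<otimes> xs ! i] @ drop (i + 1) xs"
    using i False by (simp add: bar_face_def)
  show ?thesis
  proof (cases "k < i")
    case True
    then show ?thesis using il by (auto simp: gval_def face min_def Suc_leI)
  next
    case k': False
    have 1: "take k (bar_face G i xs) = take (i-1) xs @ [xs ! (i - 1) \<otimes> xs ! i] @ take (k-i) (drop (i+1) xs)"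
  proof -
      have "k - (i - 1) = Suc (k - i)" "min (length xs) (i - 1) = i - 1" using k' i il by auto
      then show ?thesis using k' i il by (simp add: face)
    qed
    have 2: "take (Suc k) xs = take (i-1) xs @ [xs ! (i - 1), xs ! i] @ take (k-i) (drop (i+1) xs)"
    proof -
      have "take (Suc k) xs = take (i+1) xs @ take (k-i) (drop (i+1) xs)"
        using k' take_add[of "i+1" "k-i" xs] by simp
      moreover have "take (i+1) xs = take (i-1) xs @ [xs ! (i - 1), xs ! i]"
      proof -
        have "take (Suc i) xs = take i xs @ [xs ! i]" by (rule take_Suc_conv_app_nth[OF il])
        moreover have "take (Suc (i-1)) xs = take (i-1) xs @ [xs ! (i-1)]"
          by (rule take_Suc_conv_app_nth) (use il in simp)
        moreover have "Suc (i-1) = i" "i + 1 = Suc i" using i by auto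
        ultimately show ?thesis by (metis append.assoc append_Cons append_Nil)
      qed
      ultimately show ?thesis by simp
    qed
    have c: "xs ! (i-1) \<in> carrier G" "xs ! i \<in> carrier G" "set (take (i-1) xs) \<subseteq> carrier G"
      using xs il i set_take_carrier[OF xs, of "i-1"] by (auto simp: subset_iff)
    have c2: "set (take (k-i) (drop (i+1) xs)) \<subseteq> carrier G"
      using xs set_take_carrier set_drop_carrier by blast
    define z where "z = foldr (\<otimes>) (take (k-i) (drop (i+1) xs)) \<one>"
    have z: "z \<in> carrier G" unfolding z_def by (rule foldr_closed[OF c2])
    have "gval G (bar_face G i xs) k = foldr (\<otimes>) (take (i-1) xs) \<one> \<otimes> (xs ! (i - 1) \<otimes> xs ! i \<otimes> z)"
      unfolding gval_def 1 z_def using c c2 by (subst foldr_append_one) auto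
    also have "\<dots> = foldr (\<otimes>) (take (i-1) xs) \<one> \<otimes> (xs ! (i - 1) \<otimes> (xs ! i \<otimes> z))"
      using c z by (simp add: m_assoc)
    also have "\<dots> = gval G xs (Suc k)"
      unfolding gval_def 2 z_def using c c2 by (subst foldr_append_one) auto
    finally show ?thesis using k' by simp
  qed
qed

lemma gval_bar_degeneracy:
  assumes xs: "set xs \<subseteq> carrier G" and i: "i \<le> length xs"
  shows "gval G (bar_degeneracy G i xs) k = gval G xs (if k \<le> i then k else k - 1)"
proof (cases "k \<le> i")
  case True
  then show ?thesis using i by (simp add: gval_def bar_degeneracy_def min_def)
next
  case False
  have 1: "take k (bar_degeneracy G i xs) = take i xs @ \<one> # take (k - 1 - i) (drop i xs)"
  proof -
    have "k - i = Suc (k - 1 - i)" using False by simp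
    then show ?thesis using i False by (simp add: bar_degeneracy_def min_def)
  qed
  have 2: "take (k - 1) xs = take i xs @ take (k - 1 - i) (drop i xs)"
    using False take_add[of i "k-1-i" xs] by simp
  have c: "set (take i xs) \<subseteq> carrier G" "set (take (k - 1 - i) (drop i xs)) \<subseteq> carrier G"
    using xs by (auto intro!: set_take_carrier set_drop_carrier)
  show ?thesis
    using False c unfolding gval_def 1 by (simp add: 2[unfolded One_nat_def] foldr_closed)
qed

lemma bar_face_closed:
  assumes "set xs \<subseteq> carrier G" "length xs = Suc n" "i \<le> Suc n"
  shows "set (bar_face G i xs) \<subseteq> carrier G \<and> length (bar_face G i xs) = n"
proof -
  consider "i = 0" | "i = length xs" "i \<noteq> 0" | "0 < i" "i < length xs" using assms by linarith
  then show ?thesis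
  proof cases
    case 1
    then show ?thesis using assms by (cases xs) (auto simp: bar_face_def)
  next
    case 2
    then show ?thesis using assms by (auto simp: bar_face_def subset_iff dest: in_set_butlastD)
  next
    case 3
    then have "xs ! (i - 1) \<in> carrier G" "xs ! i \<in> carrier G" using assms by auto
    then show ?thesis
      using 3 assms(2,3) set_take_carrier[OF assms(1), of "i-1"] set_drop_carrier[OF assms(1), of "i+1"]
      by (simp add: bar_face_def)
  qed
qed

lemma bar_degeneracy_closed:
  assumes "set xs \<subseteq> carrier G" "length xs = n" "i \<le> n"
  shows "set (bar_degeneracy G i xs) \<subseteq> carrier G \<and> length (bar_degeneracy G i xs) = Suc n"
  using assms(2,3) set_take_carrier[OF assms(1), of i] set_drop_carrier[OF assms(1), of i]
  by (simp add: bar_degeneracy_def)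

end

section \<open>Points of classifying spaces as step functions\<close>

definition bar_rep :: "('g, 'm) monoid_scheme \<Rightarrow> (real \<Rightarrow> 'g) \<Rightarrow> nat \<times> 'g list \<times> (nat \<Rightarrow> real) \<Rightarrow> bool" where
  "bar_rep G e = (\<lambda>(n, xs, t). set xs \<subseteq> carrier G \<and> length xs = n \<and> t \<in> standard_simplex n \<and>
     (\<exists>g\<in>carrier G. \<forall>r\<in>{0..<1}. e r = g \<otimes>\<^bsub>G\<^esub> gval G xs (idx t r)))"

text \<open>A class is the set of all representatives of a function, so equal functions give equal
  points. The set is empty if no representative exists, hence existence is carried along as a
  separate fact.\<close>

definition bar_class :: "('g, 'm) monoid_scheme \<Rightarrow> (real \<Rightarrow> 'g) \<Rightarrow> 'g classifying_point" where
  "bar_class G e = {p. bar_rep G e p}"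

abbreviation bar_glue where
  "bar_glue G \<equiv> glue_rel (bar G) (bar_face G) (bar_degeneracy G)"

lemma topspace_simplex_sum_iff [simp]:
  "(n, x, t) \<in> topspace (simplex_sum X) \<longleftrightarrow> x \<in> topspace (X n) \<and> t \<in> standard_simplex n"
  by (auto simp: simplex_sum_def simplex_topology_def)

lemma topspace_bar [simp]: "xs \<in> topspace (bar G n) \<longleftrightarrow> set xs \<subseteq> carrier G \<and> length xs = n"
  by (simp add: bar_def)

lemma bar_rep_in_topspace: "bar_rep G e p \<Longrightarrow> p \<in> topspace (simplex_sum (bar G))"
  by (auto simp: bar_rep_def)

lemma glue_relI:
  "\<lbrakk>p \<in> topspace (simplex_sum X); q \<in> topspace (simplex_sum X); glue X \<delta> \<sigma> p q \<or> glue X \<delta> \<sigma> q p\<rbrakk>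
    \<Longrightarrow> (p, q) \<in> glue_rel X \<delta> \<sigma>"
  unfolding glue_rel_def equivclp_def by (auto simp: symclp_def)

lemma glue_rel_sym: "(p, q) \<in> glue_rel X \<delta> \<sigma> \<Longrightarrow> (q, p) \<in> glue_rel X \<delta> \<sigma>"
  using equiv_glue_rel[of X \<delta> \<sigma>] by (meson equivE symD)

lemma glue_rel_trans:
  "(p, q) \<in> glue_rel X \<delta> \<sigma> \<Longrightarrow> (q, r) \<in> glue_rel X \<delta> \<sigma> \<Longrightarrow> (p, r) \<in> glue_rel X \<delta> \<sigma>"
  using equiv_glue_rel[of X \<delta> \<sigma>] by (meson equivE transD)

lemma glue_rel_refl: "p \<in> topspace (simplex_sum X) \<Longrightarrow> (p, p) \<in> glue_rel X \<delta> \<sigma>"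
  using equiv_glue_rel[of X \<delta> \<sigma>] by (meson equivE refl_onD)

section \<open>Normal forms in a realization\<close>

lemma glue_rel_invariant:
  assumes "(p, q) \<in> glue_rel X \<delta> \<sigma>" "\<And>p q. glue X \<delta> \<sigma> p q \<Longrightarrow> Q p \<longleftrightarrow> Q q"
  shows "Q p \<longleftrightarrow> Q q"
proof -
  have "equivclp (glue X \<delta> \<sigma>) p q" using assms(1) by (simp add: glue_rel_def)
  then show ?thesis by (induction rule: equivclp_induct) (use assms(2) in blast)+
qed

text \<open>Existence half of the Eilenberg-Zilber normal form: a vanishing coordinate is removed by
  a face, a degenerate simplex by a codegeneracy, and each step lowers the dimension.
  \<open>D\<close> is a readable criterion for degeneracy. Uniqueness is obtained separately from
  step functions.\<close>

lemma reduce_to_normal_form: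
  fixes X :: "nat \<Rightarrow> 'a topology"
  assumes face: "\<And>n i x. x \<in> topspace (X (Suc n)) \<Longrightarrow> i \<le> Suc n \<Longrightarrow> \<delta> i x \<in> topspace (X n)"
    and deg: "\<And>n i x. x \<in> topspace (X (Suc n)) \<Longrightarrow> i \<le> n \<Longrightarrow> D n i x \<Longrightarrow>
      \<exists>y\<in>topspace (X n). x = \<sigma> i y"
    and p: "x \<in> topspace (X n)" "t \<in> standard_simplex n"
  shows "\<exists>m y u. ((n, x, t), (m, y, u)) \<in> glue_rel X \<delta> \<sigma> \<and> (\<forall>i\<le>m. 0 < u i) \<and>
    (\<forall>k i. m = Suc k \<longrightarrow> i \<le> k \<longrightarrow> \<not> D k i y)"
  using p
proof (induction n arbitrary: x t)
  case 0
  then have "((0, x, t), (0, x, t)) \<in> glue_rel X \<delta> \<sigma>" by (intro glue_rel_refl) simp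
  moreover have "0 < t 0" using 0 by (simp add: standard_simplex_iff_cut cut_Suc)
  ultimately show ?case by fastforce
next
  case (Suc n)
  have top: "(Suc n, x, t) \<in> topspace (simplex_sum X)" using Suc by simp
  show ?case
  proof (cases "\<exists>i\<le>Suc n. t i = 0")
    case True
    then obtain i where i: "i \<le> Suc n" "t i = 0" by blast
    obtain t' where t': "t' \<in> standard_simplex n" "t = simplical_face i t'"
      using zero_coordinate_imp_face[OF Suc.prems(2) i] by blast
    have "((Suc n, x, t), (n, \<delta> i x, t')) \<in> glue_rel X \<delta> \<sigma>"
      using glue.face[of x X n t' i \<delta> \<sigma>, OF Suc.prems(1) t'(1) i(1)] t' top face[OF Suc.prems(1) i(1)]
      by (intro glue_relI) auto
    then show ?thesis
      using Suc.IH[OF face[OF Suc.prems(1) i(1)] t'(1)] glue_rel_trans by meson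
  next
    case False
    then have pos: "\<forall>i\<le>Suc n. 0 < t i"
      using Suc.prems(2) by (metis less_eq_real_def standard_simplex_iff_cut)
    show ?thesis
    proof (cases "\<exists>i\<le>n. D n i x")
      case True
      then obtain i y where i: "i \<le> n" "y \<in> topspace (X n)" "x = \<sigma> i y"
        using deg Suc.prems(1) by meson
      have "((Suc n, x, t), (n, y, codegeneracy i t)) \<in> glue_rel X \<delta> \<sigma>"
        using glue.degeneracy[of y X n t i \<delta> \<sigma>, OF i(2) Suc.prems(2) i(1)] i top
          codegeneracy_in_simplex[OF Suc.prems(2) i(1)]
        by (intro glue_relI) auto
      then show ?thesis
        using Suc.IH[OF i(2) codegeneracy_in_simplex[OF Suc.prems(2) i(1)]] glue_rel_trans by meson
    next
      case False
      then show ?thesis using pos glue_rel_refl[OF top] by blast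
    qed
  qed
qed

context group begin

text \<open>Each generating identification leaves the step function unchanged up to translation: it
  inserts an empty interval or merges two neighbouring intervals with equal values.\<close>

lemma glue_bar_rep:
  assumes "glue (bar G) (bar_face G) (bar_degeneracy G) p q"
  shows "bar_rep G e p \<longleftrightarrow> bar_rep G e q"
  using assms
proof cases
  case (face x n t i)
  have x: "set x \<subseteq> carrier G" "length x = Suc n" using face by auto
  have p: "set (bar_face G i x) \<subseteq> carrier G" "length (bar_face G i x) = n"
    using bar_face_closed[OF x face(5)] by auto
  have t: "simplical_face i t \<in> standard_simplex (Suc n)"
    using simplical_face_in_simplex face by blast
  have idx: "idx (simplical_face i t) r = (if idx t r < i then idx t r else Suc (idx t r))"
      "idx t r < length x" if "r \<in> {0..<1}" for r
    using idx_simplical_face[OF face(4,5)] idx_bounds(3)[OF face(4)] that x by (auto simp: le_imp_less_Suc)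
  show ?thesis
  proof (cases "i = 0")
    case False
    have "gval G x (idx (simplical_face i t) r) = gval G (bar_face G i x) (idx t r)" if "r \<in> {0..<1}" for r
      using gval_bar_face[OF x(1) _ _ idx(2)[OF that], of i] False face(5) x idx(1)[OF that] by simp
    then show ?thesis using face x p t by (simp add: bar_rep_def)
  next
    case True
    have hd: "hd x \<in> carrier G" using x by (cases x) auto
    have eq: "gval G x (idx (simplical_face i t) r) = hd x \<otimes> gval G (bar_face G i x) (idx t r)"
      if "r \<in> {0..<1}" for r
    proof -
      have "x \<noteq> []" using x by auto
      from gval_bar_face_0[OF x(1) this] show ?thesis using True idx(1)[OF that] by simp
    qed
    \<comment> \<open>The translation by \<open>hd x\<close> caused by face 0 is absorbed into the
      constant \<open>g\<close>.\<close>
    have "(\<exists>g\<in>carrier G. \<forall>r\<in>{0..<1}. e r = g \<otimes> gval G (bar_face G i x) (idx t r)) \<longleftrightarrow>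
      (\<exists>g\<in>carrier G. \<forall>r\<in>{0..<1}. e r = g \<otimes> gval G x (idx (simplical_face i t) r))" (is "?l \<longleftrightarrow> ?r")
    proof
      assume ?l
      then obtain g where g: "g \<in> carrier G" "\<forall>r\<in>{0..<1}. e r = g \<otimes> gval G (bar_face G i x) (idx t r)" by blast
      then have "\<forall>r\<in>{0..<1}. e r = (g \<otimes> inv hd x) \<otimes> gval G x (idx (simplical_face i t) r)"
        using hd p x by (simp add: eq m_assoc) (simp add: m_assoc[symmetric])
      then show ?r using g hd by blast
    next
      assume ?r
      then obtain g where g: "g \<in> carrier G"
        "\<forall>r\<in>{0..<1}. e r = g \<otimes> gval G x (idx (simplical_face i t) r)" by blast
      then have "\<forall>r\<in>{0..<1}. e r = (g \<otimes> hd x) \<otimes> gval G (bar_face G i x) (idx t r)"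
        using hd p x by (simp add: eq m_assoc)
      then show ?l using g hd by blast
    qed
    then show ?thesis using face x p t by (simp add: bar_rep_def)
  qed
next
  case (degeneracy x n t i)
  have x: "set x \<subseteq> carrier G" "length x = n" using degeneracy by auto
  have q: "set (bar_degeneracy G i x) \<subseteq> carrier G" "length (bar_degeneracy G i x) = Suc n"
    using bar_degeneracy_closed[OF x degeneracy(5)] by auto
  have "gval G (bar_degeneracy G i x) (idx t r) = gval G x (idx (codegeneracy i t) r)" if "r \<in> {0..<1}" for r
    using gval_bar_degeneracy[OF x(1)] degeneracy x idx_codegeneracy[OF degeneracy(4,5)] that by simp
  then show ?thesis
    using degeneracy x q codegeneracy_in_simplex[OF degeneracy(4,5)] by (simp add: bar_rep_def)
qed

lemma glue_rel_bar_rep: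
  "(p, q) \<in> bar_glue G \<Longrightarrow> bar_rep G e p \<longleftrightarrow> bar_rep G e q"
  by (erule glue_rel_invariant) (rule glue_bar_rep)

text \<open>In normal form all intervals are nonempty and neighbouring values differ, so lengths and
  values can be read off from \<open>e\<close>. Both lists of vertices start with 1, so the
  translating constants agree with \<open>e 0\<close> and hence with each other.\<close>

lemma bar_rep_reduced_unique:
  assumes p: "bar_rep G e (n, xs, t)" "\<forall>i\<le>n. 0 < t i" "\<forall>i<n. xs ! i \<noteq> \<one>"
    and q: "bar_rep G e (m, ys, u)" "\<forall>i\<le>m. 0 < u i" "\<forall>i<m. ys ! i \<noteq> \<one>"
  shows "(m, ys, u) = (n, xs, t)"
proof -
  from p obtain g where g: "g \<in> carrier G" "\<forall>r\<in>{0..<1}. e r = g \<otimes> gval G xs (idx t r)"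
    and xs: "set xs \<subseteq> carrier G" "length xs = n" and t: "t \<in> standard_simplex n"
    by (auto simp: bar_rep_def)
  from q obtain h where h: "h \<in> carrier G" "\<forall>r\<in>{0..<1}. e r = h \<otimes> gval G ys (idx u r)"
    and ys: "set ys \<subseteq> carrier G" "length ys = m" and u: "u \<in> standard_simplex m"
    by (auto simp: bar_rep_def)
  have xsi: "xs ! i \<in> carrier G" if "i < n" for i using xs that by auto
  have ysi: "ys ! i \<in> carrier G" if "i < m" for i using ys that by auto
  have 1: "\<forall>i<n. g \<otimes> gval G xs i \<noteq> g \<otimes> gval G xs (Suc i)"
    using g xs p(3) xsi by (auto simp: gval_Suc r_cancel_one')
  have 2: "\<forall>i<m. h \<otimes> gval G ys i \<noteq> h \<otimes> gval G ys (Suc i)"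
    using h ys q(3) ysi by (auto simp: gval_Suc r_cancel_one')
  have "\<forall>r. 0 \<le> r \<longrightarrow> r < 1 \<longrightarrow> g \<otimes> gval G xs (idx t r) = h \<otimes> gval G ys (idx u r)"
    using g h by auto
  note U = reduced_step_unique[OF t p(2) u q(2) 1 2 this]
  have gh: "h = g" using U(3)[of 0] g h by simp
  have *: "gval G ys j = gval G xs j" if "j \<le> n" for j
    using U(3)[OF that] gh g(1) xs ys by simp
  have "ys ! j = xs ! j" if "j < n" for j
  proof -
    have "gval G xs j \<otimes> ys ! j = gval G xs j \<otimes> xs ! j"
      using *[of j] *[of "Suc j"] that gval_Suc[OF xs(1), of j] gval_Suc[OF ys(1), of j] xs(2) ys(2) U(1) by simp
    then show ?thesis using xs(1) xsi[OF that] ysi[of j] U(1) that by simp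
  qed
  then have "ys = xs" using xs ys U(1) by (intro nth_equalityI) auto
  with U show ?thesis by simp
qed

lemma bar_rep_reduce:
  assumes "bar_rep G e p"
  shows "\<exists>n xs t. (p, (n, xs, t)) \<in> bar_glue G \<and> bar_rep G e (n, xs, t) \<and>
    (\<forall>i\<le>n. 0 < t i) \<and> (\<forall>i<n. xs ! i \<noteq> \<one>)"
proof -
  obtain n x t where p: "p = (n, x, t)" by (cases p)
  have x: "x \<in> topspace (bar G n)" "t \<in> standard_simplex n" using assms p by (auto simp: bar_rep_def)
  have "\<exists>m y u. ((n, x, t), (m, y, u)) \<in> bar_glue G \<and> (\<forall>i\<le>m. 0 < u i) \<and>
    (\<forall>k i. m = Suc k \<longrightarrow> i \<le> k \<longrightarrow> \<not> y ! i = \<one>)"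
  proof (rule reduce_to_normal_form[where X = "bar G" and D = "\<lambda>k i y. y ! i = \<one>", OF _ _ x])
    show "bar_face G i x \<in> topspace (bar G n)" if "x \<in> topspace (bar G (Suc n))" "i \<le> Suc n" for n i x
      using bar_face_closed that by auto
    show "\<exists>y\<in>topspace (bar G n). x = bar_degeneracy G i y"
      if "x \<in> topspace (bar G (Suc n))" "i \<le> n" "x ! i = \<one>" for n i x
    proof
      have "x = take i x @ x ! i # drop (Suc i) x" using that by (intro id_take_nth_drop) auto
      then show "x = bar_degeneracy G i (take i x @ drop (Suc i) x)"
        using that by (simp add: bar_degeneracy_def min_def)
      show "take i x @ drop (Suc i) x \<in> topspace (bar G n)"
        using that set_take_carrier[of x i] set_drop_carrier[of x "Suc i"] by auto
    qed
  qed
  then obtain m y u where y: "(p, (m, y, u)) \<in> bar_glue G" "\<forall>i\<le>m. 0 < u i"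
     "\<forall>k i. m = Suc k \<longrightarrow> i \<le> k \<longrightarrow> \<not> y ! i = \<one>"
    using p by blast
  have "\<forall>i<m. y ! i \<noteq> \<one>"
    using y(3) by (cases m) auto
  then show ?thesis using y glue_rel_bar_rep[OF y(1)] assms by blast
qed

text \<open>Both representatives reduce to the same normal form. With
  \<open>glue_rel_bar_rep\<close> this identifies points of the classifying space with step
  functions up to translation.\<close>

lemma bar_rep_imp_glue:
  assumes "bar_rep G e p" "bar_rep G e q"
  shows "(p, q) \<in> bar_glue G"
proof -
  obtain n xs t where 1: "(p, (n, xs, t)) \<in> bar_glue G" "bar_rep G e (n, xs, t)"
    "\<forall>i\<le>n. 0 < t i" "\<forall>i<n. xs ! i \<noteq> \<one>" using bar_rep_reduce[OF assms(1)] by blast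
  obtain m ys u where 2: "(q, (m, ys, u)) \<in> bar_glue G" "bar_rep G e (m, ys, u)"
    "\<forall>i\<le>m. 0 < u i" "\<forall>i<m. ys ! i \<noteq> \<one>" using bar_rep_reduce[OF assms(2)] by blast
  have "(m, ys, u) = (n, xs, t)" by (rule bar_rep_reduced_unique[OF 1(2-4) 2(2-4)])
  then show ?thesis using 1(1) 2(1) glue_rel_sym glue_rel_trans by metis
qed

lemma bar_class_eq: "bar_rep G e p \<Longrightarrow> bar_class G e = bar_glue G `` {p}"
  unfolding bar_class_def using bar_rep_imp_glue glue_rel_bar_rep by blast

lemma bar_rep_self:
  assumes "set xs \<subseteq> carrier G" "length xs = n" "t \<in> standard_simplex n"
  shows "bar_rep G (\<lambda>r. gval G xs (idx t r)) (n, xs, t)"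
  unfolding bar_rep_def using assms by (auto intro!: bexI[of _ \<one>])

lemma bar_rep_translate:
  assumes "bar_rep G e p" "g \<in> carrier G" "\<forall>r\<in>{0..<1}. e' r = g \<otimes> e r"
  shows "bar_rep G e' p"
proof -
  obtain n x t where p: "p = (n, x, t)" by (cases p)
  obtain h where h: "h \<in> carrier G" "\<forall>r\<in>{0..<1}. e r = h \<otimes> gval G x (idx t r)"
    and x: "set x \<subseteq> carrier G" using assms p by (auto simp: bar_rep_def)
  have "\<forall>r\<in>{0..<1}. e' r = (g \<otimes> h) \<otimes> gval G x (idx t r)" using assms h x by (simp add: m_assoc)
  then show ?thesis using assms(1,2) h(1) p unfolding bar_rep_def by auto
qed

lemma bar_rep_unique_function:
  assumes "bar_rep G e p" "bar_rep G e' p"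
  shows "\<exists>g\<in>carrier G. \<forall>r\<in>{0..<1}. e' r = g \<otimes> e r"
proof -
  obtain n x t where p: "p = (n, x, t)" by (cases p)
  obtain h where h: "h \<in> carrier G" "\<forall>r\<in>{0..<1}. e r = h \<otimes> gval G x (idx t r)"
    and x: "set x \<subseteq> carrier G" using assms p by (auto simp: bar_rep_def)
  obtain k where k: "k \<in> carrier G" "\<forall>r\<in>{0..<1}. e' r = k \<otimes> gval G x (idx t r)"
    using assms p by (auto simp: bar_rep_def)
  have "\<forall>r\<in>{0..<1}. e' r = (k \<otimes> inv h) \<otimes> e r"
    using h k x by (simp add: m_assoc) (simp add: m_assoc[symmetric])
  then show ?thesis using h k by blast
qed

lemma bar_rep_closed: "bar_rep G e p \<Longrightarrow> r \<in> {0..<1} \<Longrightarrow> e r \<in> carrier G"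
  unfolding bar_rep_def by auto

lemma bar_class_translate:
  assumes "bar_rep G e p" "g \<in> carrier G" "\<forall>r\<in>{0..<1}. e' r = g \<otimes> e r"
  shows "bar_class G e' = bar_class G e"
  using bar_class_eq[OF assms(1)] bar_class_eq[OF bar_rep_translate[OF assms]] by simp

lemma topspace_classifying_space:
  "topspace (classifying_space G) = topspace (simplex_sum (bar G)) // bar_glue G"
  unfolding classifying_space_def realization_def
  by (rule topspace_quotient_topology[OF equiv_glue_rel])

lemma bar_class_in_topspace: "bar_rep G e p \<Longrightarrow> bar_class G e \<in> topspace (classifying_space G)"
  unfolding topspace_classifying_space
  by (simp add: bar_class_eq bar_rep_in_topspace quotientI)

lemma classifying_point_cases:
  assumes "c \<in> topspace (classifying_space G)"
  obtains n xs t where "set xs \<subseteq> carrier G" "length xs = n" "t \<in> standard_simplex n"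
    "c = bar_glue G `` {(n, xs, t)}" "c = bar_class G (\<lambda>r. gval G xs (idx t r))"
    "bar_rep G (\<lambda>r. gval G xs (idx t r)) (n, xs, t)"
proof -
  obtain p where p: "p \<in> topspace (simplex_sum (bar G))" "c = bar_glue G `` {p}"
    using assms unfolding topspace_classifying_space by (auto elim: quotientE)
  obtain n xs t where "p = (n, xs, t)" by (cases p)
  then show thesis using that[of xs n t] p bar_class_eq[OF bar_rep_self] bar_rep_self by auto
qed

lemma bar_rep_of_class_eq: "bar_class G e = bar_class G e' \<Longrightarrow> bar_rep G e p \<Longrightarrow> bar_rep G e' p"
  unfolding bar_class_def by blast

lemma bar_rep_subgroup:
  assumes "subgroup U G" "bar_rep (G\<lparr>carrier := U\<rparr>) e p" "U \<subseteq> W"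
  shows "bar_rep (G\<lparr>carrier := W\<rparr>) e p"
  using assms unfolding bar_rep_def by (auto split: prod.splits)

text \<open>An inclusion does not touch the step function; only the group of admissible translations
  grows.\<close>

lemma classifying_map_bar_class:
  assumes U: "subgroup U G" and W: "subgroup W G" and UW: "U \<subseteq> W" and e: "bar_rep (G\<lparr>carrier := U\<rparr>) e p"
  shows "classifying_map (G\<lparr>carrier := W\<rparr>) (\<lambda>g. g) (bar_class (G\<lparr>carrier := U\<rparr>) e) = bar_class (G\<lparr>carrier := W\<rparr>) e"
proof -
  interpret W: group "G\<lparr>carrier := W\<rparr>" using subgroup.subgroup_is_group[OF W] is_group by simp
  have "(\<lambda>(n, xs, t). (n, map (\<lambda>g. g) xs, t)) ` bar_class (G\<lparr>carrier := U\<rparr>) e = bar_class (G\<lparr>carrier := U\<rparr>) e"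
    by auto
  moreover have "bar_glue (G\<lparr>carrier := W\<rparr>) `` {q} = bar_class (G\<lparr>carrier := W\<rparr>) e"
    if "q \<in> bar_class (G\<lparr>carrier := U\<rparr>) e" for q
    using W.bar_class_eq[OF bar_rep_subgroup[OF U _ UW]] that by (simp add: bar_class_def)
  moreover have "p \<in> bar_class (G\<lparr>carrier := U\<rparr>) e" using e by (simp add: bar_class_def)
  ultimately show ?thesis unfolding classifying_map_def by (metis (no_types, lifting) Image_eq_UN SUP_eq_const empty_iff)
qed

end

section \<open>Points of homotopy colimits as pairs of step functions\<close>

type_synonym 'g hocolim_rep = "nat \<times> ('g set list \<times> 'g classifying_point) \<times> (nat \<Rightarrow> real)"

text \<open>The class \<open>c\<close> knows \<open>e'\<close> only up to translation by
  \<open>hd us\<close>. Allowing in addition a translation by any \<open>g\<close> of the whole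
  group lets points over different first subgroups be compared; \<open>e\<close> then runs in the
  coset of \<open>hd us\<close> that contains \<open>g\<close>. The jumps of \<open>V\<close> come
  from the outer coordinates \<open>s\<close>, those of \<open>e\<close> from the inner ones hidden
  in \<open>c\<close>.\<close>

definition hocolim_rep ::
  "('g, 'm) monoid_scheme \<Rightarrow> 'g set set \<Rightarrow> (real \<Rightarrow> 'g) \<Rightarrow> (real \<Rightarrow> 'g set) \<Rightarrow> 'g hocolim_rep \<Rightarrow> bool" where
  "hocolim_rep G P e V = (\<lambda>(n, (us, c), s). us \<in> chains_in P n \<and> s \<in> standard_simplex n \<and>
     (\<exists>g\<in>carrier G. \<exists>e' p. bar_rep (G\<lparr>carrier := hd us\<rparr>) e' p \<and> c = bar_class (G\<lparr>carrier := hd us\<rparr>) e' \<and>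
       (\<forall>r\<in>{0..<1}. e r = g \<otimes>\<^bsub>G\<^esub> e' r)) \<and>
     (\<forall>r\<in>{0..<1}. V r = us ! idx s r))"

definition hocolim_class ::
  "('g, 'm) monoid_scheme \<Rightarrow> 'g set set \<Rightarrow> (real \<Rightarrow> 'g) \<Rightarrow> (real \<Rightarrow> 'g set) \<Rightarrow> 'g hocolim_rep set" where
  "hocolim_class G P e V = {p. hocolim_rep G P e V p}"

abbreviation hocolim_spaces where
  "hocolim_spaces G P \<equiv> replacement P (\<lambda>U. classifying_space (G\<lparr>carrier := U\<rparr>))"

abbreviation hocolim_maps where
  "hocolim_maps G \<equiv> replacement_face (\<lambda>U W. classifying_map (G\<lparr>carrier := W\<rparr>) (\<lambda>g. g))"

abbreviation hocolim_glue where
  "hocolim_glue G P \<equiv> glue_rel (hocolim_spaces G P) (hocolim_maps G) replacement_degeneracy"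

lemma topspace_replacement [simp]:
  "(us, c) \<in> topspace (replacement P X n) \<longleftrightarrow> us \<in> chains_in P n \<and> c \<in> topspace (X (hd us))"
  by (auto simp: replacement_def)

lemma chains_in_hd_mem: "us \<in> chains_in P n \<Longrightarrow> us \<noteq> [] \<and> hd us \<in> P \<and> hd us = us ! 0"
  by (cases us) (auto simp: chains_in_def)

lemma chains_in_face:
  assumes "us \<in> chains_in P (Suc n)" "i \<le> Suc n"
  shows "take i us @ drop (Suc i) us \<in> chains_in P n"
proof -
  have us: "set us \<subseteq> P" "length us = Suc (Suc n)" "sorted_wrt (\<le>) us" using assms by (auto simp: chains_in_def)
  have "us = take i us @ us ! i # drop (Suc i) us" using us assms by (intro id_take_nth_drop) auto
  then have "sorted_wrt (\<le>) (take i us @ us ! i # drop (Suc i) us)" using us(3) by simp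
  then have "sorted_wrt (\<le>) (take i us @ drop (Suc i) us)" by (auto simp: sorted_wrt_append)
  moreover have "set (take i us @ drop (Suc i) us) \<subseteq> P"
    using us(1) by (auto dest: in_set_takeD in_set_dropD)
  ultimately show ?thesis using us assms by (simp add: chains_in_def)
qed

lemma chains_in_degeneracy:
  assumes "us \<in> chains_in P n" "i \<le> n"
  shows "take (Suc i) us @ drop i us \<in> chains_in P (Suc n)"
proof -
  have us: "set us \<subseteq> P" "length us = Suc n" "sorted_wrt (\<le>) us" using assms by (auto simp: chains_in_def)
  have d: "drop i us = us ! i # drop (Suc i) us" using us assms by (intro Cons_nth_drop_Suc[symmetric]) auto
  have t: "take (Suc i) us = take i us @ [us ! i]" using us assms by (intro take_Suc_conv_app_nth) auto
  have "us = take i us @ us ! i # drop (Suc i) us" using us assms by (intro id_take_nth_drop) auto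
  then have "sorted_wrt (\<le>) (take i us @ us ! i # drop (Suc i) us)" using us(3) by simp
  then have "sorted_wrt (\<le>) (take (Suc i) us @ drop i us)" unfolding d t by (auto simp: sorted_wrt_append)
  moreover have "set (take (Suc i) us @ drop i us) \<subseteq> P"
    using us(1) by (auto dest: in_set_takeD in_set_dropD)
  ultimately show ?thesis using us assms by (simp add: chains_in_def)
qed

lemma nth_chain_face:
  assumes "i < length us" "Suc k < length us"
  shows "(take i us @ drop (Suc i) us) ! k = us ! (if k < i then k else Suc k)"
  using assms by (auto simp: nth_append min_def)

lemma nth_chain_degeneracy:
  assumes "i < length us" "k \<le> length us"
  shows "(take (Suc i) us @ drop i us) ! k = us ! (if k \<le> i then k else k - 1)"
  using assms by (auto simp: nth_append min_def intro!: arg_cong[of _ _ "(!) us"])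

locale subgroup_family = group G for G (structure) +
  fixes P :: "'a set set"
  assumes subgroups: "U \<in> P \<Longrightarrow> subgroup U G"
begin

lemma group_member: "U \<in> P \<Longrightarrow> group (G\<lparr>carrier := U\<rparr>)"
  using subgroup.subgroup_is_group[OF subgroups] is_group by simp

lemma member_carrier: "U \<in> P \<Longrightarrow> x \<in> U \<Longrightarrow> x \<in> carrier G"
  using subgroup.mem_carrier[OF subgroups] by blast

lemma chain_mono:
  assumes "us \<in> chains_in P n" "i \<le> j" "j \<le> n"
  shows "us ! i \<subseteq> us ! j"
  using assms sorted_wrt_nth_less[of "(\<le>)" us i j] by (cases "i = j") (auto simp: chains_in_def)

lemma hocolim_rep_in_topspace:
  assumes "hocolim_rep G P e V p"
  shows "p \<in> topspace (simplex_sum (hocolim_spaces G P))"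
proof -
  obtain n us c s where p: "p = (n, (us, c), s)" by (metis prod.exhaust)
  obtain e1 p1 where h: "bar_rep (G\<lparr>carrier := hd us\<rparr>) e1 p1"
      "c = bar_class (G\<lparr>carrier := hd us\<rparr>) e1"
    and us: "us \<in> chains_in P n" "s \<in> standard_simplex n"
    using assms p by (auto simp: hocolim_rep_def)
  have hd: "hd us \<in> P" using us(1) chains_in_hd_mem by blast
  show ?thesis
    using group.bar_class_in_topspace[OF group_member[OF hd] h(1)] us h(2) p by simp
qed

lemma replacement_face_closed:
  assumes "x \<in> topspace (hocolim_spaces G P (Suc n))" "i \<le> Suc n"
  shows "hocolim_maps G i x \<in> topspace (hocolim_spaces G P n)"
proof -
  obtain us c where x: "x = (us, c)" by (cases x)
  then have us: "us \<in> chains_in P (Suc n)" "c \<in> topspace (classifying_space (G\<lparr>carrier := hd us\<rparr>))" using assms by auto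
  note ch = chains_in_face[OF us(1) assms(2)]
  show ?thesis
  proof (cases "i = 0")
    case False
    then show ?thesis using x ch us by (cases us) (auto simp: replacement_face_def split: nat.splits)
  next
    case True
    have "us \<noteq> []" "length us = Suc (Suc n)" "set us \<subseteq> P" using us(1) by (auto simp: chains_in_def)
    then have 0: "us ! 0 \<in> P" "us ! 1 \<in> P" "us ! 0 \<subseteq> us ! 1" "hd us = us ! 0" "hd (drop 1 us) = us ! 1"
      using chain_mono[OF us(1), of 0 1] nth_mem[of 0 us] nth_mem[of 1 us] hd_drop_conv_nth[of 1 us] hd_conv_nth[of us] by auto
    obtain n' xs t where "c = bar_class (G\<lparr>carrier := us ! 0\<rparr>) (\<lambda>r. gval (G\<lparr>carrier := us ! 0\<rparr>) xs (idx t r))"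
      "bar_rep (G\<lparr>carrier := us ! 0\<rparr>) (\<lambda>r. gval (G\<lparr>carrier := us ! 0\<rparr>) xs (idx t r)) (n', xs, t)"
      using group.classifying_point_cases[OF group_member[OF 0(1)]] us(2) 0(4) by metis
    then obtain e p where e: "c = bar_class (G\<lparr>carrier := us ! 0\<rparr>) e" "bar_rep (G\<lparr>carrier := us ! 0\<rparr>) e p" by blast
    have "classifying_map (G\<lparr>carrier := us ! 1\<rparr>) (\<lambda>g. g) c \<in> topspace (classifying_space (G\<lparr>carrier := us ! 1\<rparr>))"
      unfolding e(1) classifying_map_bar_class[OF subgroups[OF 0(1)] subgroups[OF 0(2)] 0(3) e(2)]
      by (rule group.bar_class_in_topspace[OF group_member[OF 0(2)] bar_rep_subgroup[OF subgroups[OF 0(1)] e(2) 0(3)]])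
    then show ?thesis using x ch 0 True by (simp add: replacement_face_def)
  qed
qed

lemma class_point_rep:
  assumes "U \<in> P" "c \<in> topspace (classifying_space (G\<lparr>carrier := U\<rparr>))"
  obtains e p where "bar_rep (G\<lparr>carrier := U\<rparr>) e p" "c = bar_class (G\<lparr>carrier := U\<rparr>) e"
  using group.classifying_point_cases[OF group_member[OF assms(1)] assms(2)] by metis

text \<open>Only face 0 needs an argument: it deletes the first subgroup and pushes \<open>c\<close>
  into the next one, without changing the step function behind \<open>c\<close>.\<close>

lemma glue_hocolim_rep:
  assumes "glue (hocolim_spaces G P) (hocolim_maps G) replacement_degeneracy p q"
  shows "hocolim_rep G P e V p \<longleftrightarrow> hocolim_rep G P e V q"
  using assms
proof cases
  case (face x n t i)
  obtain us c where x: "x = (us, c)" by (cases x)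
  then have us: "us \<in> chains_in P (Suc n)" and c: "c \<in> topspace (classifying_space (G\<lparr>carrier := hd us\<rparr>))"
    using face by auto
  have len: "length us = Suc (Suc n)" using us by (simp add: chains_in_def)
  note ch = chains_in_face[OF us face(5)]
  define us' where "us' = take i us @ drop (Suc i) us"
  have V: "us' ! idx t r = us ! idx (simplical_face i t) r" if "r \<in> {0..<1}" for r
    unfolding us'_def using idx_simplical_face[OF face(4,5)] idx_bounds(3)[OF face(4)] that len face(5)
    by (subst nth_chain_face) (auto simp: le_imp_less_Suc)
  have t: "simplical_face i t \<in> standard_simplex (Suc n)"
    using simplical_face_in_simplex face by blast
  show ?thesis
  proof (cases "i = 0")
    case False
    then have "hd us' = hd us" using len unfolding us'_def by (cases us) (auto split: nat.splits simp: take_Cons')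
    then show ?thesis
      using face x us ch t V False by (simp add: hocolim_rep_def replacement_face_def us'_def)
  next
    case True
    have "us \<noteq> []" "set us \<subseteq> P" "us' = drop 1 us" using us len True by (auto simp: chains_in_def us'_def)
    then have 0: "us ! 0 \<in> P" "us ! 1 \<in> P" "us ! 0 \<subseteq> us ! 1" "hd us = us ! 0" "hd us' = us ! 1"
      using chain_mono[OF us, of 0 1] len nth_mem[of 0 us] nth_mem[of 1 us] hd_drop_conv_nth[of 1 us] hd_conv_nth[of us] by auto
    obtain e1 p1 where e1: "bar_rep (G\<lparr>carrier := us ! 0\<rparr>) e1 p1" "c = bar_class (G\<lparr>carrier := us ! 0\<rparr>) e1"
      using class_point_rep[OF 0(1)] c 0(4) by metis
    define c' where "c' = classifying_map (G\<lparr>carrier := us ! 1\<rparr>) (\<lambda>g. g) c"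
    have c': "c' = bar_class (G\<lparr>carrier := us ! 1\<rparr>) e'" if "bar_rep (G\<lparr>carrier := us ! 0\<rparr>) e' p'"
      "c = bar_class (G\<lparr>carrier := us ! 0\<rparr>) e'" for e' p'
      unfolding c'_def that(2) by (rule classifying_map_bar_class[OF subgroups[OF 0(1)] subgroups[OF 0(2)] 0(3) that(1)])
    have e1': "bar_rep (G\<lparr>carrier := us ! 1\<rparr>) e1 p1"
      by (rule bar_rep_subgroup[OF subgroups[OF 0(1)] e1(1) 0(3)])
    have "(\<exists>g\<in>carrier G. \<exists>e' p. bar_rep (G\<lparr>carrier := us ! 1\<rparr>) e' p \<and> c' = bar_class (G\<lparr>carrier := us ! 1\<rparr>) e' \<and>
       (\<forall>r\<in>{0..<1}. e r = g \<otimes> e' r)) \<longleftrightarrow>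
       (\<exists>g\<in>carrier G. \<exists>e' p. bar_rep (G\<lparr>carrier := us ! 0\<rparr>) e' p \<and> c = bar_class (G\<lparr>carrier := us ! 0\<rparr>) e' \<and>
       (\<forall>r\<in>{0..<1}. e r = g \<otimes> e' r))" (is "?l \<longleftrightarrow> ?r")
    proof
      assume ?r
      then show ?l using c' bar_rep_subgroup[OF subgroups[OF 0(1)] _ 0(3)] by meson
    next
      assume ?l
      then obtain g e' p' where g: "g \<in> carrier G" "bar_rep (G\<lparr>carrier := us ! 1\<rparr>) e' p'"
        "c' = bar_class (G\<lparr>carrier := us ! 1\<rparr>) e'" "\<forall>r\<in>{0..<1}. e r = g \<otimes> e' r" by blast
      interpret W: group "G\<lparr>carrier := us ! 1\<rparr>" by (rule group_member[OF 0(2)])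
      \<comment> \<open>Over the larger subgroup \<open>e'\<close> and \<open>e1\<close> represent
        the same point, so they differ by an element \<open>h\<close> of that subgroup, which is
        absorbed into \<open>g\<close>.\<close>
      have "bar_rep (G\<lparr>carrier := us ! 1\<rparr>) e' p1"
        using W.bar_rep_of_class_eq[OF _ e1'] c'[OF e1] g(3) by simp
      from W.bar_rep_unique_function[OF e1' this] obtain h where
        h: "h \<in> us ! 1" "\<forall>r\<in>{0..<1}. e' r = h \<otimes> e1 r" by auto
      have "\<forall>r\<in>{0..<1}. e r = (g \<otimes> h) \<otimes> e1 r"
        using g h W.bar_rep_closed[OF e1'] member_carrier[OF 0(2)] by (auto simp: m_assoc)
      moreover have "g \<otimes> h \<in> carrier G" using g(1) h(1) member_carrier[OF 0(2)] by auto
      ultimately show ?r using e1 by blast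
    qed
    then show ?thesis
      using face x us ch t V True 0 by (simp add: hocolim_rep_def replacement_face_def us'_def c'_def)
  qed
next
  case (degeneracy x n t i)
  obtain us c where x: "x = (us, c)" by (cases x)
  then have us: "us \<in> chains_in P n" using degeneracy by auto
  have len: "length us = Suc n" using us by (simp add: chains_in_def)
  note ch = chains_in_degeneracy[OF us degeneracy(5)]
  have V: "(take (Suc i) us @ drop i us) ! idx t r = us ! idx (codegeneracy i t) r" if "r \<in> {0..<1}" for r
    using idx_codegeneracy[OF degeneracy(4,5)] idx_bounds(3)[OF degeneracy(4)] that len degeneracy(5)
    by (subst nth_chain_degeneracy) auto
  have hd: "hd (take (Suc i) us @ drop i us) = hd us" using len by (cases us) auto
  show ?thesis
    using degeneracy x us ch V hd codegeneracy_in_simplex[OF degeneracy(4,5)]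
    by (simp add: hocolim_rep_def replacement_degeneracy_def del: take_Suc hd_append2 hd_append)
qed

lemma glue_rel_hocolim_rep:
  "(p, q) \<in> hocolim_glue G P \<Longrightarrow> hocolim_rep G P e V p \<longleftrightarrow> hocolim_rep G P e V q"
  by (erule glue_rel_invariant) (rule glue_hocolim_rep)

lemma hocolim_rep_reduced_unique:
  assumes p: "hocolim_rep G P e V (n, (us, c), s)" "\<forall>i\<le>n. 0 < s i" "\<forall>i<n. us ! i \<noteq> us ! Suc i"
    and q: "hocolim_rep G P e V (m, (ws, d), u)" "\<forall>i\<le>m. 0 < u i" "\<forall>i<m. ws ! i \<noteq> ws ! Suc i"
  shows "(m, (ws, d), u) = (n, (us, c), s)"
proof -
  from p obtain g e1 p1 where g: "g \<in> carrier G" "bar_rep (G\<lparr>carrier := hd us\<rparr>) e1 p1"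
      "c = bar_class (G\<lparr>carrier := hd us\<rparr>) e1" "\<forall>r\<in>{0..<1}. e r = g \<otimes> e1 r"
    and us: "us \<in> chains_in P n" and s: "s \<in> standard_simplex n" and V: "\<forall>r\<in>{0..<1}. V r = us ! idx s r"
    by (auto simp: hocolim_rep_def)
  from q obtain h e2 p2 where h: "h \<in> carrier G" "bar_rep (G\<lparr>carrier := hd ws\<rparr>) e2 p2"
      "d = bar_class (G\<lparr>carrier := hd ws\<rparr>) e2" "\<forall>r\<in>{0..<1}. e r = h \<otimes> e2 r"
    and ws: "ws \<in> chains_in P m" and u: "u \<in> standard_simplex m" and W: "\<forall>r\<in>{0..<1}. V r = ws ! idx u r"
    by (auto simp: hocolim_rep_def)
  have "\<forall>r. 0 \<le> r \<longrightarrow> r < 1 \<longrightarrow> us ! idx s r = ws ! idx u r"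
    using V W by auto
  note U = reduced_step_unique[where v = "\<lambda>i. us ! i" and v' = "\<lambda>i. ws ! i", OF s p(2) u q(2) p(3) q(3) this]
  have ws_us: "ws = us" using U us ws by (intro nth_equalityI) (auto simp: chains_in_def)
  have hd: "hd us \<in> P" using us chains_in_hd_mem by blast
  interpret H: group "G\<lparr>carrier := hd us\<rparr>" by (rule group_member[OF hd])
  have e12: "e1 0 \<in> hd us" "e2 0 \<in> hd us"
    using H.bar_rep_closed[OF g(2), of 0] group.bar_rep_closed[OF group_member h(2), of 0] hd ws_us by auto
  then have e12': "e1 0 \<in> carrier G" "e2 0 \<in> carrier G" using member_carrier[OF hd] by auto
  \<comment> \<open>A priori the translation from \<open>e1\<close> to \<open>e2\<close> lies in the
    whole group. As it carries one element of \<open>hd us\<close> to another, it lies in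
    \<open>hd us\<close>, where it does not change the class.\<close>
  define k where "k = inv h \<otimes> g"
  have kc: "k \<in> carrier G" using g h by (simp add: k_def)
  have ek: "e2 r = k \<otimes> e1 r" if "r \<in> {0..<1}" for r
  proof -
    have c: "e1 r \<in> carrier G" "e2 r \<in> carrier G"
      using H.bar_rep_closed[OF g(2) that] group.bar_rep_closed[OF group_member h(2) that] hd ws_us
        member_carrier[OF hd] by auto
    have "g \<otimes> e1 r = h \<otimes> e2 r" using g(4) h(4) that by metis
    then have "inv h \<otimes> (g \<otimes> e1 r) = inv h \<otimes> (h \<otimes> e2 r)" by simp
    then show ?thesis using c g(1) h(1) unfolding k_def by (simp add: m_assoc[symmetric])
  qed
  have "k = e2 0 \<otimes> inv (e1 0)" using ek[of 0] kc e12' by (simp add: m_assoc)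
  then have "k \<in> hd us" using e12 subgroups[OF hd]
    by (metis subgroup.m_closed subgroup.m_inv_closed)
  then have "bar_class (G\<lparr>carrier := hd us\<rparr>) e2 = bar_class (G\<lparr>carrier := hd us\<rparr>) e1"
    using H.bar_class_translate[OF g(2), of k e2] ek by auto
  then show ?thesis using U ws_us g(3) h(3) by simp
qed

lemma hocolim_rep_reduce:
  assumes "hocolim_rep G P e V p"
  shows "\<exists>n us c s. (p, (n, (us, c), s)) \<in> hocolim_glue G P \<and> hocolim_rep G P e V (n, (us, c), s) \<and>
    (\<forall>i\<le>n. 0 < s i) \<and> (\<forall>i<n. us ! i \<noteq> us ! Suc i)"
proof -
  obtain n x t where p: "p = (n, x, t)" by (cases p)
  have x: "x \<in> topspace (hocolim_spaces G P n)" "t \<in> standard_simplex n"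
    using hocolim_rep_in_topspace[OF assms] p by auto
  have "\<exists>m y u. ((n, x, t), (m, y, u)) \<in> hocolim_glue G P \<and> (\<forall>i\<le>m. 0 < u i) \<and>
    (\<forall>k i. m = Suc k \<longrightarrow> i \<le> k \<longrightarrow> \<not> fst y ! i = fst y ! Suc i)"
  \<comment> \<open>Only the chain has to be reduced; the inner component is already a class, hence
    determined by its step function.\<close>
  proof (rule reduce_to_normal_form[where X = "hocolim_spaces G P" and D = "\<lambda>k i y. fst y ! i = fst y ! Suc i", OF _ _ x])
    show "hocolim_maps G i x \<in> topspace (hocolim_spaces G P n)"
      if "x \<in> topspace (hocolim_spaces G P (Suc n))" "i \<le> Suc n" for n i x
      by (rule replacement_face_closed[OF that])
    show "\<exists>y\<in>topspace (hocolim_spaces G P n). x = replacement_degeneracy i y"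
      if that: "x \<in> topspace (hocolim_spaces G P (Suc n))" "i \<le> n" "fst x ! i = fst x ! Suc i" for n i x
    proof -
      obtain us c where xx: "x = (us, c)" by (cases x)
      then have us: "us \<in> chains_in P (Suc n)" and c: "c \<in> topspace (classifying_space (G\<lparr>carrier := hd us\<rparr>))"
        using that by auto
      have len: "length us = Suc (Suc n)" using us by (simp add: chains_in_def)
      define ws where "ws = take (Suc i) us @ drop (Suc (Suc i)) us"
      have ws: "ws \<in> chains_in P n" unfolding ws_def using that(2) by (intro chains_in_face[OF us]) auto
      have hd: "hd ws = hd us" using len by (cases us) (auto simp: ws_def)
      have "take (Suc i) ws = take (Suc i) us" using len that(2) by (simp add: ws_def)
      moreover have "drop i ws = drop (Suc i) us"
      proof -
        have "take (Suc i) us = take i us @ [us ! i]" using len that(2) by (intro take_Suc_conv_app_nth) auto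
        then have "drop i ws = us ! i # drop (Suc (Suc i)) us" using len that(2) by (simp add: ws_def del: take_Suc)
        also have "\<dots> = us ! Suc i # drop (Suc (Suc i)) us" using that(3) xx by simp
        also have "\<dots> = drop (Suc i) us" using len that(2) by (intro Cons_nth_drop_Suc) auto
        finally show ?thesis .
      qed
      ultimately have "x = replacement_degeneracy i (ws, c)"
        unfolding replacement_degeneracy_def xx by (simp del: take_Suc)
      then show ?thesis using ws hd c by (intro bexI[of _ "(ws, c)"]) auto
    qed
  qed
  then obtain m ws d u where y: "(p, (m, (ws, d), u)) \<in> hocolim_glue G P" "\<forall>i\<le>m. 0 < u i"
     "\<forall>k i. m = Suc k \<longrightarrow> i \<le> k \<longrightarrow> \<not> ws ! i = ws ! Suc i"
    using p by auto
  have "\<forall>i<m. ws ! i \<noteq> ws ! Suc i"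
    using y(3) by (cases m) auto
  then show ?thesis using y glue_rel_hocolim_rep[OF y(1)] assms by blast
qed

lemma hocolim_rep_imp_glue:
  assumes "hocolim_rep G P e V p" "hocolim_rep G P e V q"
  shows "(p, q) \<in> hocolim_glue G P"
proof -
  obtain n us c s where 1: "(p, (n, (us, c), s)) \<in> hocolim_glue G P" "hocolim_rep G P e V (n, (us, c), s)"
    "\<forall>i\<le>n. 0 < s i" "\<forall>i<n. us ! i \<noteq> us ! Suc i" using hocolim_rep_reduce[OF assms(1)] by blast
  obtain m ws d u where 2: "(q, (m, (ws, d), u)) \<in> hocolim_glue G P" "hocolim_rep G P e V (m, (ws, d), u)"
    "\<forall>i\<le>m. 0 < u i" "\<forall>i<m. ws ! i \<noteq> ws ! Suc i" using hocolim_rep_reduce[OF assms(2)] by blast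
  have "(m, (ws, d), u) = (n, (us, c), s)" by (rule hocolim_rep_reduced_unique[OF 1(2-4) 2(2-4)])
  with glue_rel_sym[OF 2(1)] have "((n, (us, c), s), q) \<in> hocolim_glue G P" by simp
  with 1(1) show ?thesis by (rule glue_rel_trans)
qed

lemma hocolim_class_eq: "hocolim_rep G P e V p \<Longrightarrow> hocolim_class G P e V = hocolim_glue G P `` {p}"
  unfolding hocolim_class_def using hocolim_rep_imp_glue glue_rel_hocolim_rep by blast

lemma topspace_hocolim_classifying:
  "topspace (hocolim_classifying G P) = topspace (simplex_sum (hocolim_spaces G P)) // hocolim_glue G P"
  unfolding hocolim_classifying_def hocolim_def realization_def
  by (rule topspace_quotient_topology[OF equiv_glue_rel])

lemma hocolim_class_in_topspace:
  "hocolim_rep G P e V p \<Longrightarrow> hocolim_class G P e V \<in> topspace (hocolim_classifying G P)"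
  unfolding topspace_hocolim_classifying
  by (simp add: hocolim_class_eq hocolim_rep_in_topspace quotientI)

lemma hocolim_rep_translate:
  assumes "hocolim_rep G P e V p" "g \<in> carrier G" "\<forall>r\<in>{0..<1}. e' r = g \<otimes> e r" "\<forall>r\<in>{0..<1}. V' r = V r"
  shows "hocolim_rep G P e' V' p"
proof -
  obtain n us c s where p: "p = (n, (us, c), s)" by (metis prod.exhaust)
  obtain h e1 p1 where h: "h \<in> carrier G" "bar_rep (G\<lparr>carrier := hd us\<rparr>) e1 p1"
      "c = bar_class (G\<lparr>carrier := hd us\<rparr>) e1" "\<forall>r\<in>{0..<1}. e r = h \<otimes> e1 r"
    and us: "us \<in> chains_in P n" 
    using assms p by (auto simp: hocolim_rep_def)
  have hd: "hd us \<in> P" using us chains_in_hd_mem by blast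
  have "\<forall>r\<in>{0..<1}. e' r = (g \<otimes> h) \<otimes> e1 r"
    using assms(2,3) h group.bar_rep_closed[OF group_member h(2)] hd member_carrier[OF hd] by (auto simp: m_assoc)
  moreover have "g \<otimes> h \<in> carrier G" using assms(2) h(1) by simp
  moreover have "s \<in> standard_simplex n" "\<forall>r\<in>{0..<1}. V' r = us ! idx s r"
    using assms(1,4) p by (auto simp: hocolim_rep_def)
  ultimately show ?thesis using h(2,3) us unfolding p hocolim_rep_def by blast
qed

end

section \<open>Continuity\<close>

lemma continuous_map_prod_sum:
  assumes "\<And>i. i \<in> I \<Longrightarrow> continuous_map (prod_topology Z (X i)) Y (\<lambda>(z, x). h (z, (i, x)))"
  shows "continuous_map (prod_topology Z (sum_topology X I)) Y h"
  unfolding continuous_map_def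
proof (intro conjI allI impI)
  show "h \<in> topspace (prod_topology Z (sum_topology X I)) \<rightarrow> topspace Y"
  proof clarsimp
    fix z i x assume "z \<in> topspace Z" "i \<in> I" "x \<in> topspace (X i)"
    then show "h (z, i, x) \<in> topspace Y"
      using continuous_map_image_subset_topspace[OF assms[of i]] by fastforce
  qed
  fix W assume W: "openin Y W"
  show "openin (prod_topology Z (sum_topology X I)) {p \<in> topspace (prod_topology Z (sum_topology X I)). h p \<in> W}"
    unfolding openin_prod_topology_alt
  proof (intro allI impI)
    fix z p assume a: "(z, p) \<in> {p \<in> topspace (prod_topology Z (sum_topology X I)). h p \<in> W}"
    then obtain i x where p: "p = (i, x)" "i \<in> I" "x \<in> topspace (X i)" "z \<in> topspace Z" "h (z, i, x) \<in> W" by auto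
    have "openin (prod_topology Z (X i)) {q \<in> topspace (prod_topology Z (X i)). (\<lambda>(z, x). h (z, (i, x))) q \<in> W}"
      by (rule openin_continuous_map_preimage[OF assms[OF p(2)] W])
    from iffD1[OF openin_prod_topology_alt this, rule_format, of z x] p
    obtain U V where UV: "openin Z U" "openin (X i) V" "z \<in> U" "x \<in> V"
      "U \<times> V \<subseteq> {q \<in> topspace (prod_topology Z (X i)). (\<lambda>(z, x). h (z, (i, x))) q \<in> W}"
      by auto
    have "openin (sum_topology X I) ({i} \<times> V)"
    proof -
      have "{x. (j, x) \<in> {i} \<times> V} = (if j = i then V else {})" for j by auto
      then show ?thesis using UV(2) p openin_subset[OF UV(2)] by (auto simp: openin_sum_topology)
    qed
    moreover have "U \<times> ({i} \<times> V) \<subseteq> {p \<in> topspace (prod_topology Z (sum_topology X I)). h p \<in> W}"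
      using UV(5) p(2) by auto
    ultimately show "\<exists>U V. openin Z U \<and> openin (sum_topology X I) V \<and> z \<in> U \<and> p \<in> V \<and>
        U \<times> V \<subseteq> {p \<in> topspace (prod_topology Z (sum_topology X I)). h p \<in> W}"
      using UV p by blast
  qed
qed

text \<open>Moves the simplex into the parameter space, so that the factor to be decomposed comes
  last.\<close>

lemma continuous_map_rearrange:
  assumes "continuous_map (prod_topology (prod_topology Z S) X) Y (\<lambda>((z, s), x). h (z, (x, s)))"
  shows "continuous_map (prod_topology Z (prod_topology X S)) Y h"
proof -
  have c: "continuous_map (prod_topology Z (prod_topology X S)) (prod_topology (prod_topology Z S) X)
      (\<lambda>p. ((fst p, snd (snd p)), fst (snd p)))"
    by (intro continuous_map_pairedI continuous_map_fst continuous_map_compose[OF continuous_map_snd, unfolded o_def]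
        continuous_map_snd)
  show ?thesis
    by (rule continuous_map_eq[OF continuous_map_compose[OF c assms]]) auto
qed

lemma continuous_map_prod_sum_left:
  assumes "\<And>i. i \<in> I \<Longrightarrow> continuous_map (prod_topology (prod_topology Z S) (X i)) Y (\<lambda>((z, s), x). h (z, ((i, x), s)))"
  shows "continuous_map (prod_topology Z (prod_topology (sum_topology X I) S)) Y h"
proof (rule continuous_map_rearrange)
  show "continuous_map (prod_topology (prod_topology Z S) (sum_topology X I)) Y (\<lambda>((z, s), x). h (z, x, s))"
    by (rule continuous_map_prod_sum) (use assms in \<open>simp add: case_prod_unfold\<close>)
qed

lemma continuous_map_prod_discrete_left:
  assumes "\<And>x. x \<in> D \<Longrightarrow> continuous_map (prod_topology Z S) Y (\<lambda>(z, s). h (z, (x, s)))"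
  shows "continuous_map (prod_topology Z (prod_topology (discrete_topology D) S)) Y h"
  unfolding continuous_map_def
proof (intro conjI allI impI)
  show "h \<in> topspace (prod_topology Z (prod_topology (discrete_topology D) S)) \<rightarrow> topspace Y"
  proof clarsimp
    fix z x s assume "z \<in> topspace Z" "x \<in> D" "s \<in> topspace S"
    then show "h (z, x, s) \<in> topspace Y"
      using continuous_map_image_subset_topspace[OF assms[of x]] by fastforce
  qed
  fix W assume W: "openin Y W"
  show "openin (prod_topology Z (prod_topology (discrete_topology D) S))
      {p \<in> topspace (prod_topology Z (prod_topology (discrete_topology D) S)). h p \<in> W}"
    unfolding openin_prod_topology_alt[of Z]
  proof (intro allI impI)
    fix z p assume a: "(z, p) \<in> {p \<in> topspace (prod_topology Z (prod_topology (discrete_topology D) S)). h p \<in> W}"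
    then obtain x s where p: "p = (x, s)" "x \<in> D" "s \<in> topspace S" "z \<in> topspace Z" "h (z, x, s) \<in> W" by auto
    have "openin (prod_topology Z S) {q \<in> topspace (prod_topology Z S). (\<lambda>(z, s). h (z, (x, s))) q \<in> W}"
      by (rule openin_continuous_map_preimage[OF assms[OF p(2)] W])
    from iffD1[OF openin_prod_topology_alt this, rule_format, of z s] p
    obtain U V where UV: "openin Z U" "openin S V" "z \<in> U" "s \<in> V"
      "U \<times> V \<subseteq> {q \<in> topspace (prod_topology Z S). (\<lambda>(z, s). h (z, (x, s))) q \<in> W}"
      by auto
    have "openin (prod_topology (discrete_topology D) S) ({x} \<times> V)"
      using UV p by (simp add: openin_prod_Times_iff)
    moreover have "U \<times> ({x} \<times> V) \<subseteq> {p \<in> topspace (prod_topology Z (prod_topology (discrete_topology D) S)). h p \<in> W}"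
      using UV(5) p(2) by auto
    ultimately show "\<exists>U V. openin Z U \<and> openin (prod_topology (discrete_topology D) S) V \<and> z \<in> U \<and> p \<in> V \<and>
        U \<times> V \<subseteq> {p \<in> topspace (prod_topology Z (prod_topology (discrete_topology D) S)). h p \<in> W}"
      using UV p by blast
  qed
qed

lemma compact_Hausdorff_simplex_topology:
  "compact_space (simplex_topology n)" "Hausdorff_space (simplex_topology n)"
  unfolding simplex_topology_def
  by (auto simp: compact_space_subtopology compactin_standard_simplex Hausdorff_space_subtopology Hausdorff_space_product_topology)

lemma topspace_simplex_topology [simp]: "topspace (simplex_topology n) = standard_simplex n"
  by (simp add: simplex_topology_def)

lemma continuous_map_into_realization:
  assumes "continuous_map T (X n) a" "continuous_map T (simplex_topology n) t"
  shows "continuous_map T (realization X \<delta> \<sigma>) (\<lambda>y. glue_rel X \<delta> \<sigma> `` {(n, a y, t y)})"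
proof -
  have 1: "continuous_map T (prod_topology (X n) (simplex_topology n)) (\<lambda>y. (a y, t y))"
    using assms by (simp add: continuous_map_pairwise o_def)
  have 2: "continuous_map (prod_topology (X n) (simplex_topology n)) (simplex_sum X) (\<lambda>q. (n, q))"
    unfolding simplex_sum_def by (rule continuous_map_component_injection) simp
  have 3: "continuous_map (simplex_sum X) (realization X \<delta> \<sigma>) (\<lambda>q. glue_rel X \<delta> \<sigma> `` {q})"
    unfolding realization_def
    by (rule quotient_imp_continuous_map[OF quotient_map_quotient_topology[OF equiv_glue_rel]])
  show ?thesis
    using continuous_map_compose[OF continuous_map_compose[OF 1 2] 3] by (simp add: o_def)
qed

text \<open>The product of a quotient map with the identity of a locally compact Hausdorff space is
  a quotient map. The parameter space \<open>Z\<close> serves both for the unit interval of a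
  homotopy and for the simplices of an outer realization.\<close>

lemma continuous_map_from_realization:
  assumes Z: "compact_space Z" "Hausdorff_space Z"
    and h: "\<And>n. continuous_map (prod_topology Z (prod_topology (X n) (simplex_topology n))) Y
      (\<lambda>(z, (x, t)). h (z, glue_rel X \<delta> \<sigma> `` {(n, x, t)}))"
  shows "continuous_map (prod_topology Z (realization X \<delta> \<sigma>)) Y h"
proof -
  have q: "quotient_map (prod_topology Z (simplex_sum X)) (prod_topology Z (realization X \<delta> \<sigma>))
      (\<lambda>(z, p). (z, glue_rel X \<delta> \<sigma> `` {p}))"
    unfolding realization_def
    by (rule quotient_map_prod_right)
       (use Z compact_imp_locally_compact_space quotient_map_quotient_topology[OF equiv_glue_rel] in auto)
  have "continuous_map (prod_topology Z (simplex_sum X)) Y (h \<circ> (\<lambda>(z, p). (z, glue_rel X \<delta> \<sigma> `` {p})))"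
    unfolding simplex_sum_def
    by (rule continuous_map_prod_sum) (use h in \<open>simp add: case_prod_unfold\<close>)
  then show ?thesis by (rule continuous_compose_quotient_map[OF q])
qed

lemma continuous_map_from_classifying_space:
  assumes Z: "compact_space Z" "Hausdorff_space Z"
    and h: "\<And>n xs. set xs \<subseteq> carrier G \<Longrightarrow> length xs = n \<Longrightarrow>
      continuous_map (prod_topology Z (simplex_topology n)) Y (\<lambda>(z, t). h (z, bar_glue G `` {(n, xs, t)}))"
  shows "continuous_map (prod_topology Z (classifying_space G)) Y h"
  unfolding classifying_space_def
proof (rule continuous_map_from_realization[OF Z])
  fix n
  show "continuous_map (prod_topology Z (prod_topology (bar G n) (simplex_topology n))) Y
          (\<lambda>(z, x, t). h (z, bar_glue G `` {(n, x, t)}))"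
  proof -
    have "bar G n = discrete_topology {xs. set xs \<subseteq> carrier G \<and> length xs = n}" by (simp add: bar_def)
    then show ?thesis
      by (simp only:) (rule continuous_map_prod_discrete_left, use h in auto)
  qed
qed

text \<open>Two nested realizations are unfolded in turn. The simplex of the outer one joins the
  parameter space, which stays compact Hausdorff, so the inner quotient can be treated in the same
  way.\<close>

lemma continuous_map_from_hocolim:
  assumes Z: "compact_space Z" "Hausdorff_space Z"
    and h: "\<And>n us m xs. us \<in> chains_in P n \<Longrightarrow> set xs \<subseteq> hd us \<Longrightarrow> length xs = m \<Longrightarrow>
      continuous_map (prod_topology (prod_topology Z (simplex_topology n)) (simplex_topology m)) Y
        (\<lambda>((z, s), t). h (z, hocolim_glue G P `` {(n, (us, bar_glue (G\<lparr>carrier := hd us\<rparr>) `` {(m, xs, t)}), s)}))"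
  shows "continuous_map (prod_topology Z (hocolim_classifying G P)) Y h"
  unfolding hocolim_classifying_def hocolim_def
proof (rule continuous_map_from_realization[OF Z])
  fix n
  have Z': "compact_space (prod_topology Z (simplex_topology n))" "Hausdorff_space (prod_topology Z (simplex_topology n))"
    using Z compact_Hausdorff_simplex_topology by (auto simp: compact_space_prod_topology Hausdorff_space_prod_topology)
  show "continuous_map (prod_topology Z (prod_topology (hocolim_spaces G P n) (simplex_topology n))) Y
          (\<lambda>(z, x, t). h (z, hocolim_glue G P `` {(n, x, t)}))"
  proof -
    have eq: "hocolim_spaces G P n = sum_topology (\<lambda>us. classifying_space (G\<lparr>carrier := hd us\<rparr>)) (chains_in P n)"
      by (simp add: replacement_def)
    show ?thesis
      unfolding eq
    proof (rule continuous_map_prod_sum_left)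
      fix us assume us: "us \<in> chains_in P n"
      show "continuous_map (prod_topology (prod_topology Z (simplex_topology n)) (classifying_space (G\<lparr>carrier := hd us\<rparr>)))
        Y (\<lambda>((z, s), x). case (z, (us, x), s) of (z, x, t) \<Rightarrow> h (z, hocolim_glue G P `` {(n, x, t)}))"
        by (rule continuous_map_from_classifying_space[OF Z'])
           (use h[OF us] in \<open>simp add: case_prod_unfold\<close>)
    qed
  qed
qed

section \<open>Tame families of step functions and their closed cells\<close>

definition same_type :: "('a \<Rightarrow> real) set \<Rightarrow> 'a \<Rightarrow> 'a \<Rightarrow> bool" where
  "same_type K x y \<longleftrightarrow> (\<forall>f\<in>K. \<forall>h\<in>K. f x \<le> h x \<longrightarrow> f y \<le> h y)"

text \<open>The jumps of \<open>q x\<close> lie among the values \<open>f x\<close>, and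
  \<open>q x r\<close> depends only on the order of these values and on which of them have been
  passed at \<open>r\<close>. Since \<open>same_type\<close> is not symmetric, \<open>y\<close> may
  satisfy more relations than \<open>x\<close>: it lies in the closed cell of \<open>x\<close>,
  where some intervals may have shrunk to nothing. The condition then says that the surviving
  intervals keep their values, which is exactly what continuity in a realization demands.\<close>

definition tame :: "('a \<Rightarrow> real) set \<Rightarrow> 'a set \<Rightarrow> ('a \<Rightarrow> real \<Rightarrow> 'b) \<Rightarrow> bool" where
  "tame K S q \<longleftrightarrow> (\<forall>x\<in>S. \<forall>y\<in>S. \<forall>r\<in>{0..<1}. \<forall>r'\<in>{0..<1}. same_type K x y \<longrightarrow>
     (\<forall>f\<in>K. f x \<le> r \<longleftrightarrow> f y \<le> r') \<longrightarrow> q x r = q y r')"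

abbreviation cell where
  "cell K T x \<equiv> {y \<in> topspace T. same_type K x y}"

definition tamable :: "'a topology \<Rightarrow> ('a \<Rightarrow> real \<Rightarrow> 'b) \<Rightarrow> bool" where
  "tamable T q \<longleftrightarrow> (\<exists>K. finite K \<and> (\<forall>f\<in>K. continuous_map T euclideanreal f) \<and> tame K (topspace T) q)"

lemma tame_mono:
  assumes "tame K S q" "K \<subseteq> K'"
  shows "tame K' S q"
  unfolding tame_def
proof (intro ballI impI)
  fix x y and r r' :: real
  assume "x \<in> S" "y \<in> S" "r \<in> {0..<1}" "r' \<in> {0..<1}"
    "same_type K' x y" "\<forall>f\<in>K'. f x \<le> r \<longleftrightarrow> f y \<le> r'"
  moreover from this have "same_type K x y" "\<forall>f\<in>K. f x \<le> r \<longleftrightarrow> f y \<le> r'"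
    using assms(2) by (auto simp: same_type_def)
  ultimately show "q x r = q y r'" using assms(1) unfolding tame_def by blast
qed

lemma closedin_le:
  assumes "continuous_map T euclideanreal f" "continuous_map T euclideanreal h"
  shows "closedin T {x \<in> topspace T. f x \<le> h x}"
proof -
  have "continuous_map T euclideanreal (\<lambda>x. f x - h x)" using assms by (intro continuous_map_diff)
  from closedin_continuous_map_preimage[OF this, of "{..0}"] show ?thesis by simp
qed

text \<open>A cell is cut out by weak inequalities, hence closed, and is determined by a subset of
  \<open>K \<times> K\<close>. So the cells form a finite closed cover and the pasting lemma
  applies.\<close>

lemma continuous_map_by_cells:
  assumes K: "finite K" "\<And>f. f \<in> K \<Longrightarrow> continuous_map T euclideanreal f"
    and c: "\<And>x. x \<in> topspace T \<Longrightarrow> continuous_map (subtopology T (cell K T x)) Y \<phi>"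
  shows "continuous_map T Y \<phi>"
proof (rule pasting_lemma_closed[where I = "cell K T ` topspace T" and T = "\<lambda>C. C" and f = "\<lambda>_. \<phi>"])
  have "cell K T x = (\<lambda>R. {y \<in> topspace T. \<forall>(f, h)\<in>R. f y \<le> h y}) {(f, h) \<in> K \<times> K. f x \<le> h x}" for x
    by (auto simp: same_type_def)
  then have "cell K T ` topspace T \<subseteq> (\<lambda>R. {y \<in> topspace T. \<forall>(f, h)\<in>R. f y \<le> h y}) ` Pow (K \<times> K)"
    by blast
  then show "finite (cell K T ` topspace T)"
    by (rule finite_subset) (use K in auto)
  fix C assume "C \<in> cell K T ` topspace T"
  then obtain x where x: "x \<in> topspace T" "C = cell K T x" by blast
  show "continuous_map (subtopology T C) Y \<phi>" using c x by simp
  have "C = \<Inter> (insert (topspace T) ((\<lambda>(f, h). {y \<in> topspace T. f y \<le> h y}) ` {(f, h) \<in> K \<times> K. f x \<le> h x}))"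
    unfolding x same_type_def by auto
  moreover have "closedin T \<dots>"
    by (rule closedin_Inter) (auto intro!: closedin_le K)
  ultimately show "closedin T C" by simp
qed (auto simp: same_type_def)

text \<open>The values in [0, 1) of \<open>K\<close> at the single point \<open>x\<close> are sorted
  and each is represented by one function of \<open>K\<close>; the constant 1 is appended. These
  functions then serve as cut points on the whole cell of \<open>x\<close>.\<close>

lemma cut_functions:
  assumes K: "finite K" "(\<lambda>_. 0) \<in> K" "(\<lambda>_. 1) \<in> K"
  obtains m \<phi> where "\<phi> 0 = (\<lambda>_. 0)" "\<phi> (Suc m) = (\<lambda>_. 1)" "\<forall>k\<le>Suc m. \<phi> k \<in> K"
    "\<forall>k\<le>m. \<phi> k x < (\<phi> (Suc k) x :: real)" "\<forall>k\<le>m. \<forall>f\<in>K. f x \<le> \<phi> k x \<or> \<phi> (Suc k) x \<le> f x"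
proof -
  define A where "A = {f x | f. f \<in> K} \<inter> {0..<1}"
  have A: "finite A" "0 \<in> A" using K unfolding A_def by (auto intro!: exI[of _ "\<lambda>_. 0"])
  define vs where "vs = sorted_list_of_set A"
  have vs: "set vs = A" "sorted_wrt (<) vs" using A by (auto simp: vs_def)
  define m where "m = length vs - 1"
  have len: "length vs = Suc m" using vs A by (cases vs) (auto simp: m_def)
  have less: "vs ! i < vs ! j" if "i < j" "j \<le> m" for i j
    using sorted_wrt_nth_less[OF vs(2), of i j] that len by auto
  have mem: "vs ! k \<in> A" if "k \<le> m" for k using vs(1) len that by (metis nth_mem le_imp_less_Suc)
  have vs0: "vs ! 0 = 0"
  proof -
    obtain j where "j \<le> m" "vs ! j = 0" using vs(1) A(2) len by (metis in_set_conv_nth less_Suc_eq_le)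
    then show ?thesis using less[of 0 j] mem[of 0] by (cases "j = 0") (auto simp: A_def)
  qed
  have "\<exists>f\<in>K. f x = vs ! k" if "k \<le> m" for k using mem[OF that] by (auto simp: A_def)
  then obtain F where F: "\<And>k. k \<le> m \<Longrightarrow> F k \<in> K \<and> F k x = vs ! k" by metis
  define \<phi> where "\<phi> k = (if k = 0 then (\<lambda>_. 0) else if k \<le> m then F k else (\<lambda>_. 1))" for k
  have val: "\<phi> k x = (if k \<le> m then vs ! k else 1)" for k using F vs0 by (auto simp: \<phi>_def)
  show thesis
  proof
    show "\<phi> 0 = (\<lambda>_. 0)" "\<phi> (Suc m) = (\<lambda>_. 1)" by (auto simp: \<phi>_def)
    show "\<forall>k\<le>Suc m. \<phi> k \<in> K" using F K by (auto simp: \<phi>_def)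
    show "\<forall>k\<le>m. \<phi> k x < \<phi> (Suc k) x" using less mem by (auto simp: val A_def Suc_le_eq)
    show "\<forall>k\<le>m. \<forall>f\<in>K. f x \<le> \<phi> k x \<or> \<phi> (Suc k) x \<le> f x"
    proof (intro allI impI ballI)
      fix k f assume k: "k \<le> m" and f: "f \<in> K"
      have v: "0 \<le> vs ! j" "vs ! j < 1" if "j \<le> m" for j using mem[OF that] by (auto simp: A_def)
      consider "f x < 0" | "f x \<ge> 1" | "f x \<in> A" using f by (force simp: A_def)
      then show "f x \<le> \<phi> k x \<or> \<phi> (Suc k) x \<le> f x"
      proof cases
        case 1
        then show ?thesis using v[OF k] k val[of k] by simp
      next
        case 2
        then show ?thesis using v[of "Suc k"] val[of "Suc k"] by (cases "Suc k \<le> m") auto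
      next
        case 3
        then obtain j where j: "j \<le> m" "vs ! j = f x" using vs(1) len by (metis in_set_conv_nth less_Suc_eq_le)
        show ?thesis
        proof (cases "j \<le> k")
          case True
          then show ?thesis using less[of j k] j k val[of k] by (cases "j = k") auto
        next
          case False
          then show ?thesis using less[of "Suc k" j] j k val[of "Suc k"] by (cases "j = Suc k") auto
        qed
      qed
    qed
  qed
qed

text \<open>On the cell of \<open>x\<close> the cut functions of \<open>cut_functions\<close> keep
  their order weakly, so their differences are barycentric coordinates that depend continuously on
  the point. \<open>\<rho> k\<close> is the left end of interval \<open>k\<close> at
  \<open>x\<close>, a sample point: any \<open>r\<close> in interval \<open>k\<close> of
  \<open>y\<close> has passed the same functions as \<open>\<rho> k\<close> at
  \<open>x\<close>.\<close>

lemma cell_coordinates: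
  assumes K: "finite K" "\<And>f. f \<in> K \<Longrightarrow> continuous_map T euclideanreal f" "(\<lambda>_. 0) \<in> K" "(\<lambda>_. 1) \<in> K"
    and x: "x \<in> topspace T"
  obtains m t \<rho> where "continuous_map (subtopology T (cell K T x)) (simplex_topology m) t"
    "\<forall>y\<in>cell K T x. t y \<in> standard_simplex m"
    "\<rho> 0 = (0::real)" "\<forall>k\<le>m. \<rho> k \<in> {0..<1}" "\<forall>k\<le>m. \<forall>j\<le>k. \<rho> j \<le> \<rho> k"
    "\<forall>y\<in>cell K T x. \<forall>r\<in>{0..<1}. \<forall>f\<in>K. f x \<le> \<rho> (idx (t y) r) \<longleftrightarrow> f y \<le> r"
proof -
  obtain m \<phi> where \<phi>: "\<phi> 0 = (\<lambda>_. 0)" "\<phi> (Suc m) = (\<lambda>_. 1)" "\<forall>k\<le>Suc m. \<phi> k \<in> K"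
    "\<forall>k\<le>m. \<phi> k x < (\<phi> (Suc k) x :: real)" "\<forall>k\<le>m. \<forall>f\<in>K. f x \<le> \<phi> k x \<or> \<phi> (Suc k) x \<le> f x"
    by (rule cut_functions[OF K(1,3,4), of x])
  define t where "t y = (\<lambda>k. if k \<le> m then \<phi> (Suc k) y - \<phi> k y else 0)" for y
  have cut: "cut (t y) k = \<phi> k y" if "k \<le> Suc m" for y k
    using that by (induction k) (auto simp: cut_Suc \<phi>(1) t_def)
  have mono: "\<phi> k y \<le> \<phi> (Suc k) y" if "y \<in> cell K T x" "k \<le> m" for k y
    using that \<phi>(3,4) unfolding same_type_def by (auto dest: less_imp_le)
  have t: "t y \<in> standard_simplex m" if "y \<in> cell K T x" for y
    using mono[OF that] cut[of "Suc m"] \<phi>(2) by (auto simp: standard_simplex_iff_cut t_def)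
  have le: "\<phi> j x \<le> \<phi> k x" if "j \<le> k" "k \<le> Suc m" for j k
    using that
  proof (induction k)
    case (Suc k)
    then show ?case using \<phi>(4)[rule_format, of k] by (cases "j = Suc k") auto
  qed simp
  show thesis
  proof (rule that[of m t "\<lambda>k. \<phi> k x"])
    have "continuous_map T euclideanreal (\<lambda>y. t y k)" for k
      using \<phi>(3) K(2) unfolding t_def by (cases "k \<le> m") (auto intro!: continuous_map_diff)
    then show "continuous_map (subtopology T (cell K T x)) (simplex_topology m) t"
      using t unfolding simplex_topology_def
      by (auto simp: continuous_map_in_subtopology continuous_map_componentwise_UNIV intro: continuous_map_from_subtopology)
    show "\<forall>y\<in>cell K T x. t y \<in> standard_simplex m" using t by blast
    show "\<phi> 0 x = 0" using \<phi>(1) by simp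
    have "\<phi> k x \<in> {0..<1}" if "k \<le> m" for k
      using le[of 0 k] le[of "Suc k" "Suc m"] \<phi>(1,2) \<phi>(4)[rule_format, OF that] that by force
    then show "\<forall>k\<le>m. \<phi> k x \<in> {0..<1}" by blast
    show "\<forall>k\<le>m. \<forall>j\<le>k. \<phi> j x \<le> \<phi> k x" using le by simp
    show "\<forall>y\<in>cell K T x. \<forall>r\<in>{0..<1}. \<forall>f\<in>K. f x \<le> \<phi> (idx (t y) r) x \<longleftrightarrow> f y \<le> r"
    proof (intro ballI)
    fix y r f assume y: "y \<in> cell K T x" and r: "r \<in> {0..<1::real}" and f: "f \<in> K"
    define k where "k = idx (t y) r"
    have k: "k \<le> m" "\<phi> k y \<le> r" "r < \<phi> (Suc k) y"
      using idx_bounds[OF t[OF y], of r] r cut[of k y] cut[of "Suc k" y] by (auto simp: k_def)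
    have st: "\<And>f h. f \<in> K \<Longrightarrow> h \<in> K \<Longrightarrow> f x \<le> h x \<Longrightarrow> f y \<le> h y" using y by (auto simp: same_type_def)
    have K: "\<phi> k \<in> K" "\<phi> (Suc k) \<in> K" using \<phi>(3) k(1) by auto
    show "f x \<le> \<phi> (idx (t y) r) x \<longleftrightarrow> f y \<le> r"
      unfolding k_def[symmetric]
    proof
      assume "f x \<le> \<phi> k x"
      then show "f y \<le> r" using st[OF f K(1)] k by simp
    next
      assume "f y \<le> r"
      show "f x \<le> \<phi> k x"
      proof (rule ccontr)
        assume "\<not> ?thesis"
        \<comment> \<open>At \<open>x\<close> no function of \<open>K\<close> lies strictly between
          neighbouring cuts, so \<open>f\<close> is at or above the right end of the interval, at
          \<open>x\<close> and hence at \<open>y\<close>.\<close>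
        then have "\<phi> (Suc k) x \<le> f x" using \<phi>(5) k(1) f by blast
        then show False using st[OF K(2) f] k \<open>f y \<le> r\<close> by simp
      qed
    qed
    qed
  qed
qed

lemma tame_cell:
  assumes "tame K (topspace T) q" "x \<in> topspace T" "y \<in> cell K T x" "r \<in> {0..<1}" "r' \<in> {0..<1}"
    "\<And>f. f \<in> K \<Longrightarrow> f x \<le> r' \<longleftrightarrow> f y \<le> r"
  shows "q y r = q x r'"
proof -
  have "y \<in> topspace T" "same_type K x y" "\<forall>f\<in>K. f x \<le> r' \<longleftrightarrow> f y \<le> r" using assms(3,6) by auto
  with assms(1,2,4,5) show ?thesis unfolding tame_def by (metis (no_types))
qed

section \<open>Tame families give continuous maps\<close>

context group begin

text \<open>Passage from homogeneous to bar coordinates, inverse to \<open>gval\<close> up to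
  translation by \<open>E 0\<close>.\<close>

definition diffs :: "(nat \<Rightarrow> 'a) \<Rightarrow> nat \<Rightarrow> 'a list" where
  "diffs E m = map (\<lambda>k. inv E k \<otimes> E (Suc k)) [0..<m]"

lemma diffs_closed:
  assumes "subgroup U G" "\<And>k. k \<le> m \<Longrightarrow> E k \<in> carrier G" "\<And>k. k \<le> m \<Longrightarrow> inv E 0 \<otimes> E k \<in> U"
  shows "set (diffs E m) \<subseteq> U" "length (diffs E m) = m"
proof -
  have "inv E k \<otimes> E (Suc k) \<in> U" if "k < m" for k
  proof -
    have c: "E 0 \<in> carrier G" "E k \<in> carrier G" "E (Suc k) \<in> carrier G" using assms(2) that by auto
    have "inv (inv E 0 \<otimes> E k) \<otimes> (inv E 0 \<otimes> E (Suc k)) \<in> U"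
      by (rule subgroup.m_closed[OF assms(1)], rule subgroup.m_inv_closed[OF assms(1)]) (use assms(3) that in auto)
    also have "inv (inv E 0 \<otimes> E k) \<otimes> (inv E 0 \<otimes> E (Suc k)) = inv E k \<otimes> (E 0 \<otimes> (inv E 0 \<otimes> E (Suc k)))"
      using c by (simp add: inv_mult_group m_assoc)
    also have "E 0 \<otimes> (inv E 0 \<otimes> E (Suc k)) = E (Suc k)"
      using c by (simp add: m_assoc[symmetric])
    finally show ?thesis .
  qed
  then show "set (diffs E m) \<subseteq> U" by (auto simp: diffs_def)
qed (simp add: diffs_def)

lemma gval_diffs:
  assumes "\<And>k. k \<le> m \<Longrightarrow> E k \<in> carrier G"
  shows "k \<le> m \<Longrightarrow> gval G (diffs E m) k = inv E 0 \<otimes> E k"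
proof (induction k)
  case 0
  then show ?case using assms[of 0] by simp
next
  case (Suc k)
  have c: "E 0 \<in> carrier G" "E k \<in> carrier G" "E (Suc k) \<in> carrier G" using assms Suc by auto
  have s: "set (diffs E m) \<subseteq> carrier G" "length (diffs E m) = m"
    using diffs_closed[OF subgroup_self, of m E] assms by auto
  have "gval G (diffs E m) (Suc k) = (inv E 0 \<otimes> E k) \<otimes> (inv E k \<otimes> E (Suc k))"
    using gval_Suc[OF s(1), of k] s Suc by (simp add: diffs_def)
  also have "\<dots> = inv E 0 \<otimes> (E k \<otimes> (inv E k \<otimes> E (Suc k)))"
    using c by (simp add: m_assoc)
  also have "E k \<otimes> (inv E k \<otimes> E (Suc k)) = E (Suc k)"
    using c by (simp add: m_assoc[symmetric])
  finally show ?case .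
qed

text \<open>On one cell the bar string is constant and only the simplex coordinates move. A
  representative at \<open>x0\<close> exists because \<open>x0\<close> lies in its own cell.\<close>

lemma continuous_map_bar_class:
  assumes "tamable T e" and e: "\<And>x r. x \<in> topspace T \<Longrightarrow> r \<in> {0..<1} \<Longrightarrow> e x r \<in> carrier G"
  shows "continuous_map T (classifying_space G) (\<lambda>x. bar_class G (e x))"
    and "x0 \<in> topspace T \<Longrightarrow> \<exists>p. bar_rep G (e x0) p"
proof -
  obtain K where K: "finite K" "\<forall>f\<in>K. continuous_map T euclideanreal f" "tame K (topspace T) e"
    using assms(1) unfolding tamable_def by metis
  define K' where "K' = insert (\<lambda>_. 0) (insert (\<lambda>_. 1) K)"
  have K': "finite K'" "\<And>f. f \<in> K' \<Longrightarrow> continuous_map T euclideanreal f" "(\<lambda>_. 0) \<in> K'" "(\<lambda>_. 1) \<in> K'"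
    using K by (auto simp: K'_def)
  have tame: "tame K' (topspace T) e" by (rule tame_mono[OF K(3)]) (auto simp: K'_def)
  have main: "\<exists>m t xs. continuous_map (subtopology T (cell K' T x)) (simplex_topology m) t \<and>
    set xs \<subseteq> carrier G \<and> length xs = m \<and> (\<forall>y \<in> cell K' T x. bar_rep G (e y) (m, xs, t y))"
    if x: "x \<in> topspace T" for x
  proof -
    obtain m t \<rho> where c: "continuous_map (subtopology T (cell K' T x)) (simplex_topology m) t"
      "\<forall>y\<in>cell K' T x. t y \<in> standard_simplex m"
      "\<rho> 0 = (0::real)" "\<forall>k\<le>m. \<rho> k \<in> {0..<1}" "\<forall>k\<le>m. \<forall>j\<le>k. \<rho> j \<le> \<rho> k"
      "\<forall>y\<in>cell K' T x. \<forall>r\<in>{0..<1}. \<forall>f\<in>K'. f x \<le> \<rho> (idx (t y) r) \<longleftrightarrow> f y \<le> r"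
      by (rule cell_coordinates[OF K' x])
    define E where "E k = e x (\<rho> k)" for k
    have E: "E k \<in> carrier G" if "k \<le> m" for k using e[OF x c(4)[rule_format, OF that]] by (simp add: E_def)
    have xs: "set (diffs E m) \<subseteq> carrier G" "length (diffs E m) = m"
      using diffs_closed[OF subgroup_self, of m E] E by auto
    have "bar_rep G (e y) (m, diffs E m, t y)" if y: "y \<in> cell K' T x" for y
    proof -
      have "e y r = E 0 \<otimes> gval G (diffs E m) (idx (t y) r)" if r: "r \<in> {0..<1}" for r
      proof -
        have k: "idx (t y) r \<le> m" using idx_bounds(3)[OF c(2)[rule_format, OF y]] r by auto
        have "e y r = E (idx (t y) r)"
          unfolding E_def by (rule tame_cell[OF tame x y r c(4)[rule_format, OF k]]) (use c(6)[rule_format, OF y r] in auto)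
        also have "\<dots> = E 0 \<otimes> (inv E 0 \<otimes> E (idx (t y) r))"
          using E[OF k] E[of 0] by (simp add: m_assoc[symmetric])
        finally show ?thesis using gval_diffs[OF E k] by simp
      qed
      then show ?thesis using xs c(2)[rule_format, OF y] E[of 0] unfolding bar_rep_def by auto
    qed
    then show ?thesis using c(1) xs by blast
  qed
  show "continuous_map T (classifying_space G) (\<lambda>x. bar_class G (e x))"
  proof (rule continuous_map_by_cells[OF K'(1,2)])
    fix x assume "x \<in> topspace T"
    from main[OF this] obtain m t xs where m:
      "continuous_map (subtopology T (cell K' T x)) (simplex_topology m) t"
      "set xs \<subseteq> carrier G" "length xs = m" "\<forall>y \<in> cell K' T x. bar_rep G (e y) (m, xs, t y)" by blast
    have "continuous_map (subtopology T (cell K' T x)) (classifying_space G) (\<lambda>y. bar_glue G `` {(m, xs, t y)})"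
      unfolding classifying_space_def
      by (rule continuous_map_into_realization[where a = "\<lambda>_. xs", OF _ m(1)]) (use m in \<open>simp add: bar_def\<close>)
    then show "continuous_map (subtopology T (cell K' T x)) (classifying_space G) (\<lambda>y. bar_class G (e y))"
      by (rule continuous_map_eq) (use m(4) bar_class_eq in auto)
  qed
  show "\<exists>p. bar_rep G (e x0) p" if "x0 \<in> topspace T"
  proof -
    have "x0 \<in> cell K' T x0" using that by (simp add: same_type_def)
    then show ?thesis using main[OF that] by blast
  qed
qed

end

context subgroup_family begin

definition valid :: "(real \<Rightarrow> 'a) \<Rightarrow> (real \<Rightarrow> 'a set) \<Rightarrow> bool" where
  "valid e V \<longleftrightarrow> (\<forall>r\<in>{0..<1}. e r \<in> carrier G \<and> V r \<in> P \<and> inv (e 0) \<otimes> e r \<in> V 0 \<and>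
    (\<forall>r'\<in>{0..<1}. r \<le> r' \<longrightarrow> V r \<subseteq> V r'))"

lemma continuous_map_hocolim_class:
  assumes "tamable T e" "tamable T V"
    and v: "\<And>x. x \<in> topspace T \<Longrightarrow> valid (e x) (V x)"
  shows "continuous_map T (hocolim_classifying G P) (\<lambda>x. hocolim_class G P (e x) (V x))"
    and "x0 \<in> topspace T \<Longrightarrow> \<exists>p. hocolim_rep G P (e x0) (V x0) p"
proof -
  obtain L M where K: "finite L" "\<forall>f\<in>L. continuous_map T euclideanreal f" "tame L (topspace T) e"
    "finite M" "\<forall>f\<in>M. continuous_map T euclideanreal f" "tame M (topspace T) V"
    using assms(1,2) unfolding tamable_def by metis
  \<comment> \<open>One set of cut functions adapted to \<open>e\<close> and \<open>V\<close> at
    once: the chain and the bar string are then written with the same coordinates \<open>t\<close>.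
    The constants 0 and 1 supply the two ends of the interval.\<close>
  define K' where "K' = insert (\<lambda>_. 0) (insert (\<lambda>_. 1) (L \<union> M))"
  have K': "finite K'" "\<And>f. f \<in> K' \<Longrightarrow> continuous_map T euclideanreal f" "(\<lambda>_. 0) \<in> K'" "(\<lambda>_. 1) \<in> K'"
    using K by (auto simp: K'_def)
  have tame: "tame K' (topspace T) e" "tame K' (topspace T) V"
    by (rule tame_mono[OF K(3)], auto simp: K'_def, rule tame_mono[OF K(6)], auto simp: K'_def)
  have main: "\<exists>m t us xs. continuous_map (subtopology T (cell K' T x)) (simplex_topology m) t \<and>
    us \<in> chains_in P m \<and> set xs \<subseteq> hd us \<and> length xs = m \<and>
    (\<forall>y \<in> cell K' T x. hocolim_rep G P (e y) (V y) (m, (us, bar_glue (G\<lparr>carrier := hd us\<rparr>) `` {(m, xs, t y)}), t y))"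
    if x: "x \<in> topspace T" for x
  proof -
    obtain m t \<rho> where c: "continuous_map (subtopology T (cell K' T x)) (simplex_topology m) t"
      "\<forall>y\<in>cell K' T x. t y \<in> standard_simplex m"
      "\<rho> 0 = (0::real)" "\<forall>k\<le>m. \<rho> k \<in> {0..<1}" "\<forall>k\<le>m. \<forall>j\<le>k. \<rho> j \<le> \<rho> k"
      "\<forall>y\<in>cell K' T x. \<forall>r\<in>{0..<1}. \<forall>f\<in>K'. f x \<le> \<rho> (idx (t y) r) \<longleftrightarrow> f y \<le> r"
      by (rule cell_coordinates[OF K' x])
    define E where "E k = e x (\<rho> k)" for k
    define us where "us = map (\<lambda>k. V x (\<rho> k)) [0..<Suc m]"
    \<comment> \<open>At a point \<open>y\<close> of the cell where the first interval has
      collapsed, \<open>V y 0\<close> may be larger than \<open>U\<close>. The representative keeps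
      \<open>U\<close> as its first subgroup on the whole cell, with first coordinate zero at such a
      \<open>y\<close>.\<close>
    define U where "U = V x 0"
    have E: "E k \<in> carrier G" "V x (\<rho> k) \<in> P" "inv E 0 \<otimes> E k \<in> U" if "k \<le> m" for k
      using v[OF x] c(4)[rule_format, OF that] c(3) by (auto simp: E_def valid_def U_def)
    have Vm: "V x (\<rho> j) \<subseteq> V x (\<rho> k)" if "j \<le> k" "k \<le> m" for j k
      using v[OF x] c(4)[rule_format, of j] c(4)[rule_format, of k] c(5)[rule_format, OF that(2,1)] that by (auto simp: valid_def)
    have us: "us \<in> chains_in P m"
      unfolding chains_in_def us_def using E(2) Vm by (auto simp: sorted_wrt_iff_nth_less simp del: upt_Suc)
    have hd: "hd us = U" unfolding us_def U_def by (simp add: upt_rec c(3))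
    have UP: "U \<in> P" using E(2)[of 0] c(3) by (simp add: U_def)
    have xs: "set (diffs E m) \<subseteq> U" "length (diffs E m) = m"
      using diffs_closed[OF subgroups[OF UP], of m E] E by auto
    interpret U: group "G\<lparr>carrier := U\<rparr>" by (rule group_member[OF UP])
    have "hocolim_rep G P (e y) (V y) (m, (us, bar_glue (G\<lparr>carrier := U\<rparr>) `` {(m, diffs E m, t y)}), t y)"
      if y: "y \<in> cell K' T x" for y
    proof -
      have b: "bar_rep (G\<lparr>carrier := U\<rparr>) (\<lambda>r. gval G (diffs E m) (idx (t y) r)) (m, diffs E m, t y)"
        using U.bar_rep_self[of "diffs E m" m "t y"] xs c(2)[rule_format, OF y] by simp
      have ey: "e y r = E 0 \<otimes> gval G (diffs E m) (idx (t y) r)" "V y r = us ! idx (t y) r"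
        if r: "r \<in> {0..<1}" for r
      proof -
        have k: "idx (t y) r \<le> m" using idx_bounds(3)[OF c(2)[rule_format, OF y]] r by auto
        have "e y r = E (idx (t y) r)"
          unfolding E_def by (rule tame_cell[OF tame(1) x y r c(4)[rule_format, OF k]]) (use c(6)[rule_format, OF y r] in auto)
        also have "\<dots> = E 0 \<otimes> (inv E 0 \<otimes> E (idx (t y) r))"
          using E(1)[OF k] E(1)[of 0] by (simp add: m_assoc[symmetric])
        finally show "e y r = E 0 \<otimes> gval G (diffs E m) (idx (t y) r)" using gval_diffs[OF E(1) k] by simp
        have "V y r = V x (\<rho> (idx (t y) r))"
          by (rule tame_cell[OF tame(2) x y r c(4)[rule_format, OF k]]) (use c(6)[rule_format, OF y r] in auto)
        also have "\<dots> = us ! idx (t y) r" using k by (simp add: us_def del: upt_Suc)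
        finally show "V y r = us ! idx (t y) r" .
      qed
      have E0: "E 0 \<in> carrier G" using E(1) by simp
      show ?thesis
        unfolding hocolim_rep_def prod.case hd U.bar_class_eq[OF b, symmetric]
        using us c(2)[rule_format, OF y] E0 b ey by blast
    qed
    then show ?thesis using c(1) us xs hd by blast
  qed
  show "continuous_map T (hocolim_classifying G P) (\<lambda>x. hocolim_class G P (e x) (V x))"
  proof (rule continuous_map_by_cells[OF K'(1,2)])
    fix x assume "x \<in> topspace T"
    from main[OF this] obtain m t us xs where m:
      "continuous_map (subtopology T (cell K' T x)) (simplex_topology m) t"
      "us \<in> chains_in P m" "set xs \<subseteq> hd us" "length xs = m"
      "\<forall>y \<in> cell K' T x. hocolim_rep G P (e y) (V y) (m, (us, bar_glue (G\<lparr>carrier := hd us\<rparr>) `` {(m, xs, t y)}), t y)"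
      by blast
    have 1: "continuous_map (subtopology T (cell K' T x)) (classifying_space (G\<lparr>carrier := hd us\<rparr>))
        (\<lambda>y. bar_glue (G\<lparr>carrier := hd us\<rparr>) `` {(m, xs, t y)})"
      unfolding classifying_space_def
      by (rule continuous_map_into_realization[where a = "\<lambda>_. xs", OF _ m(1)]) (use m in \<open>simp add: bar_def\<close>)
    have 2: "continuous_map (classifying_space (G\<lparr>carrier := hd us\<rparr>)) (hocolim_spaces G P m) (\<lambda>c. (us, c))"
      unfolding replacement_def
      by (rule continuous_map_component_injection[where X = "\<lambda>us. classifying_space (G\<lparr>carrier := hd us\<rparr>)", OF m(2)])
    have "continuous_map (subtopology T (cell K' T x)) (hocolim_classifying G P)
      (\<lambda>y. hocolim_glue G P `` {(m, (us, bar_glue (G\<lparr>carrier := hd us\<rparr>) `` {(m, xs, t y)}), t y)})"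
      unfolding hocolim_classifying_def hocolim_def
      by (rule continuous_map_into_realization[OF _ m(1)])
         (use continuous_map_compose[OF 1 2] in \<open>simp add: o_def\<close>)
    then show "continuous_map (subtopology T (cell K' T x)) (hocolim_classifying G P) (\<lambda>y. hocolim_class G P (e y) (V y))"
      by (rule continuous_map_eq) (use m(5) hocolim_class_eq in auto)
  qed
  show "\<exists>p. hocolim_rep G P (e x0) (V x0) p" if "x0 \<in> topspace T"
  proof -
    have "x0 \<in> cell K' T x0" using that by (simp add: same_type_def)
    then show ?thesis using main[OF that] by blast
  qed
qed

end

section \<open>Operations on step functions\<close>

lemma tameD:
  assumes "tame K S q" "x \<in> S" "y \<in> S" "r \<in> {0..<1}" "r' \<in> {0..<1}" "same_type K x y"
    "\<forall>f\<in>K. f x \<le> r \<longleftrightarrow> f y \<le> r'"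
  shows "q x r = q y r'"
  using assms unfolding tame_def by blast

lemma tamable_cong:
  assumes "tamable T q" "\<And>x r. x \<in> topspace T \<Longrightarrow> r \<in> {0..<1} \<Longrightarrow> q' x r = q x r"
  shows "tamable T q'"
  using assms(1) unfolding tamable_def tame_def by (simp add: assms(2) cong: ball_cong_simp)

lemma tamable_comp: "tamable T q \<Longrightarrow> tamable T (\<lambda>x r. F (q x r))"
  unfolding tamable_def tame_def by metis

lemma tamable_pair:
  assumes "tamable T q" "tamable T q'"
  shows "tamable T (\<lambda>x r. (q x r, q' x r))"
proof -
  obtain K K' where K: "finite K" "\<forall>f\<in>K. continuous_map T euclideanreal f" "tame K (topspace T) q"
    "finite K'" "\<forall>f\<in>K'. continuous_map T euclideanreal f" "tame K' (topspace T) q'"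
    using assms unfolding tamable_def by metis
  have "tame (K \<union> K') (topspace T) q" "tame (K \<union> K') (topspace T) q'"
    using tame_mono[OF K(3), of "K \<union> K'"] tame_mono[OF K(6), of "K \<union> K'"] by auto
  then have "tame (K \<union> K') (topspace T) (\<lambda>x r. (q x r, q' x r))" unfolding tame_def by (metis (no_types))
  then show ?thesis unfolding tamable_def using K by (intro exI[of _ "K \<union> K'"]) auto
qed

lemma tamable_comp2:
  assumes "tamable T q" "tamable T q'"
  shows "tamable T (\<lambda>x r. F (q x r) (q' x r))"
  using tamable_comp[OF tamable_pair[OF assms], of "\<lambda>(a, b). F a b"] by simp

lemma tamable_pullback:
  assumes "tamable T q" "continuous_map T' T \<pi>"
  shows "tamable T' (\<lambda>x. q (\<pi> x))"
proof -
  obtain K where K: "finite K" "\<forall>f\<in>K. continuous_map T euclideanreal f" "tame K (topspace T) q"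
    using assms unfolding tamable_def by metis
  have \<pi>: "\<pi> x \<in> topspace T" if "x \<in> topspace T'" for x
    using assms(2) that by (auto simp: continuous_map_def)
  have "tame ((\<lambda>f. f \<circ> \<pi>) ` K) (topspace T') (\<lambda>x. q (\<pi> x))"
    unfolding tame_def
  proof (intro ballI impI)
    fix x y and r r' :: real
    assume "x \<in> topspace T'" "y \<in> topspace T'" "r \<in> {0..<1}" "r' \<in> {0..<1}"
      "same_type ((\<lambda>f. f \<circ> \<pi>) ` K) x y" "\<forall>f\<in>(\<lambda>f. f \<circ> \<pi>) ` K. f x \<le> r \<longleftrightarrow> f y \<le> r'"
    then show "q (\<pi> x) r = q (\<pi> y) r'"
      by (intro tameD[OF K(3)] \<pi>) (simp_all add: same_type_def)
  qed
  moreover have "\<forall>f\<in>(\<lambda>f. f \<circ> \<pi>) ` K. continuous_map T' euclideanreal f"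
    using K(2) continuous_map_compose[OF assms(2)] by auto
  ultimately show ?thesis unfolding tamable_def using K(1) by blast
qed

text \<open>Comparing \<open>f x\<close> with \<open>a * r + b\<close> amounts to comparing
  \<open>(f x - b) / a\<close> with \<open>r\<close>, and this affine change keeps the order of the
  cut functions.\<close>

lemma tamable_reparametrize:
  fixes a b :: real
  assumes "tamable T q" "0 < a" "0 \<le> b" "a + b \<le> 1"
  shows "tamable T (\<lambda>x r. q x (a * r + b))"
proof -
  obtain K where K: "finite K" "\<forall>f\<in>K. continuous_map T euclideanreal f" "tame K (topspace T) q"
    using assms unfolding tamable_def by metis
  have le: "(u - b) / a \<le> r \<longleftrightarrow> u \<le> a * r + b" for u r :: real
    using assms(2) by (simp add: field_simps)
  have le': "(u - b) / a \<le> (v - b) / a \<longleftrightarrow> u \<le> v" for u v :: real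
    using assms(2) by (simp add: field_simps)
  have r: "a * r + b \<in> {0..<1}" if "r \<in> {0..<1}" for r
  proof -
    have "a * r < a * 1" using that assms(2) by (intro mult_strict_left_mono) auto
    then have "a * r + b < 1" using assms(4) by linarith
    then show ?thesis using that assms by auto
  qed
  have "tame ((\<lambda>f x. (f x - b) / a) ` K) (topspace T) (\<lambda>x r. q x (a * r + b))"
    unfolding tame_def
  proof (intro ballI impI)
    fix x y and r r' :: real
    assume *: "x \<in> topspace T" "y \<in> topspace T" "r \<in> {0..<1}" "r' \<in> {0..<1}"
      and st: "same_type ((\<lambda>f x. (f x - b) / a) ` K) x y"
      and pos: "\<forall>f\<in>(\<lambda>f x. (f x - b) / a) ` K. f x \<le> r \<longleftrightarrow> f y \<le> r'"
    have "same_type K x y" using st unfolding same_type_def ball_simps le' .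
    moreover have "\<forall>f\<in>K. f x \<le> a * r + b \<longleftrightarrow> f y \<le> a * r' + b" using pos unfolding ball_simps le .
    ultimately show "q x (a * r + b) = q y (a * r' + b)"
      using tameD[OF K(3) *(1,2) r[OF *(3)] r[OF *(4)]] by blast
  qed
  moreover have "\<forall>f\<in>(\<lambda>f x. (f x - b) / a) ` K. continuous_map T euclideanreal f"
  proof
    fix f' assume "f' \<in> (\<lambda>f x. (f x - b) / a) ` K"
    then obtain f where f: "f \<in> K" "f' = (\<lambda>x. (f x - b) / a)" by blast
    have "continuous_map T euclideanreal f" using K f by blast
    then have "continuous_map T euclideanreal (\<lambda>x. (f x - b) * (1 / a))"
      by (intro continuous_map_real_mult continuous_map_diff) auto
    then show "continuous_map T euclideanreal f'" using f by simp
  qed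
  ultimately show ?thesis unfolding tamable_def using K(1) by blast
qed

lemma tamable_positions:
  assumes "finite K" "\<And>f. f \<in> K \<Longrightarrow> continuous_map T euclideanreal f"
  shows "tamable T (\<lambda>x r. {f \<in> K. f x \<le> r})"
  unfolding tamable_def tame_def using assms by (intro exI[of _ K]) blast

lemma tamable_positions_indexed:
  assumes "finite I" "\<And>i. i \<in> I \<Longrightarrow> continuous_map T euclideanreal (f i)"
  shows "tamable T (\<lambda>x r. {i \<in> I. f i x \<le> r})"
proof -
  have "tamable T (\<lambda>x r. {h \<in> f ` I. h x \<le> r})"
    by (rule tamable_positions) (use assms in auto)
  from tamable_comp[OF this, of "\<lambda>A. {i \<in> I. f i \<in> A}"] show ?thesis
    by (rule tamable_cong) auto
qed

text \<open>As \<open>c\<close> runs from 0 to 1, this is a path from \<open>b\<close> to \<open>a\<close> in a space of step functions.\<close>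

definition splice :: "real \<Rightarrow> (real \<Rightarrow> 'b) \<Rightarrow> (real \<Rightarrow> 'b) \<Rightarrow> real \<Rightarrow> 'b" where
  "splice c a b r = (if r < c then a r else b r)"

text \<open>The splicing point is one more cut function, so it may move freely across the jumps of
  both step functions.\<close>

lemma tamable_splice:
  assumes "tamable T q" "tamable T q'" "continuous_map T euclideanreal c"
  shows "tamable T (\<lambda>x. splice (c x) (q x) (q' x))"
proof -
  have "tamable T (\<lambda>x r. {f \<in> {c}. f x \<le> r})"
    by (rule tamable_positions) (use assms in auto)
  from tamable_comp2[OF this tamable_pair[OF assms(1,2)], of "\<lambda>A (u, v). if A = {} then u else v"]
  show ?thesis by (rule tamable_cong) (auto simp: splice_def)
qed

definition unit_interval :: "real topology" where
  "unit_interval = top_of_set {0..1}"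

lemma unit_interval_compact: "compact_space unit_interval" "Hausdorff_space unit_interval"
  by (auto simp: unit_interval_def compact_space_subtopology Hausdorff_space_subtopology Hausdorff_space_euclidean
      compactin_euclidean_iff)

lemma continuous_map_cut: "continuous_map (simplex_topology n) euclideanreal (\<lambda>t. cut t k)"
  unfolding cut_def simplex_topology_def
  by (intro continuous_map_sum continuous_map_from_subtopology) (auto intro: continuous_map_product_projection)

lemma tamable_idx: "tamable (simplex_topology n) (\<lambda>t r. idx t r)"
proof -
  have "tamable (simplex_topology n) (\<lambda>t r. {k \<in> {..n}. cut t (Suc k) \<le> r})"
    by (rule tamable_positions_indexed) (auto intro: continuous_map_cut)
  from tamable_comp[OF this, of "\<lambda>A. LEAST k. k \<notin> A"] show ?thesis
  proof (rule tamable_cong)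
    fix t r assume "t \<in> topspace (simplex_topology n)" "r \<in> {0..<1::real}"
    then have t: "t \<in> standard_simplex n" "0 \<le> r" "r < 1" by auto
    show "idx t r = (LEAST k. k \<notin> {k \<in> {..n}. cut t (Suc k) \<le> r})"
    proof (rule Least_equality[symmetric])
      show "idx t r \<notin> {k \<in> {..n}. cut t (Suc k) \<le> r}" using idx_bounds[OF t] by auto
      fix k assume k: "k \<notin> {k \<in> {..n}. cut t (Suc k) \<le> r}"
      show "idx t r \<le> k"
      proof (cases "k \<le> n")
        case True
        then have "r < cut t (Suc k)" using k by auto
        then show ?thesis unfolding idx_def by (rule Least_le)
      qed (use idx_bounds(3)[OF t] in auto)
    qed
  qed
qed

definition bar_fun :: "('g, 'm) monoid_scheme \<Rightarrow> 'g list \<Rightarrow> (nat \<Rightarrow> real) \<Rightarrow> real \<Rightarrow> 'g" where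
  "bar_fun G xs t r = gval G xs (idx t r)"

definition chain_fun :: "'g set list \<Rightarrow> (nat \<Rightarrow> real) \<Rightarrow> real \<Rightarrow> 'g set" where
  "chain_fun us s r = us ! idx s r"

lemma bar_fun_subgroup [simp]: "bar_fun (G\<lparr>carrier := U\<rparr>) = bar_fun G"
  by (simp add: bar_fun_def fun_eq_iff)

lemma tamable_bar_fun: "tamable (simplex_topology n) (\<lambda>t. bar_fun G xs t)"
  using tamable_comp[OF tamable_idx, of n "gval G xs"] by (simp add: bar_fun_def[abs_def])

lemma tamable_chain_fun: "tamable (simplex_topology n) (\<lambda>s. chain_fun us s)"
  using tamable_comp[OF tamable_idx, of n "\<lambda>k. us ! k"] by (simp add: chain_fun_def[abs_def])

lemma bar_class_cong: "(\<And>r. r \<in> {0..<1} \<Longrightarrow> e r = e' r) \<Longrightarrow> bar_class G e = bar_class G e'"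
  unfolding bar_class_def bar_rep_def by (simp cong: ball_cong_simp)

lemma hocolim_class_cong:
  "(\<And>r. r \<in> {0..<1} \<Longrightarrow> e r = e' r) \<Longrightarrow> (\<And>r. r \<in> {0..<1} \<Longrightarrow> V r = V' r) \<Longrightarrow>
    hocolim_class G P e V = hocolim_class G P e' V'"
  unfolding hocolim_class_def hocolim_rep_def by (simp cong: ball_cong_simp)

context group begin

lemma bar_fun_closed: "set xs \<subseteq> carrier G \<Longrightarrow> bar_fun G xs t r \<in> carrier G"
  by (simp add: bar_fun_def)

lemma bar_class_bar_fun:
  assumes "set xs \<subseteq> carrier G" "length xs = n" "t \<in> standard_simplex n"
  shows "bar_rep G (bar_fun G xs t) (n, xs, t)" "bar_glue G `` {(n, xs, t)} = bar_class G (bar_fun G xs t)"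
  using bar_rep_self[OF assms] bar_class_eq[OF bar_rep_self[OF assms]] by (auto simp: bar_fun_def[abs_def])

lemma coset_trans:
  assumes "subgroup U G" "c \<in> carrier G" "x \<in> carrier G" "y \<in> carrier G" "inv c \<otimes> x \<in> U" "inv c \<otimes> y \<in> U"
  shows "inv x \<otimes> y \<in> U"
proof -
  have "inv (inv c \<otimes> x) \<otimes> (inv c \<otimes> y) \<in> U"
    by (rule subgroup.m_closed[OF assms(1) subgroup.m_inv_closed[OF assms(1,5)] assms(6)])
  also have "inv (inv c \<otimes> x) \<otimes> (inv c \<otimes> y) = inv x \<otimes> (c \<otimes> (inv c \<otimes> y))"
    using assms(2-4) by (simp add: inv_mult_group m_assoc)
  also have "c \<otimes> (inv c \<otimes> y) = y" using assms(2,4) by (simp add: m_assoc[symmetric])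
  finally show ?thesis .
qed

end

section \<open>Charts of the homotopy colimit and natural operations on it\<close>

context subgroup_family begin

text \<open>A closed cell of the homotopy colimit, the product of the simplex of a chain and the
  simplex of a bar string in its first subgroup. In a chart the step function takes its values in
  \<open>hd us\<close> itself, not merely in one of its cosets.\<close>

definition chart :: "'a set list \<Rightarrow> 'a list \<Rightarrow> (nat \<Rightarrow> real) \<Rightarrow> (nat \<Rightarrow> real) \<Rightarrow> bool" where
  "chart us xs s t \<longleftrightarrow> us \<in> chains_in P (length us - 1) \<and> set xs \<subseteq> hd us \<and>
     s \<in> standard_simplex (length us - 1) \<and> t \<in> standard_simplex (length xs)"

definition chart_point :: "'a set list \<Rightarrow> 'a list \<Rightarrow> (nat \<Rightarrow> real) \<Rightarrow> (nat \<Rightarrow> real) \<Rightarrow> 'a hocolim_rep" where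
  "chart_point us xs s t = (length us - 1, (us, bar_glue (G\<lparr>carrier := hd us\<rparr>) `` {(length xs, xs, t)}), s)"

definition chart_fun :: "(real \<Rightarrow> 'a) \<Rightarrow> (real \<Rightarrow> 'a set) \<Rightarrow> bool" where
  "chart_fun e V \<longleftrightarrow> (\<exists>us xs s t. chart us xs s t \<and> e = bar_fun G xs t \<and> V = chain_fun us s)"

lemma chartD:
  assumes "chart us xs s t"
  shows "hd us \<in> P" "set xs \<subseteq> carrier G" "r \<in> {0..<1} \<Longrightarrow> bar_fun G xs t r \<in> hd us"
    "r \<in> {0..<1} \<Longrightarrow> chain_fun us s r \<in> P" "r \<in> {0..<1} \<Longrightarrow> hd us \<subseteq> chain_fun us s r"
    "r \<in> {0..<1} \<Longrightarrow> r' \<in> {0..<1} \<Longrightarrow> r \<le> r' \<Longrightarrow> chain_fun us s r \<subseteq> chain_fun us s r'"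
    "k \<le> length xs \<Longrightarrow> gval G xs k \<in> hd us"
proof -
  define n where "n = length us - 1"
  have c: "us \<in> chains_in P n" "set xs \<subseteq> hd us" "s \<in> standard_simplex n" "t \<in> standard_simplex (length xs)"
    using assms by (auto simp: chart_def n_def)
  show hd: "hd us \<in> P" using chains_in_hd_mem[OF c(1)] by blast
  interpret U: group "G\<lparr>carrier := hd us\<rparr>" by (rule group_member[OF hd])
  show "set xs \<subseteq> carrier G" using member_carrier[OF hd] c(2) by blast
  show g: "gval G xs k \<in> hd us" for k using U.gval_closed[of xs k] c(2) by simp
  then show "bar_fun G xs t r \<in> hd us" by (simp add: bar_fun_def)
  have b: "idx s r \<le> n" if "r \<in> {0..<1}" for r using idx_bounds(3)[OF c(3)] that by auto
  show "chain_fun us s r \<in> P" if "r \<in> {0..<1}"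
    using b[OF that] c(1) by (auto simp: chain_fun_def chains_in_def)
  have h0: "hd us = us ! 0" using chains_in_hd_mem[OF c(1)] by blast
  show "hd us \<subseteq> chain_fun us s r" if "r \<in> {0..<1}"
    using chain_mono[OF c(1) _ b[OF that], of 0] h0 by (simp add: chain_fun_def)
  show "chain_fun us s r \<subseteq> chain_fun us s r'" if r: "r \<in> {0..<1}" "r' \<in> {0..<1}" "r \<le> r'"
  proof -
    have "idx s r \<le> idx s r'"
      using idx_bounds(2)[OF c(3), of r'] r unfolding idx_def[of s r] by (intro Least_le) auto
    then show ?thesis using chain_mono[OF c(1) _ b[OF r(2)]] by (simp add: chain_fun_def)
  qed
qed

lemma chart_valid:
  assumes "chart us xs s t"
  shows "valid (bar_fun G xs t) (chain_fun us s)"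
proof -
  note c = chartD[OF assms]
  have "inv (bar_fun G xs t 0) \<otimes> bar_fun G xs t r \<in> chain_fun us s 0" if "r \<in> {0..<1}" for r
  proof -
    have "bar_fun G xs t 0 \<in> hd us" by (rule c(3)) simp
    then have "inv (bar_fun G xs t 0) \<otimes> bar_fun G xs t r \<in> hd us"
      by (intro subgroup.m_closed[OF subgroups[OF c(1)] subgroup.m_inv_closed[OF subgroups[OF c(1)]]] c(3)[OF that])
    moreover have "hd us \<subseteq> chain_fun us s 0" by (rule c(5)) simp
    ultimately show ?thesis by blast
  qed
  then show ?thesis unfolding valid_def using bar_fun_closed[OF c(2)] c(4) c(6) by simp
qed

lemma chart_rep:
  assumes "chart us xs s t"
  shows "hocolim_rep G P (bar_fun G xs t) (chain_fun us s) (chart_point us xs s t)"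
proof -
  note c = chartD[OF assms]
  interpret U: group "G\<lparr>carrier := hd us\<rparr>" by (rule group_member[OF c(1)])
  have b: "bar_rep (G\<lparr>carrier := hd us\<rparr>) (bar_fun G xs t) (length xs, xs, t)"
    "bar_glue (G\<lparr>carrier := hd us\<rparr>) `` {(length xs, xs, t)} = bar_class (G\<lparr>carrier := hd us\<rparr>) (bar_fun G xs t)"
  proof -
    have x: "set xs \<subseteq> carrier (G\<lparr>carrier := hd us\<rparr>)" "t \<in> standard_simplex (length xs)"
      using assms by (simp_all add: chart_def)
    show "bar_rep (G\<lparr>carrier := hd us\<rparr>) (bar_fun G xs t) (length xs, xs, t)"
      "bar_glue (G\<lparr>carrier := hd us\<rparr>) `` {(length xs, xs, t)} = bar_class (G\<lparr>carrier := hd us\<rparr>) (bar_fun G xs t)"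
      using U.bar_class_bar_fun[OF x(1) refl x(2)] by simp_all
  qed
  have "\<forall>r\<in>{0..<1}. bar_fun G xs t r = \<one> \<otimes> bar_fun G xs t r" using bar_fun_closed[OF c(2)] by simp
  with b have 2: "\<exists>g\<in>carrier G. \<exists>e' p. bar_rep (G\<lparr>carrier := hd us\<rparr>) e' p \<and>
      bar_glue (G\<lparr>carrier := hd us\<rparr>) `` {(length xs, xs, t)} = bar_class (G\<lparr>carrier := hd us\<rparr>) e' \<and>
      (\<forall>r\<in>{0..<1}. bar_fun G xs t r = g \<otimes> e' r)" by blast
  have 1: "us \<in> chains_in P (length us - 1)" "s \<in> standard_simplex (length us - 1)"
    using assms by (simp_all add: chart_def)
  show ?thesis
    unfolding hocolim_rep_def chart_point_def prod.case
    by (intro conjI 1 2) (simp add: chain_fun_def)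
qed

lemma hocolim_point_cases:
  assumes "C \<in> topspace (hocolim_classifying G P)"
  obtains us xs s t where "chart us xs s t" "C = hocolim_class G P (bar_fun G xs t) (chain_fun us s)"
proof -
  obtain p where p: "p \<in> topspace (simplex_sum (hocolim_spaces G P))" "C = hocolim_glue G P `` {p}"
    using assms unfolding topspace_hocolim_classifying by (auto elim: quotientE)
  obtain n us c s where pp: "p = (n, (us, c), s)" by (metis prod.exhaust)
  then have us: "us \<in> chains_in P n" "c \<in> topspace (classifying_space (G\<lparr>carrier := hd us\<rparr>))" "s \<in> standard_simplex n"
    using p(1) by auto
  have hd: "hd us \<in> P" using chains_in_hd_mem[OF us(1)] by blast
  have "\<exists>xs t. set xs \<subseteq> hd us \<and> t \<in> standard_simplex (length xs) \<and>
      c = bar_glue (G\<lparr>carrier := hd us\<rparr>) `` {(length xs, xs, t)}"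
  proof (rule group.classifying_point_cases[OF group_member[OF hd] us(2)])
    fix m xs t
    assume a: "set xs \<subseteq> carrier (G\<lparr>carrier := hd us\<rparr>)" "length xs = m" "t \<in> standard_simplex m"
      "c = bar_glue (G\<lparr>carrier := hd us\<rparr>) `` {(m, xs, t)}"
    then have "set xs \<subseteq> hd us" by simp
    with a show ?thesis by blast
  qed
  then obtain xs t where x: "set xs \<subseteq> hd us" "t \<in> standard_simplex (length xs)"
    "c = bar_glue (G\<lparr>carrier := hd us\<rparr>) `` {(length xs, xs, t)}" by blast
  have n: "length us - 1 = n" using us(1) by (simp add: chains_in_def)
  have ch: "chart us xs s t" using us x n by (simp add: chart_def)
  have "C = hocolim_class G P (bar_fun G xs t) (chain_fun us s)"
    unfolding hocolim_class_eq[OF chart_rep[OF ch]] using p pp x n by (simp add: chart_point_def)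
  then show thesis using that ch by blast
qed

lemma hocolim_rep_unique_function:
  assumes "hocolim_rep G P e V p" "hocolim_rep G P e' V' p"
  shows "\<exists>g\<in>carrier G. \<forall>r\<in>{0..<1}. e' r = g \<otimes> e r \<and> V' r = V r"
proof -
  obtain n us c s where p: "p = (n, (us, c), s)" by (metis prod.exhaust)
  obtain g e1 p1 where g: "g \<in> carrier G" "bar_rep (G\<lparr>carrier := hd us\<rparr>) e1 p1"
      "c = bar_class (G\<lparr>carrier := hd us\<rparr>) e1" "\<forall>r\<in>{0..<1}. e r = g \<otimes> e1 r"
    and us: "us \<in> chains_in P n" and V: "\<forall>r\<in>{0..<1}. V r = us ! idx s r"
    using assms(1) p by (auto simp: hocolim_rep_def)
  obtain h e2 p2 where h: "h \<in> carrier G" "bar_rep (G\<lparr>carrier := hd us\<rparr>) e2 p2"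
      "c = bar_class (G\<lparr>carrier := hd us\<rparr>) e2" "\<forall>r\<in>{0..<1}. e' r = h \<otimes> e2 r"
    and V': "\<forall>r\<in>{0..<1}. V' r = us ! idx s r"
    using assms(2) p by (auto simp: hocolim_rep_def)
  have hd: "hd us \<in> P" using chains_in_hd_mem[OF us(1)] by blast
  interpret U: group "G\<lparr>carrier := hd us\<rparr>" by (rule group_member[OF hd])
  have "bar_rep (G\<lparr>carrier := hd us\<rparr>) e2 p1" using U.bar_rep_of_class_eq[OF _ g(2)] g(3) h(3) by simp
  from U.bar_rep_unique_function[OF g(2) this] obtain k where
    k: "k \<in> hd us" "\<forall>r\<in>{0..<1}. e2 r = k \<otimes> e1 r" by auto
  have kc: "k \<in> carrier G" using k member_carrier[OF hd] by blast
  have "e' r = (h \<otimes> k \<otimes> inv g) \<otimes> e r" if r: "r \<in> {0..<1}" for r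
  proof -
    have e1: "e1 r \<in> carrier G" using U.bar_rep_closed[OF g(2) r] member_carrier[OF hd] by simp
    have "(h \<otimes> k \<otimes> inv g) \<otimes> e r = (h \<otimes> k) \<otimes> (inv g \<otimes> (g \<otimes> e1 r))"
      using g(1,4) h(1) kc e1 r by (simp add: m_assoc)
    also have "inv g \<otimes> (g \<otimes> e1 r) = e1 r" using g(1) e1 by (simp add: m_assoc[symmetric])
    finally show ?thesis using h(1,4) k kc e1 r by (simp add: m_assoc)
  qed
  then show ?thesis using V V' g(1) h(1) kc by (intro bexI[of _ "h \<otimes> k \<otimes> inv g"]) auto
qed

text \<open>A point determines its pair of step functions only up to translation, so one pair coming
  from a chart is chosen arbitrarily. Equivariant constructions do not depend on this
  choice.\<close>

definition select :: "'a hocolim_rep set \<Rightarrow> (real \<Rightarrow> 'a) \<times> (real \<Rightarrow> 'a set)" where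
  "select C = (SOME (e, V). chart_fun e V \<and> C = hocolim_class G P e V)"

lemma select_chart:
  assumes "chart us xs s t"
  obtains g e V where "select (hocolim_class G P (bar_fun G xs t) (chain_fun us s)) = (e, V)"
    "chart_fun e V" "g \<in> carrier G" "\<forall>r\<in>{0..<1}. e r = g \<otimes> bar_fun G xs t r \<and> V r = chain_fun us s r"
proof -
  define C where "C = hocolim_class G P (bar_fun G xs t) (chain_fun us s)"
  obtain e V where eV: "select C = (e, V)" by (cases "select C")
  have "\<exists>p. case p of (e, V) \<Rightarrow> chart_fun e V \<and> C = hocolim_class G P e V"
    using assms unfolding C_def chart_fun_def by (intro exI[of _ "(bar_fun G xs t, chain_fun us s)"]) auto
  from someI_ex[OF this] have c: "chart_fun e V" "C = hocolim_class G P e V"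
    using eV by (auto simp: select_def)
  have "hocolim_rep G P e V (chart_point us xs s t)"
    using chart_rep[OF assms] c(2) by (auto simp: C_def hocolim_class_def)
  from hocolim_rep_unique_function[OF chart_rep[OF assms] this] show thesis
    using that eV c(1) unfolding C_def by blast
qed

text \<open>Equivariance under left translation, together with independence of the values outside
  [0, 1). This makes \<open>op_map\<close> well defined on classes.\<close>

definition natural :: "((real \<Rightarrow> 'a) \<Rightarrow> (real \<Rightarrow> 'a set) \<Rightarrow> real \<Rightarrow> 'a) \<Rightarrow>
    ((real \<Rightarrow> 'a) \<Rightarrow> (real \<Rightarrow> 'a set) \<Rightarrow> real \<Rightarrow> 'a set) \<Rightarrow> bool" where
  "natural E W \<longleftrightarrow> (\<forall>e V e' V'. \<forall>g\<in>carrier G. chart_fun e V \<longrightarrow> chart_fun e' V' \<longrightarrow>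
     (\<forall>r\<in>{0..<1}. e' r = g \<otimes> e r \<and> V' r = V r) \<longrightarrow>
     (\<forall>r\<in>{0..<1}. E e' V' r = g \<otimes> E e V r \<and> W e' V' r = W e V r))"

definition chart_tamable :: "((real \<Rightarrow> 'a) \<Rightarrow> (real \<Rightarrow> 'a set) \<Rightarrow> real \<Rightarrow> 'c) \<Rightarrow> bool" where
  "chart_tamable q \<longleftrightarrow> (\<forall>us xs. us \<in> chains_in P (length us - 1) \<longrightarrow> set xs \<subseteq> hd us \<longrightarrow>
     tamable (prod_topology (simplex_topology (length us - 1)) (simplex_topology (length xs)))
       (\<lambda>(s, t). q (bar_fun G xs t) (chain_fun us s)))"

definition operation where
  "operation E W \<longleftrightarrow> natural E W \<and> (\<forall>e V. chart_fun e V \<longrightarrow> valid (E e V) (W e V)) \<and>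
     chart_tamable E \<and> chart_tamable W"

definition op_map where
  "op_map E W C = (let (e, V) = select C in hocolim_class G P (E e V) (W e V))"

lemma hocolim_class_translate:
  assumes "hocolim_rep G P e V p" "g \<in> carrier G" "\<forall>r\<in>{0..<1}. e' r = g \<otimes> e r \<and> V' r = V r"
  shows "hocolim_class G P e' V' = hocolim_class G P e V"
  using hocolim_class_eq[OF assms(1)] hocolim_class_eq[OF hocolim_rep_translate[OF assms(1,2)]] assms(3) by simp

lemma chart_funI: "chart us xs s t \<Longrightarrow> chart_fun (bar_fun G xs t) (chain_fun us s)"
  unfolding chart_fun_def by blast

lemma operation_valid:
  "operation E W \<Longrightarrow> chart_fun e V \<Longrightarrow> valid (E e V) (W e V)"
  unfolding operation_def by blast

lemma operation_natural:
  assumes "operation E W" "g \<in> carrier G" "chart_fun e V" "chart_fun e' V'"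
    "\<forall>r\<in>{0..<1}. e' r = g \<otimes> e r \<and> V' r = V r"
  shows "\<forall>r\<in>{0..<1}. E e' V' r = g \<otimes> E e V r \<and> W e' V' r = W e V r"
proof -
  have "natural E W" using assms(1) by (simp add: operation_def)
  then show ?thesis using assms(2-5) unfolding natural_def by blast
qed

text \<open>Translation invariance of classes presupposes a representative; tameness of the
  operation provides it.\<close>

lemma operation_rep:
  assumes "operation E W" "chart us xs s t"
  shows "\<exists>p. hocolim_rep G P (E (bar_fun G xs t) (chain_fun us s)) (W (bar_fun G xs t) (chain_fun us s)) p"
proof -
  let ?T = "prod_topology (simplex_topology (length us - 1)) (simplex_topology (length xs))"
  have c: "us \<in> chains_in P (length us - 1)" "set xs \<subseteq> hd us"
    "s \<in> standard_simplex (length us - 1)" "t \<in> standard_simplex (length xs)"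
    using assms(2) by (simp_all add: chart_def)
  have t: "tamable ?T (\<lambda>(s, t). E (bar_fun G xs t) (chain_fun us s))"
     "tamable ?T (\<lambda>(s, t). W (bar_fun G xs t) (chain_fun us s))"
    using assms(1) c unfolding operation_def chart_tamable_def by auto
  have v: "valid ((\<lambda>(s, t). E (bar_fun G xs t) (chain_fun us s)) x) ((\<lambda>(s, t). W (bar_fun G xs t) (chain_fun us s)) x)"
    if "x \<in> topspace ?T" for x
  proof -
    obtain s t where x: "x = (s, t)" by (cases x)
    then have "chart us xs s t" using that c by (simp add: chart_def)
    then show ?thesis unfolding x prod.case by (rule operation_valid[OF assms(1) chart_funI])
  qed
  have "(s, t) \<in> topspace ?T" using c by simp
  from continuous_map_hocolim_class(2)[OF t v this] show ?thesis by simp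
qed

lemma op_map_chart:
  assumes "operation E W" "chart us xs s t"
  shows "op_map E W (hocolim_class G P (bar_fun G xs t) (chain_fun us s)) =
    hocolim_class G P (E (bar_fun G xs t) (chain_fun us s)) (W (bar_fun G xs t) (chain_fun us s))"
proof -
  obtain g e V where s: "select (hocolim_class G P (bar_fun G xs t) (chain_fun us s)) = (e, V)"
    "chart_fun e V" "g \<in> carrier G" "\<forall>r\<in>{0..<1}. e r = g \<otimes> bar_fun G xs t r \<and> V r = chain_fun us s r"
    by (rule select_chart[OF assms(2)])
  obtain p where p: "hocolim_rep G P (E (bar_fun G xs t) (chain_fun us s)) (W (bar_fun G xs t) (chain_fun us s)) p"
    using operation_rep[OF assms] by (rule exE)
  show ?thesis
    unfolding op_map_def s(1) Let_def prod.case
    by (rule hocolim_class_translate[OF p s(3) operation_natural[OF assms(1) s(3) chart_funI[OF assms(2)] s(2,4)]])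
qed

text \<open>Starting from \<open>(E1, W1)\<close>, the subgroups are exchanged before the group elements: as long as
  subgroups of \<open>W1\<close> occur, all group elements come from \<open>E1\<close>.\<close>

lemma operations_homotopic:
  assumes 1: "operation E1 W1" and 2: "operation E2 W2"
    and W: "\<And>e V r. chart_fun e V \<Longrightarrow> r \<in> {0..<1} \<Longrightarrow> W1 e V r \<subseteq> W2 e V r"
    and E: "\<And>e V r. chart_fun e V \<Longrightarrow> r \<in> {0..<1} \<Longrightarrow> inv (E1 e V 0) \<otimes> E2 e V r \<in> W2 e V 0"
  shows "homotopic_with (\<lambda>_. True) (hocolim_classifying G P) (hocolim_classifying G P)
    (op_map E2 W2) (op_map E1 W1)"
proof -
  \<comment> \<open>As \<open>z\<close> grows, the pair moves from \<open>(E2, W2)\<close> to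
    \<open>(E1, W1)\<close>: the elements are spliced for \<open>z \<le> 1/2\<close>, the subgroups
    for \<open>z \<ge> 1/2\<close>.\<close>
  define EE where "EE z e V = splice (min 1 (2 * z)) (E1 e V) (E2 e V)" for z e V
  define WW where "WW z e V = splice (max 0 (2 * z - 1)) (W1 e V) (W2 e V)" for z e V
  define h where "h = (\<lambda>(z, C). let (e, V) = select C in hocolim_class G P (EE z e V) (WW z e V))"
  have valid12: "valid (E1 e V) (W1 e V)" "valid (E2 e V) (W2 e V)" if "chart_fun e V" for e V
    by (rule operation_valid[OF 1 that], rule operation_valid[OF 2 that])
  have valid: "valid (EE z e V) (WW z e V)" if c: "chart_fun e V" and z: "z \<in> {0..1}" for z e V
  proof -
    note v = valid12[OF c]
    have P2: "W2 e V 0 \<in> P" using v by (auto simp: valid_def)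
    have c1: "E1 e V r \<in> carrier G" "E2 e V r \<in> carrier G" if "r \<in> {0..<1}" for r
      using v that by (auto simp: valid_def)
    have "inv (EE z e V 0) \<otimes> EE z e V r \<in> WW z e V 0" if r: "r \<in> {0..<1}" for r
    proof (cases "2 * z - 1 > 0")
      case True
      then show ?thesis using v(1) r by (auto simp: EE_def WW_def splice_def valid_def)
    next
      case False
      \<comment> \<open>Here \<open>WW\<close> is \<open>W2\<close> throughout. The values of
        \<open>E1\<close> lie in the coset of \<open>E1 e V 0\<close> because the first subgroup of
        \<open>W1\<close> is contained in that of \<open>W2\<close>; for \<open>E2\<close> this is
        the hypothesis.\<close>
      have i1: "inv (E1 e V 0) \<otimes> E1 e V r \<in> W2 e V 0" if "r \<in> {0..<1}" for r
        using W[OF c, of 0] v(1) that by (auto simp: valid_def)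
      have i: "inv (E1 e V 0) \<otimes> EE z e V r \<in> W2 e V 0" "EE z e V r \<in> carrier G" if "r \<in> {0..<1}" for r
        using i1[OF that] E[OF c that] c1[OF that] by (auto simp: EE_def splice_def)
      have "inv (EE z e V 0) \<otimes> EE z e V r \<in> W2 e V 0"
        using coset_trans[OF subgroups[OF P2] c1(1)[of 0] i(2)[of 0] i(2)[OF r] i(1)[of 0] i(1)[OF r]] by simp
      then show ?thesis using False by (simp add: WW_def splice_def)
    qed
    moreover have "EE z e V r \<in> carrier G" "WW z e V r \<in> P" if "r \<in> {0..<1}" for r
      using v that by (auto simp: EE_def WW_def splice_def valid_def)
    \<comment> \<open>The splice places the smaller chain \<open>W1\<close> before
      \<open>W2\<close>, so the result is still increasing.\<close>
    moreover have "WW z e V r \<subseteq> WW z e V r'" if "r \<in> {0..<1}" "r' \<in> {0..<1}" "r \<le> r'" for r r'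
    proof -
      have "W1 e V r \<subseteq> W1 e V r'" "W2 e V r \<subseteq> W2 e V r'" "W1 e V r \<subseteq> W2 e V r"
        using v that W[OF c that(1)] by (simp_all add: valid_def)
      then show ?thesis using that(3) by (auto simp: WW_def splice_def)
    qed
    ultimately show ?thesis unfolding valid_def by blast
  qed
  have nat: "EE z e' V' r = g \<otimes> EE z e V r \<and> WW z e' V' r = WW z e V r"
    if g: "g \<in> carrier G" "chart_fun e V" "chart_fun e' V'" "\<forall>r\<in>{0..<1}. e' r = g \<otimes> e r \<and> V' r = V r"
      and r: "r \<in> {0..<1}" for z g e V e' V' r
  proof -
    have "E1 e' V' r = g \<otimes> E1 e V r \<and> W1 e' V' r = W1 e V r" "E2 e' V' r = g \<otimes> E2 e V r \<and> W2 e' V' r = W2 e V r"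
      using operation_natural[OF 1 g] operation_natural[OF 2 g] r by blast+
    then show ?thesis by (auto simp: EE_def WW_def splice_def)
  qed
  have "continuous_map (prod_topology unit_interval (hocolim_classifying G P)) (hocolim_classifying G P) h"
  proof (rule continuous_map_from_hocolim[OF unit_interval_compact])
    fix n us m xs assume us: "us \<in> chains_in P n" and xs: "set xs \<subseteq> hd us" "length xs = m"
    have n: "n = length us - 1" using us by (simp add: chains_in_def)
    let ?S = "prod_topology (simplex_topology n) (simplex_topology m)"
    let ?T = "prod_topology (prod_topology unit_interval (simplex_topology n)) (simplex_topology m)"
    have \<pi>: "continuous_map ?T ?S (\<lambda>((z, s), t). (s, t))"
    proof -
      have "continuous_map ?T ?S (\<lambda>p. (snd (fst p), snd p))"
        by (intro continuous_map_pairedI continuous_map_snd continuous_map_compose[OF continuous_map_fst continuous_map_snd, unfolded o_def])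
      then show ?thesis by (simp add: case_prod_unfold)
    qed
    have zc: "continuous_map ?T euclideanreal (\<lambda>p. fst (fst p))"
    proof -
      have "continuous_map unit_interval euclideanreal (\<lambda>x. x)" unfolding unit_interval_def by (simp add: continuous_map_from_subtopology)
      from continuous_map_compose[OF continuous_map_compose[OF continuous_map_fst continuous_map_fst] this]
      show ?thesis by (simp add: o_def)
    qed
    have t12: "tamable ?S (\<lambda>(s, t). E1 (bar_fun G xs t) (chain_fun us s))"
      "tamable ?S (\<lambda>(s, t). E2 (bar_fun G xs t) (chain_fun us s))"
      "tamable ?S (\<lambda>(s, t). W1 (bar_fun G xs t) (chain_fun us s))"
      "tamable ?S (\<lambda>(s, t). W2 (bar_fun G xs t) (chain_fun us s))"
      using 1 2 us xs n unfolding operation_def chart_tamable_def by auto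
    have tE: "tamable ?T (\<lambda>((z, s), t). EE z (bar_fun G xs t) (chain_fun us s))"
    proof -
      have "continuous_map ?T euclideanreal (\<lambda>p. min 1 (2 * fst (fst p)))"
        by (intro continuous_map_real_min continuous_map_real_mult zc) auto
      from tamable_splice[OF tamable_pullback[OF t12(1) \<pi>] tamable_pullback[OF t12(2) \<pi>] this]
      show ?thesis by (simp add: EE_def case_prod_unfold)
    qed
    have tW: "tamable ?T (\<lambda>((z, s), t). WW z (bar_fun G xs t) (chain_fun us s))"
    proof -
      have "continuous_map ?T euclideanreal (\<lambda>p. max 0 (2 * fst (fst p) - 1))"
        by (intro continuous_map_real_max continuous_map_diff continuous_map_real_mult zc) auto
      from tamable_splice[OF tamable_pullback[OF t12(3) \<pi>] tamable_pullback[OF t12(4) \<pi>] this]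
      show ?thesis by (simp add: WW_def case_prod_unfold)
    qed
    have ch: "chart us xs s t" if "s \<in> standard_simplex n" "t \<in> standard_simplex m" for s t
      using that us xs n by (simp add: chart_def)
    have vT: "valid ((\<lambda>((z, s), t). EE z (bar_fun G xs t) (chain_fun us s)) p)
        ((\<lambda>((z, s), t). WW z (bar_fun G xs t) (chain_fun us s)) p)" if "p \<in> topspace ?T" for p
    proof -
      obtain z s t where "p = ((z, s), t)" by (metis prod.exhaust)
      then have "chart us xs s t" "z \<in> {0..1}" using that ch by (auto simp: unit_interval_def)
      from valid[OF chart_funI[OF this(1)] this(2)] show ?thesis using \<open>p = ((z, s), t)\<close> by simp
    qed
    show "continuous_map ?T (hocolim_classifying G P)
        (\<lambda>((z, s), t). h (z, hocolim_glue G P `` {(n, (us, bar_glue (G\<lparr>carrier := hd us\<rparr>) `` {(m, xs, t)}), s)}))"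
    proof (rule continuous_map_eq[OF continuous_map_hocolim_class(1)[OF tE tW vT]])
      fix p assume p: "p \<in> topspace ?T"
      obtain z s t where pp: "p = ((z, s), t)" by (metis prod.exhaust)
      then have c: "chart us xs s t" using p ch by auto
      obtain g e V where s: "select (hocolim_class G P (bar_fun G xs t) (chain_fun us s)) = (e, V)"
        "chart_fun e V" "g \<in> carrier G" "\<forall>r\<in>{0..<1}. e r = g \<otimes> bar_fun G xs t r \<and> V r = chain_fun us s r"
        by (rule select_chart[OF c])
      obtain q where q: "hocolim_rep G P (EE z (bar_fun G xs t) (chain_fun us s)) (WW z (bar_fun G xs t) (chain_fun us s)) q"
        using continuous_map_hocolim_class(2)[OF tE tW vT p] pp by auto
      have "hocolim_class G P (EE z e V) (WW z e V) =
          hocolim_class G P (EE z (bar_fun G xs t) (chain_fun us s)) (WW z (bar_fun G xs t) (chain_fun us s))"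
        by (rule hocolim_class_translate[OF q s(3)]) (intro ballI nat[OF s(3) chart_funI[OF c] s(2) s(4)])
      moreover have "hocolim_glue G P `` {(n, (us, bar_glue (G\<lparr>carrier := hd us\<rparr>) `` {(m, xs, t)}), s)} =
          hocolim_class G P (bar_fun G xs t) (chain_fun us s)"
        using hocolim_class_eq[OF chart_rep[OF c]] n xs by (simp add: chart_point_def)
      ultimately show "hocolim_class G P ((\<lambda>((z, s), t). EE z (bar_fun G xs t) (chain_fun us s)) p)
          ((\<lambda>((z, s), t). WW z (bar_fun G xs t) (chain_fun us s)) p) =
        (\<lambda>((z, s), t). h (z, hocolim_glue G P `` {(n, (us, bar_glue (G\<lparr>carrier := hd us\<rparr>) `` {(m, xs, t)}), s)})) p"
        using pp s(1) by (simp add: h_def)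
    qed
  qed
  moreover have "h (0, C) = op_map E2 W2 C" for C
    unfolding h_def op_map_def EE_def WW_def
    by (auto simp: Let_def splice_def split: prod.splits intro!: hocolim_class_cong)
  moreover have "h (1, C) = op_map E1 W1 C" for C
    unfolding h_def op_map_def EE_def WW_def
    by (auto simp: Let_def splice_def split: prod.splits intro!: hocolim_class_cong)
  ultimately show ?thesis unfolding homotopic_with_def unit_interval_def by auto
qed

end

section \<open>Weights of group elements\<close>

definition scale :: "nat \<Rightarrow> real" where
  "scale i = (1/4) ^ i"

lemma scale_pos: "0 < scale i"
  by (simp add: scale_def)

lemma scale_Suc: "scale (Suc i) = scale i / 4"
  by (simp add: scale_def)

lemma scale_antimono: "i \<le> j \<Longrightarrow> scale j \<le> scale i"
  unfolding scale_def by (rule power_decreasing) auto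

lemma scale_le_1: "scale i \<le> 1"
  using scale_antimono[of 0 i] by (simp add: scale_def)

definition mass :: "(real \<Rightarrow> 'g) \<Rightarrow> nat \<Rightarrow> 'g \<Rightarrow> real" where
  "mass e i g = measure lborel {r \<in> {0..<scale i}. e r = g}"

text \<open>Positive exactly when \<open>g\<close> fills more than half of the window, so positive
  excess occurs for at most one element per index.\<close>

definition excess :: "(real \<Rightarrow> 'g) \<Rightarrow> nat \<Rightarrow> 'g \<Rightarrow> real" where
  "excess e i g = 2 * mass e i g - scale i"

text \<open>The labels whose excess lies above the fraction \<open>(2 + r) / 4\<close> of every
  excess. The fraction runs from 1/2 to 3/4 for \<open>r\<close> in [0, 1) and from 3/4 to 1 for
  \<open>r\<close> in [1, 2). Without an explicit maximum the definition makes sense for any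
  function and is visibly equivariant.\<close>

definition active :: "('g, 'm) monoid_scheme \<Rightarrow> (real \<Rightarrow> 'g) \<Rightarrow> real \<Rightarrow> (nat \<times> 'g) set" where
  "active G e r = {(i, g). g \<in> carrier G \<and> (\<forall>j. \<forall>h\<in>carrier G. (2 + r) / 4 * excess e j h < excess e i g)}"

text \<open>A maximum over finitely many candidates, hence continuous in \<open>t\<close>;
  \<open>excess_le_peak\<close> shows that it bounds every excess.\<close>

definition peak :: "('g, 'm) monoid_scheme \<Rightarrow> 'g list \<Rightarrow> (nat \<Rightarrow> real) \<Rightarrow> real" where
  "peak G xs t = Max ((\<lambda>(i, k). excess (bar_fun G xs t) i (gval G xs k)) ` ({..length xs} \<times> {..length xs}))"

lemma idx_eq_iff:
  assumes "t \<in> standard_simplex n" "0 \<le> r" "r < 1"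
  shows "idx t r = k \<longleftrightarrow> cut t k \<le> r \<and> r < cut t (Suc k)"
  using idx_bounds[OF assms] idx_eqI[of t k r] assms(1) by (auto simp: standard_simplex_iff_cut)

lemma cut_nonneg: "t \<in> standard_simplex n \<Longrightarrow> 0 \<le> cut t k"
  using cut_mono[of t 0 k] by (simp add: standard_simplex_iff_cut)

lemma cut_Suc_mono: "t \<in> standard_simplex n \<Longrightarrow> cut t k \<le> cut t (Suc k)"
  using cut_mono[of t k "Suc k"] by (simp add: standard_simplex_iff_cut)

text \<open>Expresses the measure by clipped interval lengths, from which continuity in
  \<open>t\<close> is evident.\<close>

lemma mass_bar_fun:
  assumes t: "t \<in> standard_simplex (length xs)"
  shows "mass (bar_fun G xs t) i g = (\<Sum>k\<le>length xs. if gval G xs k = g then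
     min (cut t (Suc k)) (scale i) - min (cut t k) (scale i) else 0)"
proof -
  define \<epsilon> :: real where "\<epsilon> = scale i"
  define I where "I = {k. k \<le> length xs \<and> gval G xs k = g}"
  define A where "A k = {min (cut t k) \<epsilon> ..< min (cut t (Suc k)) \<epsilon>}" for k
  have e: "\<epsilon> \<le> 1" "0 < \<epsilon>" using scale_le_1 scale_pos by (auto simp: \<epsilon>_def)
  have set: "{r \<in> {0..<\<epsilon>}. bar_fun G xs t r = g} = (\<Union>k\<in>I. A k)"
  proof (intro equalityI subsetI)
    fix r assume r: "r \<in> {r \<in> {0..<\<epsilon>}. bar_fun G xs t r = g}"
    then have b: "idx t r \<le> length xs" "cut t (idx t r) \<le> r" "r < cut t (Suc (idx t r))"
      using idx_bounds[OF t, of r] e by auto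
    then have "r \<in> A (idx t r)" using r by (auto simp: A_def)
    moreover have "idx t r \<in> I" using b(1) r by (auto simp: I_def bar_fun_def)
    ultimately show "r \<in> (\<Union>k\<in>I. A k)" by blast
  next
    fix r assume "r \<in> (\<Union>k\<in>I. A k)"
    then obtain k where k: "k \<in> I" "r \<in> A k" by blast
    then have r: "cut t k \<le> r" "r < cut t (Suc k)" "r < \<epsilon>" by (auto simp: A_def)
    then have "0 \<le> r" using cut_nonneg[OF t, of k] by linarith
    then show "r \<in> {r \<in> {0..<\<epsilon>}. bar_fun G xs t r = g}"
      using r k(1) e idx_eq_iff[OF t, of r k] by (auto simp: I_def bar_fun_def)
  qed
  have disj: "disjoint_family_on A I"
    unfolding disjoint_family_on_def
  proof (intro ballI impI)
    fix j k assume jk: "j \<in> I" "k \<in> I" "j \<noteq> k"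
    show "A j \<inter> A k = {}"
    proof (rule ccontr)
      assume "A j \<inter> A k \<noteq> {}"
      then obtain r where r: "r \<in> A j" "r \<in> A k" by blast
      then have "0 \<le> r" "r < 1" using cut_nonneg[OF t, of k] e by (auto simp: A_def)
      then show False using r jk(3) idx_eq_iff[OF t, of r j] idx_eq_iff[OF t, of r k] by (auto simp: A_def)
    qed
  qed
  have le: "min (cut t k) \<epsilon> \<le> min (cut t (Suc k)) \<epsilon>" for k
    using cut_Suc_mono[OF t, of k] by (auto simp: min_def)
  have "measure lborel (\<Union>k\<in>I. A k) = (\<Sum>k\<in>I. measure lborel (A k))"
  proof (rule measure_finite_Union)
    show "finite I" by (simp add: I_def)
    show "A ` I \<subseteq> sets lborel" by (auto simp: A_def)
    show "emeasure lborel (A k) \<noteq> \<infinity>" for k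
      using le[of k] by (simp add: A_def)
  qed (rule disj)
  also have "\<dots> = (\<Sum>k\<in>I. min (cut t (Suc k)) \<epsilon> - min (cut t k) \<epsilon>)"
    by (intro sum.cong refl) (simp only: A_def measure_lborel_Ico[OF le])
  also have "\<dots> = (\<Sum>k\<le>length xs. if gval G xs k = g then min (cut t (Suc k)) \<epsilon> - min (cut t k) \<epsilon> else 0)"
    by (subst sum.inter_filter[symmetric]) (auto simp: I_def intro!: sum.cong)
  finally show ?thesis unfolding mass_def set[unfolded \<epsilon>_def] \<epsilon>_def .
qed

lemma sum_clipped_lengths:
  assumes t: "t \<in> standard_simplex n" and \<epsilon>: "0 \<le> \<epsilon>" "\<epsilon> \<le> 1"
  shows "(\<Sum>k\<le>n. min (cut t (Suc k)) \<epsilon> - min (cut t k) \<epsilon>) = \<epsilon>"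
proof -
  have "(\<Sum>k<Suc n. min (cut t (Suc k)) \<epsilon> - min (cut t k) \<epsilon>) = min (cut t (Suc n)) \<epsilon> - min (cut t 0) \<epsilon>"
    by (rule sum_lessThan_telescope)
  also have "cut t (Suc n) = 1" using t by (simp add: standard_simplex_iff_cut)
  finally show ?thesis using \<epsilon> by (simp add: lessThan_Suc_atMost)
qed

lemma sum_mass_le:
  assumes t: "t \<in> standard_simplex (length xs)"
  shows "(\<Sum>k\<le>length xs. min (cut t (Suc k)) (scale i) - min (cut t k) (scale i)) = scale i"
  by (rule sum_clipped_lengths[OF t less_imp_le[OF scale_pos] scale_le_1])

lemma mass_add_le:
  assumes t: "t \<in> standard_simplex (length xs)" and "g \<noteq> h"
  shows "mass (bar_fun G xs t) i g + mass (bar_fun G xs t) i h \<le> scale i"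
proof -
  have le: "min (cut t k) \<epsilon> \<le> min (cut t (Suc k)) \<epsilon>" for k \<epsilon>
    using cut_Suc_mono[OF t, of k] by (auto simp: min_def)
  have "mass (bar_fun G xs t) i g + mass (bar_fun G xs t) i h \<le>
    (\<Sum>k\<le>length xs. min (cut t (Suc k)) (scale i) - min (cut t k) (scale i))"
    unfolding mass_bar_fun[OF t] sum.distrib[symmetric]
    by (intro sum_mono) (use assms(2) le in auto)
  then show ?thesis by (simp only: sum_mass_le[OF t])
qed

lemma mass_le:
  assumes t: "t \<in> standard_simplex (length xs)"
  shows "mass (bar_fun G xs t) i g \<le> scale i"
proof -
  have le: "min (cut t k) \<epsilon> \<le> min (cut t (Suc k)) \<epsilon>" for k \<epsilon>
    using cut_Suc_mono[OF t, of k] by (auto simp: min_def)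
  have "mass (bar_fun G xs t) i g \<le>
    (\<Sum>k\<le>length xs. min (cut t (Suc k)) (scale i) - min (cut t k) (scale i))"
    unfolding mass_bar_fun[OF t] by (intro sum_mono) (use le in auto)
  then show ?thesis by (simp only: sum_mass_le[OF t])
qed

lemma excess_le: "t \<in> standard_simplex (length xs) \<Longrightarrow> excess (bar_fun G xs t) i g \<le> scale i"
  using mass_le[of t xs G i g] by (simp add: excess_def)

lemma excess_not_value:
  assumes t: "t \<in> standard_simplex (length xs)" and "\<And>k. k \<le> length xs \<Longrightarrow> gval G xs k \<noteq> g"
  shows "excess (bar_fun G xs t) i g < 0"
  unfolding excess_def mass_bar_fun[OF t] using assms(2) scale_pos[of i] by simp

text \<open>One of the \<open>m + 1\<close> intervals \<open>[4\<^sup>-\<^sup>i\<^sup>-\<^sup>1, 4\<^sup>-\<^sup>i)\<close> with \<open>i \<le> m\<close> contains no cut point of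
  an \<open>m\<close>-simplex, so the step function is constant on it.\<close>

lemma peak_lower_aux:
  assumes t: "t \<in> standard_simplex m"
  shows "\<exists>i\<le>m. \<exists>k\<le>m. cut t k \<le> scale (Suc i) \<and> scale i \<le> cut t (Suc k)"
proof -
  define B :: "nat \<Rightarrow> real set" where "B i = {scale (Suc i) ..< scale i}" for i
  have "\<exists>i\<le>m. \<forall>k\<in>{1..m}. cut t k \<notin> B i"
  proof (rule ccontr)
    assume "\<not> ?thesis"
    then have "\<forall>i\<in>{..m}. \<exists>k. k \<in> {1..m} \<and> cut t k \<in> B i" unfolding atMost_iff by blast
    then obtain F where F: "\<And>i. i \<le> m \<Longrightarrow> F i \<in> {1..m} \<and> cut t (F i) \<in> B i" by (metis atMost_iff)
    have disj: "B i \<inter> B j = {}" if "i < j" for i j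
    proof -
      have "scale j \<le> scale (Suc i)" using that by (intro scale_antimono) auto
      then show ?thesis by (auto simp: B_def)
    qed
    have "inj_on F {..m}"
    proof (rule inj_onI)
      fix i j assume ij: "i \<in> {..m}" "j \<in> {..m}" "F i = F j"
      have "cut t (F i) \<in> B i" "cut t (F j) \<in> B j" using F[of i] F[of j] ij(1,2) by blast+
      then have "cut t (F i) \<in> B i \<inter> B j" "cut t (F i) \<in> B j \<inter> B i" unfolding ij(3) by blast+
      then show "i = j" using disj[of i j] disj[of j i] by (cases i j rule: linorder_cases) blast+
    qed
    then have "card {..m} \<le> card {1..m}" by (rule card_inj_on_le) (use F in blast, simp)
    then show False by simp
  qed
  then obtain i where i: "i \<le> m" "\<forall>k\<in>{1..m}. cut t k \<notin> B i" by blast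
  define r :: real where "r = scale (Suc i)"
  have r: "0 \<le> r" "r < 1" using scale_le_1[of i] scale_pos[of i] unfolding r_def scale_Suc by auto
  define k where "k = idx t r"
  have k: "cut t k \<le> r" "r < cut t (Suc k)" "k \<le> m" using idx_bounds[OF t r] by (auto simp: k_def)
  have "scale i \<le> cut t (Suc k)"
  proof (cases "k = m")
    case True
    then show ?thesis using t scale_le_1[of i] by (simp add: standard_simplex_iff_cut)
  next
    case False
    then have "cut t (Suc k) \<notin> B i" using i(2) k(3) by auto
    then show ?thesis using k(2) by (auto simp: B_def r_def)
  qed
  then show ?thesis using i(1) k unfolding r_def by blast
qed

text \<open>The value on a window \<open>[4^-(i+1), 4^-i)\<close> free of cut points fills at least
  3/4 of \<open>[0, 4^-i)\<close>, and twice 3/4 minus 1 is 1/2.\<close>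

lemma peak_lower:
  assumes t: "t \<in> standard_simplex (length xs)"
  shows "scale (length xs) / 2 \<le> peak G xs t"
proof -
  obtain i k where ik: "i \<le> length xs" "k \<le> length xs" "cut t k \<le> scale (Suc i)" "scale i \<le> cut t (Suc k)"
    using peak_lower_aux[OF t] by blast
  have "3/4 * scale i \<le> min (cut t (Suc k)) (scale i) - min (cut t k) (scale i)"
  proof -
    have "min (cut t (Suc k)) (scale i) = scale i" using ik(4) by (rule min_absorb2)
    moreover have "min (cut t k) (scale i) \<le> 1/4 * scale i" using ik(3) by (simp add: min.coboundedI1 scale_Suc)
    ultimately show ?thesis by linarith
  qed
  also have "\<dots> = (\<Sum>j\<le>length xs. if j = k then min (cut t (Suc k)) (scale i) - min (cut t k) (scale i) else 0)"
    using ik(2) by simp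
  also have "\<dots> \<le> mass (bar_fun G xs t) i (gval G xs k)"
    unfolding mass_bar_fun[OF t]
  proof (intro sum_mono)
    fix j
    have "min (cut t j) (scale i) \<le> min (cut t (Suc j)) (scale i)"
      using cut_Suc_mono[OF t, of j] by (auto simp: min_def)
    then show "(if j = k then min (cut t (Suc k)) (scale i) - min (cut t k) (scale i) else 0) \<le>
      (if gval G xs j = gval G xs k then min (cut t (Suc j)) (scale i) - min (cut t j) (scale i) else 0)"
      by auto
  qed
  finally have "scale i / 2 \<le> excess (bar_fun G xs t) i (gval G xs k)" by (simp add: excess_def)
  moreover have "scale (length xs) \<le> scale i" using ik(1) by (intro scale_antimono) auto
  moreover have "excess (bar_fun G xs t) i (gval G xs k) \<le> peak G xs t"
    unfolding peak_def using ik(1,2) by (intro Max_ge) force+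
  ultimately show ?thesis by linarith
qed

lemma peak_pos: "t \<in> standard_simplex (length xs) \<Longrightarrow> 0 < peak G xs t"
  using peak_lower[of t xs G] scale_pos[of "length xs"] by linarith

text \<open>For an index beyond \<open>length xs\<close> the whole window has length at most
  \<open>scale (length xs) / 4\<close>, which is less than the bound of \<open>peak_lower\<close>;
  an element that is not a value has negative excess.\<close>

lemma excess_le_peak:
  assumes t: "t \<in> standard_simplex (length xs)"
  shows "excess (bar_fun G xs t) i g \<le> peak G xs t"
proof (cases "i \<le> length xs \<and> (\<exists>k\<le>length xs. g = gval G xs k)")
  case True
  then show ?thesis unfolding peak_def by (intro Max_ge) force+
next
  case False
  then consider "length xs < i" | "\<forall>k\<le>length xs. gval G xs k \<noteq> g" by auto
  then show ?thesis
  proof cases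
    case 1
    then have "scale i \<le> scale (Suc (length xs))" by (intro scale_antimono) auto
    then show ?thesis using excess_le[OF t, of G i g] peak_lower[OF t, of G] scale_pos[of "length xs"]
      unfolding scale_Suc by linarith
  next
    case 2
    then show ?thesis using excess_not_value[OF t, of G g i] peak_pos[OF t, of G] by force
  qed
qed

lemma peak_attained:
  obtains i k where "i \<le> length xs" "k \<le> length xs" "peak G xs t = excess (bar_fun G xs t) i (gval G xs k)"
proof -
  have "peak G xs t \<in> (\<lambda>(i, k). excess (bar_fun G xs t) i (gval G xs k)) ` ({..length xs} \<times> {..length xs})"
    unfolding peak_def by (intro Max_in) auto
  then show thesis using that by auto
qed

lemma continuous_map_Max:
  fixes f :: "'i \<Rightarrow> 'a \<Rightarrow> real"
  assumes "finite I" "I \<noteq> {}" "\<And>i. i \<in> I \<Longrightarrow> continuous_map T euclideanreal (f i)"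
  shows "continuous_map T euclideanreal (\<lambda>x. Max ((\<lambda>i. f i x) ` I))"
  using assms
proof (induction I rule: finite_ne_induct)
  case (insert i I)
  then have "continuous_map T euclideanreal (\<lambda>x. max (f i x) (Max ((\<lambda>i. f i x) ` I)))"
    by (intro continuous_map_real_max) auto
  then show ?case using insert.hyps by simp
qed simp

lemma continuous_map_excess:
  "continuous_map (simplex_topology (length xs)) euclideanreal (\<lambda>t. excess (bar_fun G xs t) i g)"
proof -
  have "continuous_map (simplex_topology (length xs)) euclideanreal
    (\<lambda>t. (if gval G xs k = g then min (cut t (Suc k)) (scale i) - min (cut t k) (scale i) else 0))" for k
    by (cases "gval G xs k = g") (auto intro!: continuous_map_diff continuous_map_real_min continuous_map_cut)
  then have "continuous_map (simplex_topology (length xs)) euclideanreal (\<lambda>t. 2 * (\<Sum>k\<le>length xs.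
    (if gval G xs k = g then min (cut t (Suc k)) (scale i) - min (cut t k) (scale i) else 0)) - scale i)"
    by (intro continuous_map_diff continuous_map_real_mult continuous_map_sum) auto
  then show ?thesis
    by (rule continuous_map_eq) (simp add: excess_def mass_bar_fun)
qed

lemma continuous_map_peak:
  "continuous_map (simplex_topology (length xs)) euclideanreal (\<lambda>t. peak G xs t)"
  unfolding peak_def case_prod_unfold by (rule continuous_map_Max) (auto intro: continuous_map_excess)

section \<open>The active labels of a step function\<close>

context group begin

text \<open>Solves the threshold inequality for \<open>r\<close>: each label stays active until
  \<open>r\<close> reaches an explicit number that is continuous in \<open>t\<close>. These numbers
  become the cut functions of the family.\<close>

lemma active_bar_fun:
  assumes xs: "set xs \<subseteq> carrier G" and t: "t \<in> standard_simplex (length xs)" and r: "0 \<le> r" "r < 2"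
  shows "active G (bar_fun G xs t) r = (\<lambda>(i, k). (i, gval G xs k)) `
    {(i, k) \<in> {..length xs} \<times> {..length xs}. r < 4 * excess (bar_fun G xs t) i (gval G xs k) / peak G xs t - 2}"
    (is "_ = ?R")
proof -
  define M where "M = peak G xs t"
  have M: "0 < M" "scale (length xs) / 2 \<le> M" using peak_pos[OF t] peak_lower[OF t] by (auto simp: M_def)
  have iff: "r < 4 * E / M - 2 \<longleftrightarrow> (2 + r) / 4 * M < E" for E
    using M(1) by (simp add: field_simps)
  show ?thesis
  proof (intro equalityI subsetI)
    fix p assume "p \<in> active G (bar_fun G xs t) r"
    then obtain i g where p: "p = (i, g)" "g \<in> carrier G"
      "\<And>j h. h \<in> carrier G \<Longrightarrow> (2 + r) / 4 * excess (bar_fun G xs t) j h < excess (bar_fun G xs t) i g"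
      by (auto simp: active_def)
    obtain j k where "peak G xs t = excess (bar_fun G xs t) j (gval G xs k)" using peak_attained by blast
    then have E: "(2 + r) / 4 * M < excess (bar_fun G xs t) i g" using p(3)[of "gval G xs k" j] xs by (simp add: M_def)
    \<comment> \<open>The threshold is at least half of the peak, hence at least
      \<open>scale (length xs) / 4\<close>. This equals \<open>scale (Suc (length xs))\<close> and
      excludes all larger indices.\<close>
    have "1/2 * M \<le> (2 + r) / 4 * M" using r M by (intro mult_right_mono) auto
    then have E2: "1/2 * M < excess (bar_fun G xs t) i g" using E by linarith
    have i: "i \<le> length xs"
    proof (rule ccontr)
      assume "\<not> ?thesis"
      then have "scale i \<le> scale (Suc (length xs))" by (intro scale_antimono) auto
      then show False using excess_le[OF t, of G i g] E2 M unfolding scale_Suc by linarith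
    qed
    obtain k where k: "k \<le> length xs" "g = gval G xs k"
      using excess_not_value[OF t, of G g i] E2 M by force
    show "p \<in> ?R" using i k p(1) E iff[of "excess (bar_fun G xs t) i g"] by (auto simp: M_def intro!: image_eqI[of _ _ "(i, k)"])
  next
    fix p assume "p \<in> ?R"
    then obtain i k where p: "p = (i, gval G xs k)" "(2 + r) / 4 * M < excess (bar_fun G xs t) i (gval G xs k)"
      using iff by (auto simp: M_def)
    have "(2 + r) / 4 * excess (bar_fun G xs t) j h \<le> (2 + r) / 4 * M" for j h
      using excess_le_peak[OF t, of G j h] r by (intro mult_left_mono) (auto simp: M_def)
    then show "p \<in> active G (bar_fun G xs t) r" using p xs unfolding active_def by (auto intro: le_less_trans)
  qed
qed

lemma active_values:
  assumes xs: "set xs \<subseteq> carrier G" and t: "t \<in> standard_simplex (length xs)" and r: "0 \<le> r" "r < 2"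
    and "(i, g) \<in> active G (bar_fun G xs t) r"
  shows "\<exists>k\<le>length xs. g = gval G xs k"
  using assms(5) unfolding active_bar_fun[OF xs t r] by auto

lemma active_finite_nonempty:
  assumes xs: "set xs \<subseteq> carrier G" and t: "t \<in> standard_simplex (length xs)" and r: "0 \<le> r" "r < 2"
  shows "finite (active G (bar_fun G xs t) r)" "active G (bar_fun G xs t) r \<noteq> {}"
proof -
  let ?I = "{(i, k) \<in> {..length xs} \<times> {..length xs}.
    r < 4 * excess (bar_fun G xs t) i (gval G xs k) / peak G xs t - 2}"
  have "finite ?I" by (rule finite_subset[of _ "{..length xs} \<times> {..length xs}"]) auto
  then show "finite (active G (bar_fun G xs t) r)" unfolding active_bar_fun[OF assms] by (rule finite_imageI)
  obtain i k where ik: "i \<le> length xs" "k \<le> length xs" "peak G xs t = excess (bar_fun G xs t) i (gval G xs k)"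
    by (rule peak_attained)
  \<comment> \<open>A label that attains the peak has drop-out value 4 - 2 = 2, so it is active for
    every \<open>r\<close> below 2.\<close>
  have "(i, k) \<in> ?I" using ik(1,2) ik(3)[symmetric] peak_pos[OF t, of G] r by simp
  then show "active G (bar_fun G xs t) r \<noteq> {}" unfolding active_bar_fun[OF assms] by blast
qed

lemma active_antimono:
  assumes xs: "set xs \<subseteq> carrier G" and t: "t \<in> standard_simplex (length xs)" and r: "0 \<le> r" "r \<le> r'" "r' < 2"
  shows "active G (bar_fun G xs t) r' \<subseteq> active G (bar_fun G xs t) r"
proof -
  have "active G (bar_fun G xs t) r' = (\<lambda>(i, k). (i, gval G xs k)) ` {(i, k) \<in> {..length xs} \<times> {..length xs}.
    r' < 4 * excess (bar_fun G xs t) i (gval G xs k) / peak G xs t - 2}"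
    using r by (intro active_bar_fun xs t) auto
  moreover have "active G (bar_fun G xs t) r = (\<lambda>(i, k). (i, gval G xs k)) ` {(i, k) \<in> {..length xs} \<times> {..length xs}.
    r < 4 * excess (bar_fun G xs t) i (gval G xs k) / peak G xs t - 2}"
    using r by (intro active_bar_fun xs t) auto
  ultimately show ?thesis using r(2) by (simp only:) (intro image_mono, auto)
qed

text \<open>Active labels have positive excess, and two different elements cannot both fill more
  than half of one window.\<close>

lemma active_unique:
  assumes xs: "set xs \<subseteq> carrier G" and t: "t \<in> standard_simplex (length xs)" and r: "0 \<le> r" "r < 2"
    and "(i, g) \<in> active G (bar_fun G xs t) r" "(i, h) \<in> active G (bar_fun G xs t) r"
  shows "h = g"
proof (rule ccontr)
  assume "h \<noteq> g"
  have pos: "0 < excess (bar_fun G xs t) i g" if "(i, g) \<in> active G (bar_fun G xs t) r" for g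
  proof -
    obtain j k where "peak G xs t = excess (bar_fun G xs t) j (gval G xs k)" using peak_attained by blast
    then have "(2 + r) / 4 * peak G xs t < excess (bar_fun G xs t) i g"
      using that xs by (auto simp: active_def)
    moreover have "0 < (2 + r) / 4 * peak G xs t" using r peak_pos[OF t] by (intro mult_pos_pos) auto
    ultimately show ?thesis by linarith
  qed
  then show False
    using pos[OF assms(5)] pos[OF assms(6)] mass_add_le[OF t, of h g G i] \<open>h \<noteq> g\<close> by (simp add: excess_def)
qed

text \<open>The cut functions are the drop-out values of the labels shifted by \<open>b\<close>. The
  cases \<open>b = 0\<close> and \<open>b = 1\<close> are the two halves of the threshold range, for
  elements and for subgroups.\<close>

lemma tamable_active:
  assumes xs: "set xs \<subseteq> carrier G" and b: "0 \<le> b" "b \<le> 1"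
  shows "tamable (simplex_topology (length xs)) (\<lambda>t r. active G (bar_fun G xs t) (b + r))"
proof -
  define I where "I = {..length xs} \<times> {..length xs}"
  define f where "f p t = 4 * excess (bar_fun G xs t) (fst p) (gval G xs (snd p)) / peak G xs t - 2 - b" for p t
  have "tamable (simplex_topology (length xs)) (\<lambda>t r. {p \<in> I. f p t \<le> r})"
  proof (rule tamable_positions_indexed)
    show "finite I" by (simp add: I_def)
    fix p
    have "peak G xs t \<noteq> 0" if "t \<in> topspace (simplex_topology (length xs))" for t
      using peak_pos[of t xs G] that by simp
    then show "continuous_map (simplex_topology (length xs)) euclideanreal (f p)"
      unfolding f_def
      by (intro continuous_map_diff continuous_map_real_divide continuous_map_real_mult continuous_map_excess
          continuous_map_peak) auto
  qed
  from tamable_comp[OF this, of "\<lambda>A. (\<lambda>(i, k). (i, gval G xs k)) ` (I - A)"] show ?thesis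
  proof (rule tamable_cong)
    fix t r assume a: "t \<in> topspace (simplex_topology (length xs))" "r \<in> {0..<1::real}"
    have "I - {p \<in> I. f p t \<le> r} = {(i, k) \<in> {..length xs} \<times> {..length xs}.
      b + r < 4 * excess (bar_fun G xs t) i (gval G xs k) / peak G xs t - 2}"
      unfolding I_def f_def by auto
    then show "active G (bar_fun G xs t) (b + r) = (\<lambda>(i, k). (i, gval G xs k)) ` (I - {p \<in> I. f p t \<le> r})"
      using active_bar_fun[OF xs, of t "b + r"] a b by simp
  qed
qed

text \<open>The weight of an element depends only on where it is taken as a value, so translation
  moves the elements and keeps their weights.\<close>

lemma active_translate:
  assumes g: "g \<in> carrier G" and e: "\<forall>r\<in>{0..<1}. e r \<in> carrier G \<and> e' r = g \<otimes> e r"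
  shows "active G e' r = (\<lambda>(i, h). (i, g \<otimes> h)) ` active G e r"
proof -
  have ex: "excess e' i (g \<otimes> h) = excess e i h" if h: "h \<in> carrier G" for i h
  proof -
    have "{r \<in> {0..<scale i}. e' r = g \<otimes> h} = {r \<in> {0..<scale i}. e r = h}"
      using e g h scale_le_1[of i] by (auto simp: subset_iff)
    then show ?thesis by (simp add: excess_def mass_def)
  qed
  have all: "(\<forall>h\<in>carrier G. Q h) \<longleftrightarrow> (\<forall>h\<in>carrier G. Q (g \<otimes> h))" for Q
  proof
    assume a: "\<forall>h\<in>carrier G. Q (g \<otimes> h)"
    show "\<forall>h\<in>carrier G. Q h"
    proof
      fix h assume "h \<in> carrier G"
      then show "Q h" using a[rule_format, of "inv g \<otimes> h"] g by (simp add: m_assoc[symmetric])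
    qed
  qed (use g in auto)
  have act: "(i, g \<otimes> h) \<in> active G e' r \<longleftrightarrow> (i, h) \<in> active G e r" if "h \<in> carrier G" for i h
  proof -
    have "(\<forall>h'\<in>carrier G. (2 + r) / 4 * excess e' j h' < excess e' i (g \<otimes> h)) \<longleftrightarrow>
       (\<forall>h'\<in>carrier G. (2 + r) / 4 * excess e j h' < excess e i h)" for j
      by (subst all) (simp add: ex that)
    then show ?thesis using g that unfolding active_def by simp
  qed
  show ?thesis
  proof (intro equalityI subsetI)
    fix p assume p: "p \<in> active G e' r"
    obtain i h where ih: "p = (i, h)" by (cases p)
    then have h: "h \<in> carrier G" using p by (auto simp: active_def)
    then have "h = g \<otimes> (inv g \<otimes> h)" "inv g \<otimes> h \<in> carrier G" using g by (simp_all add: m_assoc[symmetric])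
    then show "p \<in> (\<lambda>(i, h). (i, g \<otimes> h)) ` active G e r"
      using act[of "inv g \<otimes> h" i] p ih by (metis (no_types, lifting) case_prod_conv image_eqI)
  next
    fix p assume "p \<in> (\<lambda>(i, h). (i, g \<otimes> h)) ` active G e r"
    then obtain i h where ih: "p = (i, g \<otimes> h)" "(i, h) \<in> active G e r" by auto
    then have "h \<in> carrier G" by (auto simp: active_def)
    then show "p \<in> active G e' r" using act[of h i] ih by simp
  qed
qed

end

section \<open>Independent families of subgroups\<close>

definition label :: "(nat \<times> 'g) set \<Rightarrow> 'g" where
  "label A = (SOME g. ((LEAST i. i \<in> fst ` A), g) \<in> A)"

lemma label_mem: "A \<noteq> {} \<Longrightarrow> ((LEAST i. i \<in> fst ` A), label A) \<in> A"
proof -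
  assume "A \<noteq> {}"
  then obtain p where "p \<in> A" by blast
  then have "fst p \<in> fst ` A" by blast
  then have "(LEAST i. i \<in> fst ` A) \<in> fst ` A" by (rule LeastI)
  then have "\<exists>g. ((LEAST i. i \<in> fst ` A), g) \<in> A" by force
  then show ?thesis unfolding label_def by (rule someI_ex)
qed

text \<open>Lets single maps be treated by the continuity criteria that carry a parameter
  space.\<close>

lemma continuous_map_slice:
  assumes "continuous_map (prod_topology unit_interval X) Y (\<lambda>(z, x). f x)"
  shows "continuous_map X Y f"
proof -
  have "continuous_map X (prod_topology unit_interval X) (\<lambda>x. (0, x))"
    by (intro continuous_map_pairedI) (auto simp: unit_interval_def)
  from continuous_map_compose[OF this assms] show ?thesis by (simp add: o_def)
qed

locale independent_family = group G for G (structure) +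
  fixes H :: "nat \<Rightarrow> 'a set"
  assumes subgroup_H: "subgroup (H i) G"
    and independent: "\<lbrakk>finite F; \<And>i. i \<in> F \<Longrightarrow> g i \<in> carrier G\<rbrakk> \<Longrightarrow>
      \<exists>y\<in>carrier G. \<forall>i\<in>F. inv (g i) \<otimes> y \<in> H i"
begin

definition common :: "nat set \<Rightarrow> 'a set" where
  "common F = {x \<in> carrier G. \<forall>i\<in>F. x \<in> H i}"

text \<open>The empty index set is excluded because it would contribute the whole group. Finite
  intersections, and not just the single \<open>H i\<close>, are present so that chains can grow
  when labels drop out.\<close>

definition meets :: "'a set set" where
  "meets = {common F | F. finite F \<and> F \<noteq> {}}"

lemma subgroup_common: "subgroup (common F) G"
proof
  show "\<one> \<in> common F" using subgroup.one_closed[OF subgroup_H] by (simp add: common_def)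
  show "x \<otimes> y \<in> common F" if "x \<in> common F" "y \<in> common F" for x y
    using that subgroup.m_closed[OF subgroup_H] by (simp add: common_def)
  show "inv x \<in> common F" if "x \<in> common F" for x
    using that subgroup.m_inv_closed[OF subgroup_H] by (simp add: common_def)
qed (auto simp: common_def)

sublocale subgroup_family G meets
  by (intro subgroup_family.intro is_group subgroup_family_axioms.intro)
    (auto simp: meets_def intro: subgroup_common)

lemma common_Un: "common (F \<union> F') = common F \<inter> common F'"
  by (auto simp: common_def)

lemma meets_Int: "U \<in> meets \<Longrightarrow> W \<in> meets \<Longrightarrow> U \<inter> W \<in> meets"
  unfolding meets_def using common_Un by (smt (verit) Un_empty finite_UnI mem_Collect_eq)

definition labelled :: "(nat \<times> 'a) set \<Rightarrow> bool" where
  "labelled A \<longleftrightarrow> A \<noteq> {} \<and> finite A \<and> (\<forall>(i, h)\<in>A. h \<in> carrier G) \<and> (\<forall>i g h. (i, g) \<in> A \<longrightarrow> (i, h) \<in> A \<longrightarrow> h = g)"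

definition fits :: "(nat \<times> 'a) set \<Rightarrow> 'a \<Rightarrow> bool" where
  "fits A y \<longleftrightarrow> (\<forall>(i, h)\<in>A. inv h \<otimes> y \<in> H i)"

text \<open>Choosing \<open>x\<close> relative to the label of the least index makes \<open>pick\<close> equivariant.\<close>

definition pick :: "'a set \<Rightarrow> (nat \<times> 'a) set \<Rightarrow> 'a" where
  "pick C A = label A \<otimes> (SOME x. x \<in> carrier G \<and> label A \<otimes> x \<in> C \<and> fits A (label A \<otimes> x))"

lemma label_closed: "labelled A \<Longrightarrow> label A \<in> carrier G"
  using label_mem[of A] unfolding labelled_def by auto

lemma pick_spec:
  assumes A: "labelled A" and y: "y \<in> carrier G" "y \<in> C" "fits A y"
  shows "\<exists>x\<in>carrier G. pick C A = label A \<otimes> x \<and> label A \<otimes> x \<in> C \<and> fits A (label A \<otimes> x)"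
proof -
  note b = label_closed[OF A]
  have "label A \<otimes> (inv (label A) \<otimes> y) = y" using b y by (simp add: m_assoc[symmetric])
  then have "\<exists>x. x \<in> carrier G \<and> label A \<otimes> x \<in> C \<and> fits A (label A \<otimes> x)"
    using b y by (intro exI[of _ "inv (label A) \<otimes> y"]) simp
  from someI_ex[OF this] show ?thesis unfolding pick_def by blast
qed

lemma pick_translate:
  assumes A: "labelled A" and k: "k \<in> carrier G" and y: "y \<in> carrier G" "y \<in> C" "fits A y"
    and C: "\<And>x. x \<in> carrier G \<Longrightarrow> k \<otimes> x \<in> C' \<longleftrightarrow> x \<in> C"
  shows "pick C' ((\<lambda>(i, h). (i, k \<otimes> h)) ` A) = k \<otimes> pick C A"
proof -
  define A' where "A' = (\<lambda>(i, h). (i, k \<otimes> h)) ` A"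
  note b = label_closed[OF A]
  have Ac: "\<And>i h. (i, h) \<in> A \<Longrightarrow> h \<in> carrier G" using A by (auto simp: labelled_def)
  have fst: "fst ` A' = fst ` A" unfolding A'_def by force
  have ne: "A \<noteq> {}" "A' \<noteq> {}" using A by (auto simp: labelled_def A'_def)
  have "((LEAST i. i \<in> fst ` A), label A') \<in> A'" using label_mem[OF ne(2)] fst by simp
  then obtain h where h: "((LEAST i. i \<in> fst ` A), h) \<in> A" "label A' = k \<otimes> h" by (auto simp: A'_def)
  then have lab: "label A' = k \<otimes> label A" using label_mem[OF ne(1)] A unfolding labelled_def by blast
  have fit: "fits A' (k \<otimes> x) \<longleftrightarrow> fits A x" if x: "x \<in> carrier G" for x
  proof -
    have "inv (k \<otimes> h) \<otimes> (k \<otimes> x) = inv h \<otimes> x" if "h \<in> carrier G" for h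
    proof -
      have "inv (k \<otimes> h) \<otimes> (k \<otimes> x) = inv h \<otimes> (inv k \<otimes> (k \<otimes> x))" using that k x by (simp add: inv_mult_group m_assoc)
      also have "inv k \<otimes> (k \<otimes> x) = x" using k x by (simp add: m_assoc[symmetric])
      finally show ?thesis .
    qed
    then show ?thesis unfolding fits_def A'_def using Ac by force
  qed
  \<comment> \<open>The two predicates under the choice operator coincide, so literally the same
    \<open>x\<close> is chosen relative to both labels.\<close>
  have eq: "(x \<in> carrier G \<and> label A' \<otimes> x \<in> C' \<and> fits A' (label A' \<otimes> x)) \<longleftrightarrow>
     (x \<in> carrier G \<and> label A \<otimes> x \<in> C \<and> fits A (label A \<otimes> x))" for x
    using b k C[of "label A \<otimes> x"] fit[of "label A \<otimes> x"] by (auto simp: lab m_assoc)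
  define x0 where "x0 = (SOME x. x \<in> carrier G \<and> label A \<otimes> x \<in> C \<and> fits A (label A \<otimes> x))"
  have "label A \<otimes> (inv (label A) \<otimes> y) = y" using b y by (simp add: m_assoc[symmetric])
  then have "\<exists>x. x \<in> carrier G \<and> label A \<otimes> x \<in> C \<and> fits A (label A \<otimes> x)"
    using b y by (intro exI[of _ "inv (label A) \<otimes> y"]) simp
  from someI_ex[OF this] have "x0 \<in> carrier G" unfolding x0_def by blast
  moreover have "pick C' A' = label A' \<otimes> x0" unfolding pick_def eq x0_def ..
  moreover have "pick C A = label A \<otimes> x0" unfolding pick_def x0_def ..
  ultimately show ?thesis using b k unfolding A'_def[symmetric] by (simp add: lab m_assoc)
qed

lemma fits_imp_common:
  assumes A: "\<And>i h. (i, h) \<in> A \<Longrightarrow> h \<in> carrier G" and x: "x \<in> carrier G" "fits A x" and y: "y \<in> carrier G" "fits A y"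
  shows "inv x \<otimes> y \<in> common (fst ` A)"
  unfolding common_def
proof (intro CollectI conjI ballI)
  fix i assume "i \<in> fst ` A"
  then obtain h where h: "(i, h) \<in> A" by auto
  then have "inv h \<otimes> x \<in> H i" "inv h \<otimes> y \<in> H i" using x y by (auto simp: fits_def)
  then show "inv x \<otimes> y \<in> H i" by (rule coset_trans[OF subgroup_H A[OF h] x(1) y(1)])
qed (use x y in simp)

lemma fits_mono: "fits A x \<Longrightarrow> B \<subseteq> A \<Longrightarrow> fits B x"
  unfolding fits_def by blast

lemma labelled_active:
  assumes "set xs \<subseteq> carrier G" "t \<in> standard_simplex (length xs)" "0 \<le> r" "r < 2"
  shows "labelled (active G (bar_fun G xs t) r)"
  unfolding labelled_def
  using active_finite_nonempty[OF assms] active_unique[OF assms] by (auto simp: active_def)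

definition choice_fun :: "(real \<Rightarrow> 'a) \<Rightarrow> real \<Rightarrow> 'a" where
  "choice_fun e r = pick (carrier G) (active G e r)"

text \<open>The shift by 1 selects the upper half of the threshold range. As \<open>r\<close> grows,
  labels drop out and the intersection becomes larger.\<close>

definition choice_chain :: "(real \<Rightarrow> 'a) \<Rightarrow> real \<Rightarrow> 'a set" where
  "choice_chain e r = common (fst ` active G e (1 + r))"

text \<open>The argument \<open>r / 2\<close> uses up the first half of \<open>V\<close> and leaves
  the second half for \<open>late_chain\<close>, so that all values lie in one coset of
  \<open>V (1/2)\<close>. Using \<open>V 0\<close> for every \<open>r\<close> would not be tame: it
  jumps when the first interval shrinks to nothing. Membership is tested relative to
  \<open>e 0\<close> for the sake of equivariance.\<close>

definition bridge_fun :: "(real \<Rightarrow> 'a) \<Rightarrow> (real \<Rightarrow> 'a set) \<Rightarrow> real \<Rightarrow> 'a" where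
  "bridge_fun e V r = pick {y \<in> carrier G. inv (e 0) \<otimes> y \<in> V (r / 2)} (active G e r)"

definition late_chain :: "(real \<Rightarrow> 'a set) \<Rightarrow> real \<Rightarrow> 'a set" where
  "late_chain V r = V ((1 + r) / 2)"

lemma fits_exists:
  assumes "labelled A"
  shows "\<exists>y\<in>carrier G. fits A y"
proof -
  define g where "g i = (SOME h. (i, h) \<in> A)" for i
  have g: "(i, g i) \<in> A" if "i \<in> fst ` A" for i
  proof -
    have "\<exists>h. (i, h) \<in> A" using that by force
    then show ?thesis unfolding g_def by (rule someI_ex)
  qed
  have "finite (fst ` A)" using assms by (simp add: labelled_def)
  moreover have "g i \<in> carrier G" if "i \<in> fst ` A" for i using g[OF that] assms by (auto simp: labelled_def)
  ultimately obtain y where y: "y \<in> carrier G" "\<forall>i\<in>fst ` A. inv (g i) \<otimes> y \<in> H i" using independent[of "fst ` A" g] by blast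
  have "inv h \<otimes> y \<in> H i" if "(i, h) \<in> A" for i h
  proof -
    have i: "i \<in> fst ` A" using that by force
    then have "h = g i" using g[OF i] that assms unfolding labelled_def by blast
    then show ?thesis using y(2) i by blast
  qed
  then have "fits A y" unfolding fits_def by blast
  then show ?thesis using y(1) by blast
qed

context
  fixes xs :: "'a list" and t :: "nat \<Rightarrow> real" and e :: "real \<Rightarrow> 'a"
  assumes xs: "set xs \<subseteq> carrier G" and t: "t \<in> standard_simplex (length xs)" and e: "e = bar_fun G xs t"
begin

lemma labelled_e: "0 \<le> r \<Longrightarrow> r < 2 \<Longrightarrow> labelled (active G e r)"
  unfolding e by (rule labelled_active[OF xs t])

lemma active_closed: "(i, h) \<in> active G e r \<Longrightarrow> h \<in> carrier G"
  by (simp add: active_def)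

lemma choice_fun_spec:
  assumes "0 \<le> r" "r < 2"
  shows "choice_fun e r \<in> carrier G" "fits (active G e r) (choice_fun e r)"
proof -
  note A = labelled_e[OF assms]
  obtain y where "y \<in> carrier G" "fits (active G e r) y" using fits_exists[OF A] by blast
  from pick_spec[OF A this(1,1,2)] show "choice_fun e r \<in> carrier G" "fits (active G e r) (choice_fun e r)"
    unfolding choice_fun_def using label_closed[OF A] by auto
qed

lemma choice_chain_meets: "0 \<le> r \<Longrightarrow> r < 1 \<Longrightarrow> choice_chain e r \<in> meets"
  unfolding choice_chain_def meets_def
  using active_finite_nonempty[OF xs t, of "1 + r"] by (auto simp: e intro!: exI[of _ "fst ` active G e (1 + r)"])

lemma choice_chain_mono:
  assumes "0 \<le> r" "r \<le> r'" "r' < 1"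
  shows "choice_chain e r \<subseteq> choice_chain e r'"
proof -
  have "active G e (1 + r') \<subseteq> active G e (1 + r)"
    unfolding e by (rule active_antimono[OF xs t]) (use assms in auto)
  then show ?thesis unfolding choice_chain_def common_def by auto
qed

lemma fits_active_1:
  assumes "fits (active G e r) y" "0 \<le> r" "r < 1"
  shows "fits (active G e 1) y"
  by (rule fits_mono[OF assms(1)], unfold e, rule active_antimono[OF xs t]) (use assms in auto)

text \<open>Labels active at parameter 1 are active at every smaller parameter, so \<open>x\<close>
  and \<open>y\<close> both fit them, and \<open>choice_chain e 0\<close> is the intersection over
  precisely these indices.\<close>

lemma fits_imp_choice_coset:
  assumes "fits (active G e r) x" "fits (active G e r') y" "x \<in> carrier G" "y \<in> carrier G"
    "0 \<le> r" "r < 1" "0 \<le> r'" "r' < 1"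
  shows "inv x \<otimes> y \<in> choice_chain e 0"
  unfolding choice_chain_def
  using fits_imp_common[OF active_closed assms(3) fits_active_1[OF assms(1,5,6)] assms(4) fits_active_1[OF assms(2,7,8)]]
  by simp

lemma choice_fun_translate:
  assumes "g \<in> carrier G" "\<forall>r\<in>{0..<1}. e' r = g \<otimes> e r" "0 \<le> r" "r < 2"
  shows "choice_fun e' r = g \<otimes> choice_fun e r"
proof -
  note A = labelled_e[OF assms(3,4)]
  obtain y where y: "y \<in> carrier G" "fits (active G e r) y" using fits_exists[OF A] by blast
  have "active G e' r = (\<lambda>(i, h). (i, g \<otimes> h)) ` active G e r"
    using assms(1,2) by (intro active_translate) (auto simp: e bar_fun_closed[OF xs])
  moreover have "pick (carrier G) ((\<lambda>(i, h). (i, g \<otimes> h)) ` active G e r) = g \<otimes> pick (carrier G) (active G e r)"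
    by (rule pick_translate[OF A assms(1) y(1,1,2)]) (use assms(1) in simp)
  ultimately show ?thesis by (simp add: choice_fun_def)
qed

lemma choice_chain_translate:
  assumes "g \<in> carrier G" "\<forall>r\<in>{0..<1}. e' r = g \<otimes> e r"
  shows "choice_chain e' r = choice_chain e r"
proof -
  have "active G e' (1 + r) = (\<lambda>(i, h). (i, g \<otimes> h)) ` active G e (1 + r)"
    using assms by (intro active_translate) (auto simp: e bar_fun_closed[OF xs])
  then have "fst ` active G e' (1 + r) = fst ` active G e (1 + r)" by force
  then show ?thesis by (simp add: choice_chain_def)
qed

lemma valid_choice: "valid (choice_fun e) (choice_chain e)"
  unfolding valid_def
  using choice_fun_spec choice_chain_meets choice_chain_mono fits_imp_choice_coset[OF choice_fun_spec(2) choice_fun_spec(2) choice_fun_spec(1) choice_fun_spec(1)] by simp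

end

lemma tamable_choice_fun:
  assumes "set xs \<subseteq> carrier G"
  shows "tamable (simplex_topology (length xs)) (\<lambda>t. choice_fun (bar_fun G xs t))"
  unfolding choice_fun_def using tamable_comp[OF tamable_active[OF assms, of 0]] by simp

lemma tamable_choice_chain:
  assumes "set xs \<subseteq> carrier G"
  shows "tamable (simplex_topology (length xs)) (\<lambda>t. choice_chain (bar_fun G xs t))"
  unfolding choice_chain_def using tamable_comp[OF tamable_active[OF assms, of 1]] by simp

text \<open>On a chart \<open>e 0\<close> lies in the first subgroup and hence in all of them, so
  the coset in \<open>bridge_fun\<close> is the subgroup itself.\<close>

lemma chart_coset:
  assumes "chart us xs s t" "r \<in> {0..<1}"
  shows "{y \<in> carrier G. inv (bar_fun G xs t 0) \<otimes> y \<in> chain_fun us s r} = chain_fun us s r"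
proof -
  note c = chartD[OF assms(1)]
  have U: "subgroup (chain_fun us s r) G" by (rule subgroups[OF c(4)[OF assms(2)]])
  have "bar_fun G xs t 0 \<in> hd us" by (rule c(3)) simp
  then have e: "bar_fun G xs t 0 \<in> chain_fun us s r" using c(5)[OF assms(2)] by blast
  then have ec: "bar_fun G xs t 0 \<in> carrier G" by (rule subgroup.mem_carrier[OF U])
  have "y \<in> chain_fun us s r" if "y \<in> carrier G" "inv (bar_fun G xs t 0) \<otimes> y \<in> chain_fun us s r" for y
  proof -
    have "bar_fun G xs t 0 \<otimes> (inv (bar_fun G xs t 0) \<otimes> y) \<in> chain_fun us s r"
      by (rule subgroup.m_closed[OF U e that(2)])
    then show ?thesis using that(1) ec by (simp add: m_assoc[symmetric])
  qed
  moreover have "inv (bar_fun G xs t 0) \<otimes> y \<in> chain_fun us s r" if "y \<in> chain_fun us s r" for y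
    by (rule subgroup.m_closed[OF U subgroup.m_inv_closed[OF U e] that])
  ultimately show ?thesis using subgroup.mem_carrier[OF U] by blast
qed

text \<open>No conflict between the prescribed cosets arises: on a chart, the coset of \<open>V (r / 2)\<close> that
  contains the values of \<open>e\<close> lies in the coset prescribed by any active label.\<close>

lemma bridge_fun_exists:
  assumes ch: "chart us xs s t" and r: "r \<in> {0..<1}"
  shows "\<exists>y\<in>carrier G. y \<in> chain_fun us s (r / 2) \<and> fits (active G (bar_fun G xs t) r) y"
proof -
  note c = chartD[OF ch]
  let ?e = "bar_fun G xs t"
  let ?A = "active G ?e r"
  have t: "t \<in> standard_simplex (length xs)" using ch by (simp add: chart_def)
  have r2: "r / 2 \<in> {0..<1}" using r by auto
  obtain F where F: "finite F" "chain_fun us s (r / 2) = common F" using c(4)[OF r2] by (auto simp: meets_def)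
  have A: "labelled ?A" using labelled_active[OF c(2) t] r by simp
  \<comment> \<open>At an index of \<open>F\<close> without active label the prescribed coset is
    \<open>H i\<close> itself, hence the default value one.\<close>
  define g where "g i = (if i \<in> fst ` ?A then SOME h. (i, h) \<in> ?A else \<one>)" for i
  have g1: "(i, g i) \<in> ?A" if "i \<in> fst ` ?A" for i
  proof -
    have "\<exists>h. (i, h) \<in> ?A" using that by force
    from someI_ex[OF this] show ?thesis unfolding g_def using that by simp
  qed
  have gc: "g i \<in> carrier G" for i
    using g1[of i] by (cases "i \<in> fst ` ?A") (auto simp: active_def g_def)
  have "finite (F \<union> fst ` ?A)" using F A by (simp add: labelled_def)
  then obtain y where y: "y \<in> carrier G" "\<forall>i\<in>F \<union> fst ` ?A. inv (g i) \<otimes> y \<in> H i"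
    using independent[of "F \<union> fst ` ?A" g] gc by blast
  have "inv h \<otimes> y \<in> H i" if "(i, h) \<in> ?A" for i h
  proof -
    have i: "i \<in> fst ` ?A" using that by force
    then have "h = g i" using g1[OF i] that A unfolding labelled_def by blast
    then show ?thesis using y(2) i by blast
  qed
  then have fit: "fits ?A y" unfolding fits_def by blast
  have "y \<in> H i" if i: "i \<in> F" for i
  proof -
    have "g i \<in> H i"
    proof (cases "i \<in> fst ` ?A")
      case True
      obtain k where k: "k \<le> length xs" "g i = gval G xs k"
        using active_values[OF c(2) t _ _ g1[OF True]] r by auto
      have "gval G xs k \<in> chain_fun us s (r / 2)" using c(7)[OF k(1)] c(5)[OF r2] by blast
      then show ?thesis using k(2) F(2) i by (simp add: common_def)
    next
      case False
      then show ?thesis using subgroup.one_closed[OF subgroup_H] by (simp add: g_def)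
    qed
    moreover have "inv (g i) \<otimes> y \<in> H i" using y(2) i by blast
    ultimately have "g i \<otimes> (inv (g i) \<otimes> y) \<in> H i" by (rule subgroup.m_closed[OF subgroup_H])
    then show ?thesis using gc[of i] y(1) by (simp add: m_assoc[symmetric])
  qed
  then have "y \<in> chain_fun us s (r / 2)" using F(2) y(1) by (simp add: common_def)
  then show ?thesis using y(1) fit by blast
qed

lemma bridge_fun_spec:
  assumes ch: "chart us xs s t" and r: "r \<in> {0..<1}"
  shows "bridge_fun (bar_fun G xs t) (chain_fun us s) r \<in> carrier G"
    "bridge_fun (bar_fun G xs t) (chain_fun us s) r \<in> chain_fun us s (r / 2)"
    "fits (active G (bar_fun G xs t) r) (bridge_fun (bar_fun G xs t) (chain_fun us s) r)"
    "bridge_fun (bar_fun G xs t) (chain_fun us s) r = pick (chain_fun us s (r / 2)) (active G (bar_fun G xs t) r)"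
proof -
  have t: "t \<in> standard_simplex (length xs)" using ch by (simp add: chart_def)
  have A: "labelled (active G (bar_fun G xs t) r)" using labelled_active[OF chartD(2)[OF ch] t] r by simp
  obtain y where y: "y \<in> carrier G" "y \<in> chain_fun us s (r / 2)" "fits (active G (bar_fun G xs t) r) y"
    using bridge_fun_exists[OF assms] by blast
  have r2: "r / 2 \<in> {0..<1}" using r by auto
  show eq: "bridge_fun (bar_fun G xs t) (chain_fun us s) r = pick (chain_fun us s (r / 2)) (active G (bar_fun G xs t) r)"
    unfolding bridge_fun_def chart_coset[OF ch r2] ..
  from pick_spec[OF A y] show "bridge_fun (bar_fun G xs t) (chain_fun us s) r \<in> carrier G"
    "bridge_fun (bar_fun G xs t) (chain_fun us s) r \<in> chain_fun us s (r / 2)"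
    "fits (active G (bar_fun G xs t) r) (bridge_fun (bar_fun G xs t) (chain_fun us s) r)"
    unfolding eq using label_closed[OF A] by auto
qed

lemma bridge_fun_translate:
  assumes ch: "chart us xs s t" and g: "g \<in> carrier G"
    and e': "\<forall>r\<in>{0..<1}. e' r = g \<otimes> bar_fun G xs t r \<and> V' r = chain_fun us s r" and r: "r \<in> {0..<1}"
  shows "bridge_fun e' V' r = g \<otimes> bridge_fun (bar_fun G xs t) (chain_fun us s) r"
proof -
  have t: "t \<in> standard_simplex (length xs)" using ch by (simp add: chart_def)
  note xs = chartD(2)[OF ch]
  have A: "labelled (active G (bar_fun G xs t) r)" using labelled_active[OF xs t] r by simp
  obtain y where y: "y \<in> carrier G" "y \<in> chain_fun us s (r / 2)" "fits (active G (bar_fun G xs t) r) y"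
    using bridge_fun_exists[OF ch r] by blast
  have r2: "r / 2 \<in> {0..<1}" using r by auto
  have act: "active G e' r = (\<lambda>(i, h). (i, g \<otimes> h)) ` active G (bar_fun G xs t) r"
    using g e' by (intro active_translate) (auto simp: bar_fun_closed[OF xs])
  have b: "bar_fun G xs t 0 \<in> carrier G" by (rule bar_fun_closed[OF xs])
  have C: "g \<otimes> x \<in> {y \<in> carrier G. inv (e' 0) \<otimes> y \<in> V' (r / 2)} \<longleftrightarrow> x \<in> chain_fun us s (r / 2)"
    if x: "x \<in> carrier G" for x
  proof -
    have "inv (g \<otimes> bar_fun G xs t 0) \<otimes> (g \<otimes> x) = inv (bar_fun G xs t 0) \<otimes> (inv g \<otimes> (g \<otimes> x))"
      using b g x by (simp add: inv_mult_group m_assoc)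
    also have "inv g \<otimes> (g \<otimes> x) = x" using g x by (simp add: m_assoc[symmetric])
    finally have "inv (e' 0) \<otimes> (g \<otimes> x) = inv (bar_fun G xs t 0) \<otimes> x" using e' by simp
    then show ?thesis using chart_coset[OF ch r2] x g e' r2 by auto
  qed
  show ?thesis
    unfolding bridge_fun_spec(4)[OF ch r] bridge_fun_def[of e'] act
    by (rule pick_translate[OF A g y C])
qed

lemma chart_tamableI:
  assumes "\<And>us xs. us \<in> chains_in meets (length us - 1) \<Longrightarrow> set xs \<subseteq> hd us \<Longrightarrow> set xs \<subseteq> carrier G \<Longrightarrow>
    tamable (prod_topology (simplex_topology (length us - 1)) (simplex_topology (length xs)))
       (\<lambda>(s, t). q (bar_fun G xs t) (chain_fun us s))"
  shows "chart_tamable q"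
  unfolding chart_tamable_def
proof (intro allI impI)
  fix us xs assume us: "us \<in> chains_in meets (length us - 1)" and xs: "set xs \<subseteq> hd us"
  have "hd us \<in> meets" using chains_in_hd_mem[OF us] by blast
  then have "set xs \<subseteq> carrier G" using member_carrier xs by blast
  then show "tamable (prod_topology (simplex_topology (length us - 1)) (simplex_topology (length xs)))
       (\<lambda>(s, t). q (bar_fun G xs t) (chain_fun us s))" by (rule assms[OF us xs])
qed

lemma tamable_chart_e:
  assumes "tamable (simplex_topology m) q"
  shows "tamable (prod_topology (simplex_topology n) (simplex_topology m)) (\<lambda>(s, t). q t)"
  using tamable_pullback[OF assms continuous_map_snd] by (simp add: case_prod_unfold)

lemma tamable_chart_V:
  "tamable (prod_topology (simplex_topology n) (simplex_topology m)) (\<lambda>(s, t). chain_fun us s)"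
  using tamable_pullback[OF tamable_chain_fun continuous_map_fst] by (simp add: case_prod_unfold)

lemma chart_tamable_e: "chart_tamable (\<lambda>e V. e)"
  by (rule chart_tamableI) (rule tamable_chart_e[OF tamable_bar_fun])

lemma chart_tamable_V: "chart_tamable (\<lambda>e V. V)"
  by (rule chart_tamableI) (rule tamable_chart_V)

lemma chart_tamable_choice_fun: "chart_tamable (\<lambda>e V. choice_fun e)"
  by (rule chart_tamableI) (rule tamable_chart_e[OF tamable_choice_fun])

lemma chart_tamable_choice_chain: "chart_tamable (\<lambda>e V. choice_chain e)"
  by (rule chart_tamableI) (rule tamable_chart_e[OF tamable_choice_chain])

lemma tamable_chart_scaled_V:
  assumes "0 < a" "0 \<le> b" "a + b \<le> 1"
  shows "tamable (prod_topology (simplex_topology n) (simplex_topology m)) (\<lambda>(s, t) r. chain_fun us s (a * r + b))"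
  using tamable_reparametrize[OF tamable_chart_V assms] by (simp add: case_prod_unfold)

lemma chart_tamable_late_chain: "chart_tamable (\<lambda>e V. late_chain V)"
proof (rule chart_tamableI)
  fix us :: "'a set list" and xs :: "'a list"
  show "tamable (prod_topology (simplex_topology (length us - 1)) (simplex_topology (length xs)))
        (\<lambda>(s, t). late_chain (chain_fun us s))"
    by (rule tamable_cong[OF tamable_chart_scaled_V[of "1/2" "1/2"]])
       (auto simp: late_chain_def add_divide_distrib add.commute)
qed

lemma chart_tamable_Int:
  assumes "chart_tamable q" "chart_tamable q'"
  shows "chart_tamable (\<lambda>e V r. q e V r \<inter> q' e V r)"
proof (rule chart_tamableI)
  fix us :: "'a set list" and xs :: "'a list"
  assume us: "us \<in> chains_in meets (length us - 1)" "set xs \<subseteq> hd us"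
  have "tamable (prod_topology (simplex_topology (length us - 1)) (simplex_topology (length xs)))
       (\<lambda>(s, t). q (bar_fun G xs t) (chain_fun us s))"
    "tamable (prod_topology (simplex_topology (length us - 1)) (simplex_topology (length xs)))
       (\<lambda>(s, t). q' (bar_fun G xs t) (chain_fun us s))"
    using assms us by (auto simp: chart_tamable_def)
  from tamable_comp2[OF this, of "(\<inter>)"]
  show "tamable (prod_topology (simplex_topology (length us - 1)) (simplex_topology (length xs)))
     (\<lambda>(s, t) r. q (bar_fun G xs t) (chain_fun us s) r \<inter> q' (bar_fun G xs t) (chain_fun us s) r)"
    by (rule tamable_cong) (auto split: prod.splits)
qed

lemma chart_tamable_bridge_fun: "chart_tamable bridge_fun"
proof (rule chart_tamableI)
  fix us :: "'a set list" and xs :: "'a list"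
  assume us: "us \<in> chains_in meets (length us - 1)" "set xs \<subseteq> hd us" and xs: "set xs \<subseteq> carrier G"
  let ?T = "prod_topology (simplex_topology (length us - 1)) (simplex_topology (length xs))"
  have "tamable ?T (\<lambda>(s, t) r. chain_fun us s (1/2 * r + 0))"
    by (rule tamable_chart_scaled_V) auto
  moreover have "tamable ?T (\<lambda>(s, t) r. active G (bar_fun G xs t) (0 + r))"
    by (rule tamable_chart_e[OF tamable_active[OF xs]]) auto
  ultimately have "tamable ?T (\<lambda>x r. pick ((\<lambda>(s, t) r. chain_fun us s (1/2 * r + 0)) x r) ((\<lambda>(s, t) r. active G (bar_fun G xs t) (0 + r)) x r))"
    by (rule tamable_comp2)
  then show "tamable ?T (\<lambda>(s, t). bridge_fun (bar_fun G xs t) (chain_fun us s))"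
  proof (rule tamable_cong)
    fix x and r :: real assume x: "x \<in> topspace ?T" and r: "r \<in> {0..<1}"
    obtain s t where st: "x = (s, t)" by (cases x)
    then have "chart us xs s t" using x us by (simp add: chart_def)
    from bridge_fun_spec(4)[OF this r] show "(\<lambda>(s, t). bridge_fun (bar_fun G xs t) (chain_fun us s)) x r =
       pick ((\<lambda>(s, t) r. chain_fun us s (1/2 * r + 0)) x r) ((\<lambda>(s, t) r. active G (bar_fun G xs t) (0 + r)) x r)"
      using st by simp
  qed
qed

end

section \<open>The operations and the homotopies between them\<close>

context independent_family begin

lemma chart_fun_cases:
  assumes "chart_fun e V"
  obtains us xs s t where "chart us xs s t" "e = bar_fun G xs t" "V = chain_fun us s"
    "set xs \<subseteq> carrier G" "t \<in> standard_simplex (length xs)"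
  using assms chartD(2) unfolding chart_fun_def by (metis chart_def)

lemma operation_id: "operation (\<lambda>e V. e) (\<lambda>e V. V)"
  unfolding operation_def natural_def
  using chart_tamable_e chart_tamable_V chart_valid by (auto elim!: chart_fun_cases)

lemma operation_choice: "operation (\<lambda>e V. choice_fun e) (\<lambda>e V. choice_chain e)"
  unfolding operation_def
proof (intro conjI chart_tamable_choice_fun chart_tamable_choice_chain)
  show "natural (\<lambda>e V. choice_fun e) (\<lambda>e V. choice_chain e)"
    unfolding natural_def
  proof (intro allI ballI impI)
    fix e V e' V' g and r :: real
    assume g: "g \<in> carrier G" and c: "chart_fun e V" and e': "\<forall>r\<in>{0..<1}. e' r = g \<otimes> e r \<and> V' r = V r"
      and r: "r \<in> {0..<1}"
    obtain us xs s t where ch: "chart us xs s t" "e = bar_fun G xs t" "V = chain_fun us s"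
      "set xs \<subseteq> carrier G" "t \<in> standard_simplex (length xs)" by (rule chart_fun_cases[OF c])
    have "\<forall>r\<in>{0..<1}. e' r = g \<otimes> e r" using e' by blast
    then show "choice_fun e' r = g \<otimes> choice_fun e r \<and> choice_chain e' r = choice_chain e r"
      using choice_fun_translate[OF ch(4,5,2) g, of e' r] choice_chain_translate[OF ch(4,5,2) g, of e' r] r by simp
  qed
  show "\<forall>e V. chart_fun e V \<longrightarrow> valid (choice_fun e) (choice_chain e)"
  proof (intro allI impI)
    fix e V assume "chart_fun e V"
    then show "valid (choice_fun e) (choice_chain e)" by (rule chart_fun_cases) (rule valid_choice)
  qed
qed

lemma half_interval: "r \<in> {0..<1} \<Longrightarrow> (1 + r) / 2 \<in> {0..<1}" "r \<in> {0..<1} \<Longrightarrow> r / 2 \<in> {0..<1}" for r :: real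
  by auto

lemma natural_bridge:
  assumes g: "g \<in> carrier G" and c: "chart_fun e V" and e': "\<forall>r\<in>{0..<1}. e' r = g \<otimes> e r \<and> V' r = V r"
    and r: "r \<in> {0..<1}"
  shows "bridge_fun e' V' r = g \<otimes> bridge_fun e V r" "late_chain V' r = late_chain V r" "choice_chain e' r = choice_chain e r"
proof -
  obtain us xs s t where ch: "chart us xs s t" "e = bar_fun G xs t" "V = chain_fun us s"
    "set xs \<subseteq> carrier G" "t \<in> standard_simplex (length xs)" by (rule chart_fun_cases[OF c])
  show "bridge_fun e' V' r = g \<otimes> bridge_fun e V r"
    using bridge_fun_translate[OF ch(1) g _ r, of e' V'] e' ch(2,3) by simp
  show "late_chain V' r = late_chain V r" using e' half_interval(1)[OF r] by (simp add: late_chain_def)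
  have "\<forall>r\<in>{0..<1}. e' r = g \<otimes> e r" using e' by blast
  then show "choice_chain e' r = choice_chain e r" by (rule choice_chain_translate[OF ch(4,5,2) g])
qed

text \<open>Each value lies in \<open>V (r / 2)\<close>, which is contained in
  \<open>V (1/2)\<close>, the first subgroup of the late chain.\<close>

lemma bridge_fun_coset:
  assumes ch: "chart us xs s t" and r: "r \<in> {0..<1}" "r' \<in> {0..<1}"
  shows "inv (bridge_fun (bar_fun G xs t) (chain_fun us s) r) \<otimes> bridge_fun (bar_fun G xs t) (chain_fun us s) r' \<in> late_chain (chain_fun us s) 0"
proof -
  have U: "subgroup (chain_fun us s (1/2)) G" by (rule subgroups[OF chartD(4)[OF ch]]) simp
  have "bridge_fun (bar_fun G xs t) (chain_fun us s) r \<in> chain_fun us s (1/2)" if "r \<in> {0..<1}" for r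
    using bridge_fun_spec(2)[OF ch that] chartD(6)[OF ch half_interval(2)[OF that], of "1/2"] that by auto
  then have "inv (bridge_fun (bar_fun G xs t) (chain_fun us s) r) \<otimes> bridge_fun (bar_fun G xs t) (chain_fun us s) r' \<in> chain_fun us s (1/2)"
    using r by (intro subgroup.m_closed[OF U subgroup.m_inv_closed[OF U]])
  then show ?thesis by (simp add: late_chain_def)
qed

lemma bridge_fun_choice_coset:
  assumes ch: "chart us xs s t" and r: "r \<in> {0..<1}" "r' \<in> {0..<1}"
  shows "inv (bridge_fun (bar_fun G xs t) (chain_fun us s) r) \<otimes> bridge_fun (bar_fun G xs t) (chain_fun us s) r' \<in> choice_chain (bar_fun G xs t) 0"
  using r
  by (intro fits_imp_choice_coset[OF chartD(2)[OF ch] _ refl bridge_fun_spec(3)[OF ch r(1)] bridge_fun_spec(3)[OF ch r(2)]]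
      bridge_fun_spec(1)[OF ch]) (use ch in \<open>auto simp: chart_def\<close>)

lemma late_chain_props:
  assumes ch: "chart us xs s t" and r: "r \<in> {0..<1}"
  shows "late_chain (chain_fun us s) r \<in> meets" "r' \<in> {0..<1} \<Longrightarrow> r \<le> r' \<Longrightarrow> late_chain (chain_fun us s) r \<subseteq> late_chain (chain_fun us s) r'"
  unfolding late_chain_def using chartD(4)[OF ch half_interval(1)[OF r]] chartD(6)[OF ch half_interval(1)[OF r] half_interval(1)] by auto

lemma operation_bridge: "operation bridge_fun (\<lambda>e V. late_chain V)"
  unfolding operation_def
proof (intro conjI chart_tamable_bridge_fun chart_tamable_late_chain)
  show "natural bridge_fun (\<lambda>e V. late_chain V)"
    unfolding natural_def
  proof (intro allI ballI impI)
    fix e V e' V' g and r :: real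
    assume a: "g \<in> carrier G" "chart_fun e V" "chart_fun e' V'" "\<forall>r\<in>{0..<1}. e' r = g \<otimes> e r \<and> V' r = V r"
      "r \<in> {0..<1}"
    show "bridge_fun e' V' r = g \<otimes> bridge_fun e V r \<and> late_chain V' r = late_chain V r"
      using natural_bridge[OF a(1,2,4,5)] by simp
  qed
  show "\<forall>e V. chart_fun e V \<longrightarrow> valid (bridge_fun e V) (late_chain V)"
  proof (intro allI impI)
    fix e V assume "chart_fun e V"
    then obtain us xs s t where ch: "chart us xs s t" "e = bar_fun G xs t" "V = chain_fun us s" by (rule chart_fun_cases)
    show "valid (bridge_fun e V) (late_chain V)"
      unfolding valid_def ch(2,3)
      using bridge_fun_spec(1)[OF ch(1)] bridge_fun_coset[OF ch(1), of 0] late_chain_props[OF ch(1)] by simp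
  qed
qed

text \<open>The values of \<open>bridge_fun\<close> lie in one coset of the first subgroup of either
  chain, hence in one coset of the intersection. This pair lies below both chains and links
  them.\<close>

lemma operation_meet: "operation bridge_fun (\<lambda>e V r. late_chain V r \<inter> choice_chain e r)"
  unfolding operation_def
proof (intro conjI chart_tamable_bridge_fun chart_tamable_Int chart_tamable_late_chain chart_tamable_choice_chain)
  show "natural bridge_fun (\<lambda>e V r. late_chain V r \<inter> choice_chain e r)"
    unfolding natural_def
  proof (intro allI ballI impI)
    fix e V e' V' g and r :: real
    assume a: "g \<in> carrier G" "chart_fun e V" "chart_fun e' V'" "\<forall>r\<in>{0..<1}. e' r = g \<otimes> e r \<and> V' r = V r"
      "r \<in> {0..<1}"
    show "bridge_fun e' V' r = g \<otimes> bridge_fun e V r \<and> late_chain V' r \<inter> choice_chain e' r = late_chain V r \<inter> choice_chain e r"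
      using natural_bridge[OF a(1,2,4,5)] by simp
  qed
  show "\<forall>e V. chart_fun e V \<longrightarrow> valid (bridge_fun e V) (\<lambda>r. late_chain V r \<inter> choice_chain e r)"
  proof (intro allI impI)
    fix e V assume "chart_fun e V"
    then obtain us xs s t where ch: "chart us xs s t" "e = bar_fun G xs t" "V = chain_fun us s"
       "set xs \<subseteq> carrier G" "t \<in> standard_simplex (length xs)" by (rule chart_fun_cases)
    have 1: "late_chain (chain_fun us s) r \<inter> choice_chain (bar_fun G xs t) r \<in> meets" if "r \<in> {0..<1}" for r
      using late_chain_props(1)[OF ch(1) that] choice_chain_meets[OF ch(4,5) refl, of r] that by (intro meets_Int) auto
    have 2: "late_chain (chain_fun us s) r \<inter> choice_chain (bar_fun G xs t) r \<subseteq> late_chain (chain_fun us s) r' \<inter> choice_chain (bar_fun G xs t) r'"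
      if "r \<in> {0..<1}" "r' \<in> {0..<1}" "r \<le> r'" for r r'
      using late_chain_props(2)[OF ch(1) that] choice_chain_mono[OF ch(4,5) refl, of r r'] that by auto
    show "valid (bridge_fun e V) (\<lambda>r. late_chain V r \<inter> choice_chain e r)"
      unfolding valid_def ch(2,3)
      using bridge_fun_spec(1)[OF ch(1)] bridge_fun_coset[OF ch(1), of 0] bridge_fun_choice_coset[OF ch(1), of 0] 1 2 by simp
  qed
qed

text \<open>A zigzag: \<open>(e, V)\<close> and the pair with the intersected chain are both
  compared with \<open>(bridge_fun, late_chain)\<close>, and the latter also with the pair of
  choices. In each comparison the chain grows, as \<open>operations_homotopic\<close>
  requires.\<close>

lemma homotopic_id_choice:
  "homotopic_with (\<lambda>_. True) (hocolim_classifying G meets) (hocolim_classifying G meets)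
    (op_map (\<lambda>e V. e) (\<lambda>e V. V)) (op_map (\<lambda>e V. choice_fun e) (\<lambda>e V. choice_chain e))"
proof -
  let ?h = "homotopic_with (\<lambda>_. True) (hocolim_classifying G meets) (hocolim_classifying G meets)"
  have "?h (op_map bridge_fun (\<lambda>e V. late_chain V)) (op_map (\<lambda>e V. e) (\<lambda>e V. V))"
  proof (rule operations_homotopic[OF operation_id operation_bridge])
    fix e V and r :: real assume c: "chart_fun e V" and r: "r \<in> {0..<1}"
    obtain us xs s t where ch: "chart us xs s t" "e = bar_fun G xs t" "V = chain_fun us s" by (rule chart_fun_cases[OF c])
    show "V r \<subseteq> late_chain V r" unfolding late_chain_def ch(3) using r by (intro chartD(6)[OF ch(1)]) auto
    have U: "subgroup (chain_fun us s (1/2)) G" by (rule subgroups[OF chartD(4)[OF ch(1)]]) simp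
    have "bridge_fun e V r \<in> chain_fun us s (1/2)"
      using bridge_fun_spec(2)[OF ch(1) r] chartD(6)[OF ch(1) half_interval(2)[OF r], of "1/2"] r ch(2,3) by auto
    moreover have "e 0 \<in> chain_fun us s (1/2)"
      using chartD(3)[OF ch(1), of 0] chartD(5)[OF ch(1), of "1/2"] ch(2) by auto
    ultimately have "inv (e 0) \<otimes> bridge_fun e V r \<in> chain_fun us s (1/2)"
      by (intro subgroup.m_closed[OF U subgroup.m_inv_closed[OF U]])
    then show "inv (e 0) \<otimes> bridge_fun e V r \<in> late_chain V 0" by (simp add: late_chain_def ch(3))
  qed
  moreover have "?h (op_map bridge_fun (\<lambda>e V. late_chain V)) (op_map bridge_fun (\<lambda>e V r. late_chain V r \<inter> choice_chain e r))"
  proof (rule operations_homotopic[OF operation_meet operation_bridge])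
    fix e V and r :: real assume c: "chart_fun e V" and r: "r \<in> {0..<1}"
    obtain us xs s t where ch: "chart us xs s t" "e = bar_fun G xs t" "V = chain_fun us s" by (rule chart_fun_cases[OF c])
    show "inv (bridge_fun e V 0) \<otimes> bridge_fun e V r \<in> late_chain V 0" unfolding ch(2,3) by (rule bridge_fun_coset[OF ch(1) _ r]) simp
  qed blast
  moreover have "?h (op_map (\<lambda>e V. choice_fun e) (\<lambda>e V. choice_chain e)) (op_map bridge_fun (\<lambda>e V r. late_chain V r \<inter> choice_chain e r))"
  proof (rule operations_homotopic[OF operation_meet operation_choice])
    fix e V and r :: real assume c: "chart_fun e V" and r: "r \<in> {0..<1}"
    obtain us xs s t where ch: "chart us xs s t" "e = bar_fun G xs t" "V = chain_fun us s"
       "set xs \<subseteq> carrier G" "t \<in> standard_simplex (length xs)" by (rule chart_fun_cases[OF c])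
    have 0: "(0::real) \<in> {0..<1}" by simp
    have "inv (bridge_fun (bar_fun G xs t) (chain_fun us s) 0) \<otimes> choice_fun (bar_fun G xs t) r \<in> choice_chain (bar_fun G xs t) 0"
      using r
      by (intro fits_imp_choice_coset[OF ch(4,5) refl bridge_fun_spec(3)[OF ch(1) 0] choice_fun_spec(2)[OF ch(4,5) refl]]
         bridge_fun_spec(1)[OF ch(1)] choice_fun_spec(1)[OF ch(4,5) refl]) auto
    then show "inv (bridge_fun e V 0) \<otimes> choice_fun e r \<in> choice_chain e 0" by (simp add: ch(2,3))
  qed blast
  ultimately show ?thesis
    by (meson homotopic_with_sym homotopic_with_trans)
qed

section \<open>The two homotopy inverse maps\<close>

definition forget :: "'a hocolim_rep set \<Rightarrow> 'a classifying_point" where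
  "forget C = bar_class G (fst (select C))"

definition bar_select :: "'a classifying_point \<Rightarrow> real \<Rightarrow> 'a" where
  "bar_select c = (SOME e. \<exists>xs t. set xs \<subseteq> carrier G \<and> t \<in> standard_simplex (length xs) \<and>
     e = bar_fun G xs t \<and> c = bar_class G e)"

definition spread :: "'a classifying_point \<Rightarrow> 'a hocolim_rep set" where
  "spread c = hocolim_class G meets (choice_fun (bar_select c)) (choice_chain (bar_select c))"

lemma forget_chart:
  assumes "chart us xs s t"
  shows "forget (hocolim_class G meets (bar_fun G xs t) (chain_fun us s)) = bar_class G (bar_fun G xs t)"
proof -
  obtain g e V where s: "select (hocolim_class G meets (bar_fun G xs t) (chain_fun us s)) = (e, V)"
    "chart_fun e V" "g \<in> carrier G" "\<forall>r\<in>{0..<1}. e r = g \<otimes> bar_fun G xs t r \<and> V r = chain_fun us s r"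
    by (rule select_chart[OF assms])
  have "t \<in> standard_simplex (length xs)" using assms by (simp add: chart_def)
  then have "bar_class G e = bar_class G (bar_fun G xs t)"
    using s(4) by (intro bar_class_translate[OF bar_class_bar_fun(1)[OF chartD(2)[OF assms] refl] s(3)]) auto
  then show ?thesis by (simp add: forget_def s(1))
qed

lemma bar_select_spec:
  assumes xs: "set xs \<subseteq> carrier G" and t: "t \<in> standard_simplex (length xs)"
  obtains g xs' t' where "set xs' \<subseteq> carrier G" "t' \<in> standard_simplex (length xs')"
    "bar_select (bar_class G (bar_fun G xs t)) = bar_fun G xs' t'" "g \<in> carrier G"
    "\<forall>r\<in>{0..<1}. bar_fun G xs' t' r = g \<otimes> bar_fun G xs t r"
proof -
  have "\<exists>e xs' t'. set xs' \<subseteq> carrier G \<and> t' \<in> standard_simplex (length xs') \<and>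
     e = bar_fun G xs' t' \<and> bar_class G (bar_fun G xs t) = bar_class G e"
    using assms by blast
  from someI_ex[OF this] obtain xs' t' where x: "set xs' \<subseteq> carrier G" "t' \<in> standard_simplex (length xs')"
    "bar_select (bar_class G (bar_fun G xs t)) = bar_fun G xs' t'"
    "bar_class G (bar_fun G xs t) = bar_class G (bar_select (bar_class G (bar_fun G xs t)))"
    unfolding bar_select_def[symmetric] by blast
  have "bar_rep G (bar_fun G xs' t') (length xs, xs, t)"
    using bar_rep_of_class_eq[OF x(4) bar_class_bar_fun(1)[OF xs refl t]] x(3) by simp
  from bar_rep_unique_function[OF bar_class_bar_fun(1)[OF xs refl t] this] show thesis
    using that[OF x(1-3)] by blast
qed

lemma choice_hocolim_rep:
  assumes xs: "set xs \<subseteq> carrier G" and t: "t \<in> standard_simplex (length xs)"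
  shows "\<exists>p. hocolim_rep G meets (choice_fun (bar_fun G xs t)) (choice_chain (bar_fun G xs t)) p"
proof -
  have "valid (choice_fun (bar_fun G xs t)) (choice_chain (bar_fun G xs t))" if "t \<in> topspace (simplex_topology (length xs))" for t
    using valid_choice[OF xs _ refl] that by simp
  from continuous_map_hocolim_class(2)[OF tamable_choice_fun[OF xs] tamable_choice_chain[OF xs] this] t show ?thesis by simp
qed

lemma spread_chart:
  assumes xs: "set xs \<subseteq> carrier G" and t: "t \<in> standard_simplex (length xs)"
  shows "spread (bar_class G (bar_fun G xs t)) = hocolim_class G meets (choice_fun (bar_fun G xs t)) (choice_chain (bar_fun G xs t))"
proof -
  obtain g xs' t' where s: "set xs' \<subseteq> carrier G" "t' \<in> standard_simplex (length xs')"
    "bar_select (bar_class G (bar_fun G xs t)) = bar_fun G xs' t'" "g \<in> carrier G"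
    "\<forall>r\<in>{0..<1}. bar_fun G xs' t' r = g \<otimes> bar_fun G xs t r"
    by (rule bar_select_spec[OF assms])
  obtain p where p: "hocolim_rep G meets (choice_fun (bar_fun G xs t)) (choice_chain (bar_fun G xs t)) p"
    using choice_hocolim_rep[OF assms] by (rule exE)
  show ?thesis
    unfolding spread_def s(3)
    by (rule hocolim_class_translate[OF p s(4)])
       (use choice_fun_translate[OF xs t refl s(4,5)] choice_chain_translate[OF xs t refl s(4,5)] in simp)
qed

lemma continuous_map_forget:
  "continuous_map (hocolim_classifying G meets) (classifying_space G) forget"
proof (rule continuous_map_slice, rule continuous_map_from_hocolim[OF unit_interval_compact])
  fix n us m xs assume us: "us \<in> chains_in meets n" and xs: "set xs \<subseteq> hd us" "length xs = m"
  have n: "n = length us - 1" using us by (simp add: chains_in_def)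
  have "hd us \<in> meets" using chains_in_hd_mem[OF us] by blast
  then have xc: "set xs \<subseteq> carrier G" using member_carrier xs by blast
  let ?T = "prod_topology (prod_topology unit_interval (simplex_topology n)) (simplex_topology m)"
  have "continuous_map ?T (classifying_space G) (\<lambda>p. bar_class G (bar_fun G xs (snd p)))"
    by (rule continuous_map_bar_class(1)[OF tamable_pullback[OF tamable_bar_fun continuous_map_snd]])
       (rule bar_fun_closed[OF xc])
  then show "continuous_map ?T (classifying_space G) (\<lambda>((z, s), t). case (z, hocolim_glue G meets ``
      {(n, (us, bar_glue (G\<lparr>carrier := hd us\<rparr>) `` {(m, xs, t)}), s)}) of (z, x) \<Rightarrow> forget x)"
  proof (rule continuous_map_eq)
    fix p assume p: "p \<in> topspace ?T"
    obtain z s t where pp: "p = ((z, s), t)" by (metis prod.exhaust)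
    then have c: "chart us xs s t" using p us xs n by (simp add: chart_def)
    have "hocolim_glue G meets `` {(n, (us, bar_glue (G\<lparr>carrier := hd us\<rparr>) `` {(m, xs, t)}), s)} =
        hocolim_class G meets (bar_fun G xs t) (chain_fun us s)"
      using hocolim_class_eq[OF chart_rep[OF c]] n xs by (simp add: chart_point_def)
    then show "bar_class G (bar_fun G xs (snd p)) = (\<lambda>((z, s), t). case (z, hocolim_glue G meets ``
      {(n, (us, bar_glue (G\<lparr>carrier := hd us\<rparr>) `` {(m, xs, t)}), s)}) of (z, x) \<Rightarrow> forget x) p"
      using forget_chart[OF c] pp by simp
  qed
qed

lemma continuous_map_spread:
  "continuous_map (classifying_space G) (hocolim_classifying G meets) spread"
proof (rule continuous_map_slice, rule continuous_map_from_classifying_space[OF unit_interval_compact])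
  fix m xs assume xs: "set xs \<subseteq> carrier G" "length xs = m"
  let ?T = "prod_topology unit_interval (simplex_topology m)"
  have \<pi>: "continuous_map ?T (simplex_topology (length xs)) snd" using continuous_map_snd xs(2) by simp
  have "valid (choice_fun (bar_fun G xs (snd p))) (choice_chain (bar_fun G xs (snd p)))" if "p \<in> topspace ?T" for p
    using valid_choice[OF xs(1) _ refl, of "snd p"] that xs(2) by auto
  from continuous_map_hocolim_class(1)[OF tamable_pullback[OF tamable_choice_fun[OF xs(1)] \<pi>] tamable_pullback[OF tamable_choice_chain[OF xs(1)] \<pi>] this]
  have "continuous_map ?T (hocolim_classifying G meets)
    (\<lambda>p. hocolim_class G meets (choice_fun (bar_fun G xs (snd p))) (choice_chain (bar_fun G xs (snd p))))" by simp
  then show "continuous_map ?T (hocolim_classifying G meets)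
     (\<lambda>(z, t). case (z, bar_glue G `` {(m, xs, t)}) of (z, x) \<Rightarrow> spread x)"
  proof (rule continuous_map_eq)
    fix p assume "p \<in> topspace ?T"
    then obtain z t where p: "p = (z, t)" "t \<in> standard_simplex (length xs)" using xs(2) by auto
    show "hocolim_class G meets (choice_fun (bar_fun G xs (snd p))) (choice_chain (bar_fun G xs (snd p))) =
       (\<lambda>(z, t). case (z, bar_glue G `` {(m, xs, t)}) of (z, x) \<Rightarrow> spread x) p"
      using spread_chart[OF xs(1) p(2)] bar_class_bar_fun(2)[OF xs(1) refl p(2)] p(1) xs(2) by simp
  qed
qed

text \<open>\<open>forget\<close> is computed on charts, but the pair behind \<open>spread\<close>
  does not come from one. A chart of the same point differs from it by a translation, which
  \<open>bar_class\<close> ignores.\<close>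

lemma forget_spread_chart:
  assumes xs: "set xs \<subseteq> carrier G" and t: "t \<in> standard_simplex (length xs)"
  shows "forget (spread (bar_class G (bar_fun G xs t))) = bar_class G (choice_fun (bar_fun G xs t))"
proof -
  let ?E = "choice_fun (bar_fun G xs t)" and ?W = "choice_chain (bar_fun G xs t)"
  obtain p where p: "hocolim_rep G meets ?E ?W p" using choice_hocolim_rep[OF assms] by (rule exE)
  obtain us ys s u where ch: "chart us ys s u"
    "hocolim_class G meets ?E ?W = hocolim_class G meets (bar_fun G ys u) (chain_fun us s)"
    by (rule hocolim_point_cases[OF hocolim_class_in_topspace[OF p]])
  have u: "u \<in> standard_simplex (length ys)" using ch(1) by (simp add: chart_def)
  have "hocolim_rep G meets ?E ?W (chart_point us ys s u)"
    using chart_rep[OF ch(1)] ch(2) by (auto simp: hocolim_class_def)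
  from hocolim_rep_unique_function[OF chart_rep[OF ch(1)] this] obtain g where
    g: "g \<in> carrier G" "\<forall>r\<in>{0..<1}. ?E r = g \<otimes> bar_fun G ys u r" by blast
  have "bar_class G ?E = bar_class G (bar_fun G ys u)"
    by (rule bar_class_translate[OF bar_class_bar_fun(1)[OF chartD(2)[OF ch(1)] refl u] g])
  then show ?thesis using spread_chart[OF assms] ch(2) forget_chart[OF ch(1)] by simp
qed

text \<open>In the classifying space no subgroup constrains the values, so splicing \<open>e\<close>
  into \<open>choice_fun e\<close> at the point \<open>z\<close> is already a homotopy.\<close>

lemma homotopic_forget_spread:
  "homotopic_with (\<lambda>_. True) (classifying_space G) (classifying_space G) (forget \<circ> spread) id"
proof -
  define h where "h = (\<lambda>(z, c). bar_class G (splice z (bar_select c) (choice_fun (bar_select c))))"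
  have h: "h (z, bar_class G (bar_fun G xs t)) = bar_class G (splice z (bar_fun G xs t) (choice_fun (bar_fun G xs t)))"
    if xs: "set xs \<subseteq> carrier G" and t: "t \<in> standard_simplex (length xs)"
      and q: "\<exists>q. bar_rep G (splice z (bar_fun G xs t) (choice_fun (bar_fun G xs t))) q" for z xs t
  proof -
    obtain g xs' t' where s: "set xs' \<subseteq> carrier G" "t' \<in> standard_simplex (length xs')"
      "bar_select (bar_class G (bar_fun G xs t)) = bar_fun G xs' t'" "g \<in> carrier G"
      "\<forall>r\<in>{0..<1}. bar_fun G xs' t' r = g \<otimes> bar_fun G xs t r"
      by (rule bar_select_spec[OF xs t])
    obtain q where q: "bar_rep G (splice z (bar_fun G xs t) (choice_fun (bar_fun G xs t))) q" using q by blast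
    have "\<forall>r\<in>{0..<1}. splice z (bar_fun G xs' t') (choice_fun (bar_fun G xs' t')) r =
        g \<otimes> splice z (bar_fun G xs t) (choice_fun (bar_fun G xs t)) r"
      using s(5) choice_fun_translate[OF xs t refl s(4,5)] by (simp add: splice_def)
    from bar_class_translate[OF q s(4) this] show ?thesis by (simp add: h_def s(3))
  qed
  have "continuous_map (prod_topology unit_interval (classifying_space G)) (classifying_space G) h"
  proof (rule continuous_map_from_classifying_space[OF unit_interval_compact])
    fix m xs assume xs: "set xs \<subseteq> carrier G" "length xs = m"
    let ?T = "prod_topology unit_interval (simplex_topology m)"
    have \<pi>: "continuous_map ?T (simplex_topology (length xs)) snd" using continuous_map_snd xs(2) by simp
    have z: "continuous_map ?T euclideanreal fst"
    proof -
      have "continuous_map unit_interval euclideanreal (\<lambda>x. x)"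
        unfolding unit_interval_def by (simp add: continuous_map_from_subtopology)
      from continuous_map_compose[OF continuous_map_fst this] show ?thesis by (simp add: o_def)
    qed
    have tm: "tamable ?T (\<lambda>p. splice (fst p) (bar_fun G xs (snd p)) (choice_fun (bar_fun G xs (snd p))))"
      by (rule tamable_splice[OF tamable_pullback[OF tamable_bar_fun \<pi>] tamable_pullback[OF tamable_choice_fun[OF xs(1)] \<pi>] z])
    have cl: "splice (fst p) (bar_fun G xs (snd p)) (choice_fun (bar_fun G xs (snd p))) r \<in> carrier G"
      if "p \<in> topspace ?T" "r \<in> {0..<1}" for p r
      using choice_fun_spec(1)[OF xs(1) _ refl, of "snd p" r] bar_fun_closed[OF xs(1)] that xs(2) by (auto simp: splice_def)
    show "continuous_map ?T (classifying_space G) (\<lambda>(z, t). h (z, bar_glue G `` {(m, xs, t)}))"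
    proof (rule continuous_map_eq[OF continuous_map_bar_class(1)[OF tm cl]])
      fix p assume p: "p \<in> topspace ?T"
      then obtain z t where pp: "p = (z, t)" "t \<in> standard_simplex (length xs)" using xs(2) by auto
      from continuous_map_bar_class(2)[OF tm cl p]
      have "h (z, bar_class G (bar_fun G xs t)) = bar_class G (splice z (bar_fun G xs t) (choice_fun (bar_fun G xs t)))"
        by (intro h xs pp) (simp add: pp)
      then show "bar_class G (splice (fst p) (bar_fun G xs (snd p)) (choice_fun (bar_fun G xs (snd p)))) =
        (\<lambda>(z, t). h (z, bar_glue G `` {(m, xs, t)})) p"
        using bar_class_bar_fun(2)[OF xs(1) refl pp(2)] pp(1) xs(2) by simp
    qed
  qed
  then have "homotopic_with (\<lambda>_. True) (classifying_space G) (classifying_space G) (\<lambda>c. h (0, c)) (\<lambda>c. h (1, c))"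
    unfolding homotopic_with_def unit_interval_def by blast
  then show ?thesis
  proof (rule homotopic_with_eq)
    fix c assume "c \<in> topspace (classifying_space G)"
    then obtain n xs t where x: "set xs \<subseteq> carrier G" "length xs = n" "t \<in> standard_simplex n"
      "c = bar_class G (\<lambda>r. gval G xs (idx t r))" by (rule classifying_point_cases)
    then have c: "c = bar_class G (bar_fun G xs t)" and t: "t \<in> standard_simplex (length xs)"
      by (simp_all add: bar_fun_def[abs_def])
    obtain g xs' t' where s: "set xs' \<subseteq> carrier G" "t' \<in> standard_simplex (length xs')"
      "bar_select (bar_class G (bar_fun G xs t)) = bar_fun G xs' t'" "g \<in> carrier G"
      "\<forall>r\<in>{0..<1}. bar_fun G xs' t' r = g \<otimes> bar_fun G xs t r"
      by (rule bar_select_spec[OF x(1) t])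
    have c': "bar_class G (bar_fun G xs' t') = c"
      unfolding c by (rule bar_class_translate[OF bar_class_bar_fun(1)[OF x(1) refl t] s(4,5)])
    have "h (1, c) = bar_class G (bar_fun G xs' t')"
      unfolding h_def prod.case c s(3) by (rule bar_class_cong) (simp add: splice_def)
    then show "id c = h (1, c)" using c' by simp
    have "h (0, c) = bar_class G (choice_fun (bar_fun G xs' t'))"
      unfolding h_def prod.case c s(3) by (rule bar_class_cong) (simp add: splice_def)
    then show "(forget \<circ> spread) c = h (0, c)"
      using forget_spread_chart[OF s(1,2)] c' by simp
  qed auto
qed

lemma homotopic_spread_forget:
  "homotopic_with (\<lambda>_. True) (hocolim_classifying G meets) (hocolim_classifying G meets) (spread \<circ> forget) id"
proof (rule homotopic_with_eq[OF homotopic_with_symD[OF homotopic_id_choice]])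
  fix C assume "C \<in> topspace (hocolim_classifying G meets)"
  then obtain us xs s t where ch: "chart us xs s t" "C = hocolim_class G meets (bar_fun G xs t) (chain_fun us s)"
    by (rule hocolim_point_cases)
  have t: "t \<in> standard_simplex (length xs)" using ch(1) by (simp add: chart_def)
  show "(spread \<circ> forget) C = op_map (\<lambda>e V. choice_fun e) (\<lambda>e V. choice_chain e) C"
    unfolding ch(2) op_map_chart[OF operation_choice ch(1)] o_def forget_chart[OF ch(1)]
    by (rule spread_chart[OF chartD(2)[OF ch(1)] t])
  show "id C = op_map (\<lambda>e V. e) (\<lambda>e V. V) C"
    unfolding ch(2) op_map_chart[OF operation_id ch(1)] by simp
qed auto

theorem hocolim_meets_homotopy_equivalent:
  "hocolim_classifying G meets homotopy_equivalent_space classifying_space G"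
  unfolding homotopy_equivalent_space_def
  using continuous_map_forget continuous_map_spread homotopic_spread_forget homotopic_forget_spread by blast

end

section \<open>Congruence subgroups over a Euclidean ring\<close>

text \<open>Division with respect to the complex modulus drives the row reduction. Integrality of
  the squared modulus makes it terminate, and also prevents a prime from becoming a unit.\<close>

locale norm_euclidean_subring =
  fixes R :: "complex set"
  assumes one_mem: "1 \<in> R"
    and add_mem: "x \<in> R \<Longrightarrow> y \<in> R \<Longrightarrow> x + y \<in> R"
    and uminus_mem: "x \<in> R \<Longrightarrow> - x \<in> R"
    and mult_mem: "x \<in> R \<Longrightarrow> y \<in> R \<Longrightarrow> x * y \<in> R"
    and norm_nat: "x \<in> R \<Longrightarrow> \<exists>n::nat. (cmod x)\<^sup>2 = real n"
    and division: "x \<in> R \<Longrightarrow> y \<in> R \<Longrightarrow> y \<noteq> 0 \<Longrightarrow> \<exists>q\<in>R. cmod (x - q * y) < cmod y"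
begin

lemma diff_mem: "x \<in> R \<Longrightarrow> y \<in> R \<Longrightarrow> x - y \<in> R"
  using add_mem[OF _ uminus_mem] by force

lemma zero_mem: "0 \<in> R"
  using diff_mem[OF one_mem one_mem] by simp

lemma of_nat_mem: "of_nat n \<in> R"
  by (induction n) (auto intro: zero_mem one_mem add_mem)

lemma of_int_mem: "of_int n \<in> R"
  by (cases n) (auto intro: of_nat_mem uminus_mem simp del: of_nat_Suc)

lemmas mem = one_mem zero_mem add_mem uminus_mem mult_mem diff_mem of_nat_mem of_int_mem

definition nrm :: "complex \<Rightarrow> nat" where
  "nrm x = nat \<lfloor>(cmod x)\<^sup>2\<rfloor>"

lemma nrm_less:
  assumes "x \<in> R" "y \<in> R" "cmod x < cmod y"
  shows "nrm x < nrm y"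
proof -
  obtain m n where mn: "(cmod x)\<^sup>2 = real m" "(cmod y)\<^sup>2 = real n" using norm_nat assms by meson
  have "(cmod x)\<^sup>2 < (cmod y)\<^sup>2" using assms(3) by (intro power_strict_mono) auto
  then show ?thesis using mn by (simp add: nrm_def)
qed

lemma ideal_principal:
  assumes J: "J \<subseteq> R" "\<And>x y q. x \<in> J \<Longrightarrow> y \<in> J \<Longrightarrow> q \<in> R \<Longrightarrow> x - q * y \<in> J" and "z \<in> J" "z \<noteq> 0"
  obtains y where "y \<in> J" "y \<noteq> 0" "\<forall>x\<in>J. \<exists>q\<in>R. x = q * y"
proof -
  have ex: "\<exists>z. z \<in> J \<and> z \<noteq> 0" using assms by blast
  define y where "y = (ARG_MIN nrm z. z \<in> J \<and> z \<noteq> 0)"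
  have y: "y \<in> J" "y \<noteq> 0" and min: "\<And>x. x \<in> J \<Longrightarrow> x \<noteq> 0 \<Longrightarrow> nrm y \<le> nrm x"
    using arg_min_natI[of "\<lambda>z. z \<in> J \<and> z \<noteq> 0" z nrm] arg_min_nat_le[of "\<lambda>z. z \<in> J \<and> z \<noteq> 0" _ nrm] assms
    unfolding y_def by auto
  show thesis
  proof (rule that[OF y], rule ballI)
    fix x assume x: "x \<in> J"
    then obtain q where q: "q \<in> R" "cmod (x - q * y) < cmod y" using division J(1) y by blast
    have r: "x - q * y \<in> J" by (rule J(2)[OF x y(1) q(1)])
    have "nrm (x - q * y) < nrm y" using r J(1) y(1) q(2) by (intro nrm_less) auto
    then have "x - q * y = 0" using min[OF r] by linarith
    then show "\<exists>q\<in>R. x = q * y" using q(1) by auto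
  qed
qed

text \<open>The denominators of all powers of \<open>x\<close> form an ideal that is stable under multiplication by
  \<open>x\<close>; its generator \<open>y\<close> satisfies \<open>y * x = q * y\<close>.\<close>

lemma integrally_closed:
  assumes x: "algebraic_int x" and v: "v \<in> R" "v \<noteq> 0" "v * x \<in> R"
  shows "x \<in> R"
proof -
  obtain p :: "int poly" where p: "poly (map_poly of_int p) x = 0" "lead_coeff p = 1"
    using x algebraic_int_altdef_ipoly by blast
  define n where "n = degree p"
  have pow: "y ^ k \<in> R" if "y \<in> R" for y k using that by (induction k) (auto intro: mem)
  have sum: "(\<And>i. i \<in> I \<Longrightarrow> f i \<in> R) \<Longrightarrow> sum f I \<in> R" for f and I :: "nat set"
    by (induction I rule: infinite_finite_induct) (auto intro: mem)
  have rel: "x ^ n = - (\<Sum>i<n. of_int (coeff p i) * x ^ i)"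
  proof -
    have "degree (map_poly of_int p :: complex poly) = n" unfolding n_def by (intro degree_map_poly) auto
    then have "0 = (\<Sum>i\<le>n. of_int (coeff p i) * x ^ i)"
      using p(1) by (simp add: poly_altdef coeff_map_poly)
    also have "\<dots> = (\<Sum>i<n. of_int (coeff p i) * x ^ i) + x ^ n"
      using p(2) by (simp add: lessThan_Suc_atMost[symmetric] n_def)
    finally show ?thesis by (simp add: eq_neg_iff_add_eq_0 add.commute)
  qed
  \<comment> \<open>The factor \<open>v ^ n\<close> clears the denominators of the powers below
    \<open>n\<close>, and the monic relation expresses every higher power by lower ones with integer
    coefficients.\<close>
  have vn: "v ^ n * x ^ k \<in> R" for k
  proof (induction k rule: less_induct)
    case (less k)
    show ?case
    proof (cases "k < n")
      case True
      then have "v ^ n * x ^ k = v ^ (n - k) * (v * x) ^ k"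
        by (simp add: power_mult_distrib power_add[symmetric])
      then show ?thesis using pow v by (auto intro: mem)
    next
      case False
      then have "x ^ k = x ^ (k - n) * x ^ n" by (simp add: power_add[symmetric])
      then have "v ^ n * x ^ k = - (\<Sum>i<n. of_int (coeff p i) * (v ^ n * x ^ (k - n + i)))"
        unfolding rel by (simp add: sum_distrib_left power_add algebra_simps)
      moreover have "\<dots> \<in> R"
        by (intro uminus_mem sum mult_mem of_int_mem less.IH) (use False in auto)
      ultimately show ?thesis by simp
    qed
  qed
  define J where "J = {y \<in> R. \<forall>k. y * x ^ k \<in> R}"
  obtain y where y: "y \<in> J" "y \<noteq> 0" "\<forall>x\<in>J. \<exists>q\<in>R. x = q * y"
  proof (rule ideal_principal)
    show "J \<subseteq> R" "v ^ n \<noteq> 0" using v by (auto simp: J_def)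
    show "v ^ n \<in> J" using vn pow v by (auto simp: J_def)
    show "a - q * b \<in> J" if "a \<in> J" "b \<in> J" "q \<in> R" for a b q
      using that by (auto simp: J_def left_diff_distrib mult.assoc intro: mem)
  qed
  have "y * x ^ Suc k \<in> R" for k using y(1) unfolding J_def by blast
  from this this[of 0] have "y * x \<in> J" unfolding J_def by (simp add: mult.assoc)
  then obtain q where "q \<in> R" "y * x = q * y" using y(3) by blast
  then show ?thesis using y(2) by simp
qed

section \<open>Two by two matrices and the group SL2\<close>

definition mat2 :: "complex \<Rightarrow> complex \<Rightarrow> complex \<Rightarrow> complex \<Rightarrow> complex ^ 2 ^ 2" where
  "mat2 a b c d = (\<chi> i j. if i = 1 then if j = 1 then a else b else if j = 1 then c else d)"

lemma mat2_nth [simp]: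
  "mat2 a b c d $ 1 $ 1 = a" "mat2 a b c d $ 1 $ 2 = b" "mat2 a b c d $ 2 $ 1 = c" "mat2 a b c d $ 2 $ 2 = d"
  by (simp_all add: mat2_def)

lemma mat2_eta: "A = mat2 (A $ 1 $ 1) (A $ 1 $ 2) (A $ 2 $ 1) (A $ 2 $ 2)"
  by (simp add: vec_eq_iff forall_2)

lemma mat2_eq_iff [simp]: "mat2 a b c d = mat2 a' b' c' d' \<longleftrightarrow> a = a' \<and> b = b' \<and> c = c' \<and> d = d'"
  by (auto simp: vec_eq_iff forall_2)

lemma mat2_mult [simp]:
  "mat2 a b c d ** mat2 a' b' c' d' = mat2 (a * a' + b * c') (a * b' + b * d') (c * a' + d * c') (c * b' + d * d')"
  by (simp add: vec_eq_iff forall_2 matrix_matrix_mult_def sum_2)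

lemma mat_1_eq: "mat 1 = mat2 1 0 0 1"
  by (simp add: vec_eq_iff forall_2 mat_def)

lemma uminus_mat2: "- mat2 a b c d = mat2 (- a) (- b) (- c) (- d)"
  by (simp add: vec_eq_iff forall_2)

lemma det_mat2: "det (mat2 a b c d) = a * d - b * c"
  by (simp add: det_2)

lemma SL2_iff: "mat2 a b c d \<in> carrier (SL2 R) \<longleftrightarrow> a \<in> R \<and> b \<in> R \<and> c \<in> R \<and> d \<in> R \<and> a * d - b * c = 1"
  by (auto simp: SL2_def forall_2 det_mat2)

lemma SL2_cases:
  assumes "A \<in> carrier (SL2 R)"
  obtains a b c d where "A = mat2 a b c d" "a \<in> R" "b \<in> R" "c \<in> R" "d \<in> R" "a * d - b * c = 1"
  using assms mat2_eta[of A] SL2_iff by metis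

lemma mult_SL2 [simp]: "A \<otimes>\<^bsub>SL2 R\<^esub> B = A ** B" "\<one>\<^bsub>SL2 R\<^esub> = mat2 1 0 0 1"
  by (auto simp: SL2_def mat_1_eq)

lemma SL2_mult_closed: "A \<in> carrier (SL2 R) \<Longrightarrow> B \<in> carrier (SL2 R) \<Longrightarrow> A ** B \<in> carrier (SL2 R)"
proof -
  assume "A \<in> carrier (SL2 R)" "B \<in> carrier (SL2 R)"
  then have "(A ** B) $ i $ j \<in> R" "det (A ** B) = 1" for i j
    by (auto simp: SL2_def det_mul) (auto simp: SL2_def matrix_matrix_mult_def sum_2 intro!: mem)
  then show ?thesis by (simp add: SL2_def)
qed

lemma group_SL2: "group (SL2 R)"
proof (rule groupI)
  show "\<exists>B\<in>carrier (SL2 R). B \<otimes>\<^bsub>SL2 R\<^esub> A = \<one>\<^bsub>SL2 R\<^esub>" if AS: "A \<in> carrier (SL2 R)" for A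
  proof -
    obtain a b c d where A: "A = mat2 a b c d" "a \<in> R" "b \<in> R" "c \<in> R" "d \<in> R" "a * d - b * c = 1"
      using AS by (rule SL2_cases)
    have "mat2 d (- b) (- c) a \<in> carrier (SL2 R)" using A by (auto simp: SL2_iff algebra_simps intro: mem)
    moreover have "mat2 d (- b) (- c) a ** A = mat2 1 0 0 1" using A by (simp add: algebra_simps)
    ultimately show ?thesis by auto
  qed
  show "\<one>\<^bsub>SL2 R\<^esub> \<in> carrier (SL2 R)" by (simp add: SL2_iff mem)
qed (auto simp: SL2_mult_closed matrix_mul_assoc mat_1_eq[symmetric])

sublocale S: group "SL2 R"
  by (rule group_SL2)

lemma inv_mat2:
  assumes "mat2 a b c d \<in> carrier (SL2 R)"
  shows "inv\<^bsub>SL2 R\<^esub> (mat2 a b c d) = mat2 d (- b) (- c) a"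
  using assms by (intro S.inv_equality) (auto simp: SL2_iff algebra_simps intro: mem)

abbreviation "centre \<equiv> {mat 1, - mat 1 :: complex ^ 2 ^ 2}"

lemma centre_eq: "centre = {mat2 1 0 0 1, mat2 (-1) 0 0 (-1)}"
  by (simp add: mat_1_eq uminus_mat2)

lemma subgroup_centre: "subgroup centre (SL2 R)"
  unfolding centre_eq
proof (rule S.subgroupI)
  show "{mat2 1 0 0 1, mat2 (-1) 0 0 (-1)} \<subseteq> carrier (SL2 R)" by (auto simp: SL2_iff intro: mem)
qed (auto simp: inv_mat2 SL2_iff mem)

lemma normal_centre: "centre \<lhd> SL2 R"
  unfolding S.normal_inv_iff
proof (intro conjI subgroup_centre ballI)
  fix A B assume A: "A \<in> carrier (SL2 R)" and B: "B \<in> centre"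
  obtain a b c d where a: "A = mat2 a b c d" "a \<in> R" "b \<in> R" "c \<in> R" "d \<in> R" "a * d - b * c = 1"
    using A by (rule SL2_cases)
  then have "inv\<^bsub>SL2 R\<^esub> A = mat2 d (- b) (- c) a" using inv_mat2 A by simp
  then show "A \<otimes>\<^bsub>SL2 R\<^esub> B \<otimes>\<^bsub>SL2 R\<^esub> inv\<^bsub>SL2 R\<^esub> A \<in> centre"
    using B a unfolding centre_eq by (auto simp: algebra_simps)
qed

text \<open>The kernel of reduction modulo \<open>m\<close>, written with explicit entries so that
  no quotient ring has to be formed.\<close>

definition principal :: "nat \<Rightarrow> (complex ^ 2 ^ 2) set" where
  "principal m = {A \<in> carrier (SL2 R). \<exists>a\<in>R. \<exists>b\<in>R. \<exists>c\<in>R. \<exists>d\<in>R.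
     A = mat2 (1 + of_nat m * a) (of_nat m * b) (of_nat m * c) (1 + of_nat m * d)}"

lemma principal_cases:
  assumes "A \<in> principal m"
  obtains a b c d where "A = mat2 (1 + of_nat m * a) (of_nat m * b) (of_nat m * c) (1 + of_nat m * d)"
    "a \<in> R" "b \<in> R" "c \<in> R" "d \<in> R" "A \<in> carrier (SL2 R)"
  using assms unfolding principal_def by blast

lemma principalI:
  assumes "mat2 a' b' c' d' \<in> carrier (SL2 R)" "a' = 1 + of_nat m * a" "b' = of_nat m * b" "c' = of_nat m * c"
    "d' = 1 + of_nat m * d" "a \<in> R" "b \<in> R" "c \<in> R" "d \<in> R"
  shows "mat2 a' b' c' d' \<in> principal m"
  using assms unfolding principal_def by blast

lemma subgroup_principal: "subgroup (principal m) (SL2 R)"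
proof (rule S.subgroupI)
  show "principal m \<subseteq> carrier (SL2 R)" by (auto simp: principal_def)
  have "mat2 1 0 0 1 \<in> principal m"
    by (rule principalI[where a = 0 and b = 0 and c = 0 and d = 0]) (auto simp: SL2_iff mem)
  then show "principal m \<noteq> {}" by blast
  show "inv\<^bsub>SL2 R\<^esub> A \<in> principal m" if "A \<in> principal m" for A
  proof -
    obtain a b c d where A: "A = mat2 (1 + of_nat m * a) (of_nat m * b) (of_nat m * c) (1 + of_nat m * d)"
      "a \<in> R" "b \<in> R" "c \<in> R" "d \<in> R" "A \<in> carrier (SL2 R)" using \<open>A \<in> principal m\<close> by (rule principal_cases)
    have i: "inv\<^bsub>SL2 R\<^esub> A = mat2 (1 + of_nat m * d) (- (of_nat m * b)) (- (of_nat m * c)) (1 + of_nat m * a)"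
      using inv_mat2 A by simp
    have "inv\<^bsub>SL2 R\<^esub> A \<in> carrier (SL2 R)" using A(6) by simp
    then show ?thesis
      unfolding i by (rule principalI[where a = d and b = "- b" and c = "- c" and d = a]) (use A in \<open>auto intro: mem\<close>)
  qed
  show "A \<otimes>\<^bsub>SL2 R\<^esub> B \<in> principal m" if "A \<in> principal m" "B \<in> principal m" for A B
  proof -
    obtain a b c d where A: "A = mat2 (1 + of_nat m * a) (of_nat m * b) (of_nat m * c) (1 + of_nat m * d)"
      "a \<in> R" "b \<in> R" "c \<in> R" "d \<in> R" "A \<in> carrier (SL2 R)" using \<open>A \<in> principal m\<close> by (rule principal_cases)
    obtain e f g h where B: "B = mat2 (1 + of_nat m * e) (of_nat m * f) (of_nat m * g) (1 + of_nat m * h)"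
      "e \<in> R" "f \<in> R" "g \<in> R" "h \<in> R" "B \<in> carrier (SL2 R)" using \<open>B \<in> principal m\<close> by (rule principal_cases)
    have c: "A ** B \<in> carrier (SL2 R)" by (rule SL2_mult_closed[OF A(6) B(6)])
    let ?m = "of_nat m :: complex"
    show ?thesis
      unfolding mult_SL2 using c unfolding A(1) B(1) mat2_mult
      by (rule principalI[where a = "a + e + ?m * (a * e + b * g)" and b = "f + b + ?m * (a * f + b * h)"
            and c = "c + g + ?m * (c * e + d * g)" and d = "d + h + ?m * (c * f + d * h)"])
         (use A(2-5) B(2-5) in \<open>auto simp: algebra_simps intro!: mem\<close>)
  qed
qed

lemma principal_mono:
  assumes "p dvd m"
  shows "principal m \<subseteq> principal p"
proof
  fix A assume "A \<in> principal m"
  then obtain a b c d where A: "A = mat2 (1 + of_nat m * a) (of_nat m * b) (of_nat m * c) (1 + of_nat m * d)"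
    "a \<in> R" "b \<in> R" "c \<in> R" "d \<in> R" "A \<in> carrier (SL2 R)" by (rule principal_cases)
  obtain k where k: "m = p * k" using assms by blast
  show "A \<in> principal p"
    using A(6) unfolding A(1)
    by (rule principalI[where a = "of_nat k * a" and b = "of_nat k * b" and c = "of_nat k * c" and d = "of_nat k * d"])
       (use A k in \<open>auto simp: mult.assoc intro: mem\<close>)
qed

section \<open>Elementary matrices and the product of two principal congruence subgroups\<close>

abbreviation "upper x \<equiv> mat2 1 x 0 1"
abbreviation "lower x \<equiv> mat2 1 0 x 1"

lemma elementary_mem: "x \<in> R \<Longrightarrow> upper x \<in> carrier (SL2 R)" "x \<in> R \<Longrightarrow> lower x \<in> carrier (SL2 R)"
  by (auto simp: SL2_iff mem)

lemma elementary_mult_mem: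
  "x \<in> R \<Longrightarrow> A \<in> carrier (SL2 R) \<Longrightarrow> upper x ** A \<in> carrier (SL2 R)"
  "x \<in> R \<Longrightarrow> A \<in> carrier (SL2 R) \<Longrightarrow> lower x ** A \<in> carrier (SL2 R)"
  by (blast intro: SL2_mult_closed elementary_mem)+

lemma elementary_cancel: "upper (- x) ** (upper x ** A) = A" "lower (- x) ** (lower x ** A) = A"
proof -
  have "upper (- x) ** upper x = mat 1" "lower (- x) ** lower x = mat 1" by (simp_all add: mat_1_eq)
  then show "upper (- x) ** (upper x ** A) = A" "lower (- x) ** (lower x ** A) = A"
    by (simp_all only: matrix_mul_assoc matrix_mul_lid)
qed

lemma elementary_principal:
  assumes "x \<in> R"
  shows "upper (of_nat m * x) \<in> principal m" "lower (of_nat m * x) \<in> principal m"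
  by (rule principalI[where a = 0 and b = x and c = 0 and d = 0], use assms in \<open>auto simp: SL2_iff intro: mem\<close>)
     (rule principalI[where a = 0 and b = 0 and c = x and d = 0], use assms in \<open>auto simp: SL2_iff intro: mem\<close>)

text \<open>Conjugation fixes the identity matrix, and the deviation from it stays divisible by
  \<open>m\<close>; the witnesses are the entries of the conjugated deviation.\<close>

lemma elementary_conjugate:
  assumes x: "x \<in> R" and A: "A \<in> principal m"
  shows "upper x ** A ** upper (- x) \<in> principal m" "lower x ** A ** lower (- x) \<in> principal m"
proof -
  obtain a b c d where A: "A = mat2 (1 + of_nat m * a) (of_nat m * b) (of_nat m * c) (1 + of_nat m * d)"
    "a \<in> R" "b \<in> R" "c \<in> R" "d \<in> R" "A \<in> carrier (SL2 R)" using A by (rule principal_cases)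
  have c: "upper x ** A ** upper (- x) \<in> carrier (SL2 R)" "lower x ** A ** lower (- x) \<in> carrier (SL2 R)"
    using A(6) x by (intro SL2_mult_closed elementary_mem uminus_mem; simp)+
  show "upper x ** A ** upper (- x) \<in> principal m"
    using c(1) unfolding A(1) mat2_mult
    by (rule principalI[where a = "a + x * c" and b = "b + x * (d - a) - x * x * c" and c = c and d = "d - x * c"])
       (use A x in \<open>auto simp: algebra_simps intro!: mem\<close>)
  show "lower x ** A ** lower (- x) \<in> principal m"
    using c(2) unfolding A(1) mat2_mult
    by (rule principalI[where a = "a - x * b" and b = b and c = "c + x * (a - d) - x * x * b" and d = "d + x * b"])
       (use A x in \<open>auto simp: algebra_simps intro!: mem\<close>)
qed

text \<open>The Euclidean algorithm on the first column, with row operations only.\<close>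

lemma elementary_induct:
  assumes one: "Q (mat2 1 0 0 1)"
    and upper: "\<And>A x. A \<in> carrier (SL2 R) \<Longrightarrow> x \<in> R \<Longrightarrow> Q A \<Longrightarrow> Q (upper x ** A)"
    and lower: "\<And>A x. A \<in> carrier (SL2 R) \<Longrightarrow> x \<in> R \<Longrightarrow> Q A \<Longrightarrow> Q (lower x ** A)"
  shows "A \<in> carrier (SL2 R) \<Longrightarrow> Q A"
proof (induction "nrm (A $ 2 $ 1)" arbitrary: A rule: less_induct)
  case less
  \<comment> \<open>Elementary matrices have elementary inverses, so \<open>Q\<close> passes from a
    reduced matrix back to the original one.\<close>
  have U: "Q A" if "Q (mat2 1 x 0 1 ** A)" "x \<in> R" "A \<in> carrier (SL2 R)" for x A
  proof -
    have "Q (mat2 1 (- x) 0 1 ** (mat2 1 x 0 1 ** A))"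
      by (rule upper[OF SL2_mult_closed[OF elementary_mem(1)[OF that(2)] that(3)] uminus_mem[OF that(2)] that(1)])
    then show ?thesis by (simp only: elementary_cancel)
  qed
  have L: "Q A" if "Q (mat2 1 0 x 1 ** A)" "x \<in> R" "A \<in> carrier (SL2 R)" for x A
  proof -
    have "Q (mat2 1 0 (- x) 1 ** (mat2 1 0 x 1 ** A))"
      by (rule lower[OF SL2_mult_closed[OF elementary_mem(2)[OF that(2)] that(3)] uminus_mem[OF that(2)] that(1)])
    then show ?thesis by (simp only: elementary_cancel)
  qed
  obtain a b c d where A: "A = mat2 a b c d" "a \<in> R" "b \<in> R" "c \<in> R" "d \<in> R" "a * d - b * c = 1"
    using less.prems by (rule SL2_cases)
  show ?case
  proof (cases "c = 0")
    case True
    then have ad: "d * a = 1" using A(6) by (simp add: mult.commute)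
    \<comment> \<open>Now \<open>a\<close> is a unit with inverse \<open>d\<close>. The first
      columns of \<open>A1\<close>, \<open>A2\<close>, \<open>A3\<close> are \<open>(a, 1)\<close>,
      \<open>(1, 1)\<close> and \<open>(1, 0)\<close>; the last step clears the upper right
      entry.\<close>
    define A1 where "A1 = mat2 1 0 d 1 ** A"
    define A2 where "A2 = mat2 1 (1 - a) 0 1 ** A1"
    define A3 where "A3 = mat2 1 0 (- 1) 1 ** A2"
    define A4 where "A4 = mat2 1 (- (A3 $ 1 $ 2)) 0 1 ** A3"
    have A1: "A1 \<in> carrier (SL2 R)" unfolding A1_def by (rule elementary_mult_mem(2)[OF A(5) less.prems])
    have A2: "A2 \<in> carrier (SL2 R)"
      unfolding A2_def by (rule elementary_mult_mem(1)[OF diff_mem[OF one_mem A(2)] A1])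
    have "A3 \<in> carrier (SL2 R)" unfolding A3_def by (rule elementary_mult_mem(2)[OF uminus_mem[OF one_mem] A2])
    note c1 = A1 A2 this
    have A3: "A3 = mat2 1 (A3 $ 1 $ 2) 0 1"
    proof -
      have col: "A3 $ 1 $ 1 = 1" "A3 $ 2 $ 1 = 0"
        unfolding A3_def A2_def A1_def A(1) using True ad by (simp_all add: algebra_simps)
      have "A3 = mat2 1 (A3 $ 1 $ 2) 0 (A3 $ 2 $ 2)" using mat2_eta[of A3] col by simp
      moreover have "det A3 = 1" using c1(3) by (simp add: SL2_def)
      ultimately have "A3 $ 2 $ 2 = 1" by (metis det_mat2 mult_1 mult_zero_right diff_zero)
      then show ?thesis using \<open>A3 = mat2 1 (A3 $ 1 $ 2) 0 (A3 $ 2 $ 2)\<close> by simp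
    qed
    then have m: "A3 $ 1 $ 2 \<in> R" using c1(3) SL2_iff by metis
    have "A4 = mat2 1 0 0 1" unfolding A4_def by (subst (2) A3) simp
    then have "Q A4" using one by simp
    then have "Q A3" unfolding A4_def by (rule U) (use m c1 in \<open>auto intro: mem\<close>)
    then have "Q A2" unfolding A3_def by (rule L) (use c1 in \<open>auto intro: mem\<close>)
    then have "Q A1" unfolding A2_def by (rule U) (use c1 A in \<open>auto intro: mem\<close>)
    then show "Q A" unfolding A1_def by (rule L) (use A less.prems in auto)
  next
    case False
    obtain q where q: "q \<in> R" "cmod (a - q * c) < cmod c" using division A False by blast
    define A1 where "A1 = mat2 1 (- q) 0 1 ** A"
    \<comment> \<open>Three elementary steps exchange the rows up to sign: with
      \<open>x = a - q * c\<close>, the first column changes from \<open>(x, c)\<close> to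
      \<open>(x, x + c)\<close>, \<open>(-c, x + c)\<close> and \<open>(-c, x)\<close>.\<close>
    define A2 where "A2 = mat2 1 0 1 1 ** A1"
    define A3 where "A3 = mat2 1 (- 1) 0 1 ** A2"
    define A4 where "A4 = mat2 1 0 1 1 ** A3"
    have A1: "A1 \<in> carrier (SL2 R)" unfolding A1_def by (rule elementary_mult_mem(1)[OF uminus_mem[OF q(1)] less.prems])
    have A2: "A2 \<in> carrier (SL2 R)" unfolding A2_def by (rule elementary_mult_mem(2)[OF one_mem A1])
    have A3: "A3 \<in> carrier (SL2 R)" unfolding A3_def by (rule elementary_mult_mem(1)[OF uminus_mem[OF one_mem] A2])
    have "A4 \<in> carrier (SL2 R)" unfolding A4_def by (rule elementary_mult_mem(2)[OF one_mem A3])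
    note c1 = A1 A2 A3 this
    have "A4 $ 2 $ 1 = a - q * c"
      unfolding A4_def A3_def A2_def A1_def A(1) by (simp add: algebra_simps)
    then have "nrm (A4 $ 2 $ 1) < nrm (A $ 2 $ 1)"
      using q A by (auto intro!: nrm_less mem)
    then have "Q A4" using less.hyps c1 by blast
    then have "Q A3" unfolding A4_def by (rule L) (use c1 in \<open>auto intro: mem\<close>)
    then have "Q A2" unfolding A3_def by (rule U) (use c1 in \<open>auto intro: mem\<close>)
    then have "Q A1" unfolding A2_def by (rule L) (use c1 in \<open>auto intro: mem\<close>)
    then show "Q A" unfolding A1_def by (rule U) (use q less.prems in \<open>auto intro: mem\<close>)
  qed
qed

text \<open>By Bezout every elementary matrix is the product of one with parameter divisible by
  \<open>m\<close> and one with parameter divisible by \<open>n\<close>. In an induction over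
  elementary factors the second one is moved past \<open>B\<close> by conjugation, which keeps
  \<open>B\<close> in \<open>principal m\<close>.\<close>

lemma principal_product:
  assumes cop: "coprime m n" and A: "A \<in> carrier (SL2 R)"
  shows "\<exists>B\<in>principal m. \<exists>C\<in>principal n. A = B ** C"
proof -
  have "coprime (int m) (int n)" using cop by simp
  then obtain u v :: int where uv: "u * int m + v * int n = 1"
    by (metis coprime_iff_gcd_eq_1 bezout_int)
  then have uvc: "of_int u * of_nat m + of_int v * of_nat n = (1 :: complex)"
    by (metis of_int_1 of_int_add of_int_mult of_int_of_nat_eq)
  have split: "x = of_nat m * (of_int u * x) + of_nat n * (of_int v * x)" for x :: complex
  proof -
    have "x = (of_int u * of_nat m + of_int v * of_nat n) * x" unfolding uvc by simp
    then show ?thesis by (simp add: algebra_simps)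
  qed
  note pm = subgroup.m_closed[OF subgroup_principal, unfolded mult_SL2]
  show ?thesis
  proof (rule elementary_induct[OF _ _ _ A])
    have "mat2 1 0 0 1 \<in> principal k" for k using subgroup.one_closed[OF subgroup_principal] by simp
    then show "\<exists>B\<in>principal m. \<exists>C\<in>principal n. mat2 1 0 0 1 = B ** C"
      by (intro bexI[of _ "mat2 1 0 0 1"]) auto
    fix A x assume x: "x \<in> R" and "\<exists>B\<in>principal m. \<exists>C\<in>principal n. A = B ** C"
    then obtain B C where BC: "B \<in> principal m" "C \<in> principal n" "A = B ** C" by blast
    \<comment> \<open>The splitting \<open>x = m y + z\<close> with \<open>z\<close> divisible by
      \<open>n\<close>. The matrices with parameters \<open>z\<close> and \<open>-z\<close> are
      inserted so that the first bracket lies in \<open>principal m\<close> and the second in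
      \<open>principal n\<close>.\<close>
    define y z where "y = of_int u * x" and "z = of_nat n * (of_int v * x)"
    have yz: "y \<in> R" "z \<in> R" "x = of_nat m * y + z" using x split[of x] by (auto simp: y_def z_def intro: mem)
    have zn: "upper z \<in> principal n" "lower z \<in> principal n"
      unfolding z_def by (intro elementary_principal mem x)+
    have "mat2 1 x 0 1 ** A = (mat2 1 (of_nat m * y) 0 1 ** (upper z ** B ** upper (- z))) ** (upper z ** C)"
    proof -
      have "mat2 1 (of_nat m * y) 0 1 ** (upper z ** B ** upper (- z)) ** (upper z ** C) =
        (mat2 1 (of_nat m * y) 0 1 ** upper z) ** B ** (upper (- z) ** upper z) ** C"
        by (simp only: matrix_mul_assoc)
      also have "\<dots> = mat2 1 x 0 1 ** B ** C" using yz(3) by (simp add: mat_1_eq[symmetric] add.commute)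
      finally show ?thesis by (simp add: BC(3) matrix_mul_assoc)
    qed
    then show "\<exists>B\<in>principal m. \<exists>C\<in>principal n. mat2 1 x 0 1 ** A = B ** C"
      using pm[OF elementary_principal(1)[OF yz(1)] elementary_conjugate(1)[OF yz(2) BC(1)]] pm[OF zn(1) BC(2)] by blast
    have "mat2 1 0 x 1 ** A = (mat2 1 0 (of_nat m * y) 1 ** (lower z ** B ** lower (- z))) ** (lower z ** C)"
    proof -
      have "mat2 1 0 (of_nat m * y) 1 ** (lower z ** B ** lower (- z)) ** (lower z ** C) =
        (mat2 1 0 (of_nat m * y) 1 ** lower z) ** B ** (lower (- z) ** lower z) ** C"
        by (simp only: matrix_mul_assoc)
      also have "\<dots> = mat2 1 0 x 1 ** B ** C" using yz(3) by (simp add: mat_1_eq[symmetric] add.commute)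
      finally show ?thesis by (simp add: BC(3) matrix_mul_assoc)
    qed
    then show "\<exists>B\<in>principal m. \<exists>C\<in>principal n. mat2 1 0 x 1 ** A = B ** C"
      using pm[OF elementary_principal(2)[OF yz(1)] elementary_conjugate(2)[OF yz(2) BC(1)]] pm[OF zn(2) BC(2)] by blast
  qed
qed

end

section \<open>Independence of the congruence subgroups in SL2 and PSL2\<close>

context norm_euclidean_subring begin

text \<open>A Chinese remainder argument by induction. If \<open>B\<close> solves the problem for
  \<open>F\<close>, write the product of the inverse of \<open>B\<close> with \<open>A j\<close> as
  \<open>C D\<close>, with \<open>C\<close> congruent to one for all primes of \<open>F\<close> and
  \<open>D\<close> for \<open>p j\<close>; then \<open>B C\<close> solves it for the enlarged
  set.\<close>

lemma independent_SL2:
  assumes "finite F" "\<And>i j. i \<in> F \<Longrightarrow> j \<in> F \<Longrightarrow> i \<noteq> j \<Longrightarrow> coprime (p i) (p j)"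
    "\<And>i. i \<in> F \<Longrightarrow> A i \<in> carrier (SL2 R)"
  shows "\<exists>B\<in>carrier (SL2 R). \<forall>i\<in>F. inv\<^bsub>SL2 R\<^esub> (A i) \<otimes>\<^bsub>SL2 R\<^esub> B \<in> principal (p i)"
  using assms
proof (induction F)
  case (insert j F)
  then obtain B where B: "B \<in> carrier (SL2 R)"
    "\<forall>i\<in>F. inv\<^bsub>SL2 R\<^esub> (A i) \<otimes>\<^bsub>SL2 R\<^esub> B \<in> principal (p i)" by auto
  have Aj: "A j \<in> carrier (SL2 R)" using insert by auto
  have "coprime (\<Prod>i\<in>F. p i) (p j)" using insert.hyps insert.prems(1) by (intro prod_coprime_left) auto
  from principal_product[OF this, of "inv\<^bsub>SL2 R\<^esub> B \<otimes>\<^bsub>SL2 R\<^esub> A j"] obtain C D where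
    CD: "C \<in> principal (\<Prod>i\<in>F. p i)" "D \<in> principal (p j)" "inv\<^bsub>SL2 R\<^esub> B \<otimes>\<^bsub>SL2 R\<^esub> A j = C \<otimes>\<^bsub>SL2 R\<^esub> D"
    using B Aj by (metis S.inv_closed S.m_closed mult_SL2(1))
  have c: "C \<in> carrier (SL2 R)" "D \<in> carrier (SL2 R)" using CD by (auto simp: principal_def)
  have AB: "A j = B \<otimes>\<^bsub>SL2 R\<^esub> (C \<otimes>\<^bsub>SL2 R\<^esub> D)"
    unfolding CD(3)[symmetric] using B Aj by (simp add: S.m_assoc[symmetric] del: mult_SL2)
  have "inv\<^bsub>SL2 R\<^esub> (A j) \<otimes>\<^bsub>SL2 R\<^esub> (B \<otimes>\<^bsub>SL2 R\<^esub> C) = inv\<^bsub>SL2 R\<^esub> D"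
  proof -
    have "A j = (B \<otimes>\<^bsub>SL2 R\<^esub> C) \<otimes>\<^bsub>SL2 R\<^esub> D" unfolding AB using B c by (simp add: S.m_assoc del: mult_SL2)
    then have "inv\<^bsub>SL2 R\<^esub> (A j) = inv\<^bsub>SL2 R\<^esub> D \<otimes>\<^bsub>SL2 R\<^esub> inv\<^bsub>SL2 R\<^esub> (B \<otimes>\<^bsub>SL2 R\<^esub> C)"
      using B c by (simp add: S.inv_mult_group del: mult_SL2)
    then show ?thesis using B c by (simp add: S.m_assoc del: mult_SL2)
  qed
  then have "inv\<^bsub>SL2 R\<^esub> (A j) \<otimes>\<^bsub>SL2 R\<^esub> (B \<otimes>\<^bsub>SL2 R\<^esub> C) \<in> principal (p j)"
    using subgroup.m_inv_closed[OF subgroup_principal CD(2)] by simp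
  moreover have "inv\<^bsub>SL2 R\<^esub> (A i) \<otimes>\<^bsub>SL2 R\<^esub> (B \<otimes>\<^bsub>SL2 R\<^esub> C) \<in> principal (p i)" if i: "i \<in> F" for i
  proof -
    have "p i dvd (\<Prod>i\<in>F. p i)" using i insert.hyps(1) by (rule dvd_prodI[rotated])
    then have "C \<in> principal (p i)" using principal_mono CD(1) by blast
    then have "(inv\<^bsub>SL2 R\<^esub> (A i) \<otimes>\<^bsub>SL2 R\<^esub> B) \<otimes>\<^bsub>SL2 R\<^esub> C \<in> principal (p i)"
      using B(2) i subgroup.m_closed[OF subgroup_principal] by blast
    moreover have "A i \<in> carrier (SL2 R)" using insert.prems(2) i by simp
    ultimately show ?thesis using B c by (simp add: S.m_assoc del: mult_SL2)
  qed
  moreover have "B \<otimes>\<^bsub>SL2 R\<^esub> C \<in> carrier (SL2 R)" using B c by (simp del: mult_SL2)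
  ultimately show ?case by blast
qed (use S.one_closed in blast)

text \<open>Compare the upper right entries: some \<open>p b\<close> would be 1 or -1, so
  \<open>p\<^sup>2\<close> times the natural number \<open>(cmod b)\<^sup>2\<close> would be 1. Both
  signs occur because congruence holds only up to the centre.\<close>

lemma upper_1_not_congruent:
  assumes "prime p" "B \<in> principal p" "Z \<in> centre"
  shows "Z ** B \<noteq> upper 1"
proof
  assume eq: "Z ** B = upper 1"
  obtain a b c d where B: "B = mat2 (1 + of_nat p * a) (of_nat p * b) (of_nat p * c) (1 + of_nat p * d)"
    "a \<in> R" "b \<in> R" "c \<in> R" "d \<in> R" "B \<in> carrier (SL2 R)" using assms(2) by (rule principal_cases)
  have "of_nat p * b = 1 \<or> of_nat p * b = - 1"
    using eq assms(3) unfolding centre_eq B(1) by (auto simp: equation_minus_iff)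
  then have "cmod (of_nat p * b) = 1" by auto
  then have "(real p)\<^sup>2 * (cmod b)\<^sup>2 = 1" by (simp add: norm_mult power_mult_distrib[symmetric])
  moreover obtain n where "(cmod b)\<^sup>2 = real n" using norm_nat B(3) by blast
  ultimately have "real (p\<^sup>2 * n) = real 1" by simp
  then have "p\<^sup>2 * n = 1" by (simp only: of_nat_eq_iff)
  then show False using assms(1) by (simp add: power2_eq_square)
qed

definition congruence_subgroup :: "nat \<Rightarrow> (complex ^ 2 ^ 2) set set" where
  "congruence_subgroup p = (\<lambda>A. centre #>\<^bsub>SL2 R\<^esub> A) ` principal p"

lemma PSL2_eq: "PSL2 R = SL2 R Mod centre"
  by (simp add: PSL2_def)

sublocale Z: normal centre "SL2 R"
  by (rule normal_centre)

lemma group_PSL2: "group (PSL2 R)"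
  unfolding PSL2_eq by (rule Z.factorgroup_is_group)

lemma group_hom_PSL2: "group_hom (SL2 R) (PSL2 R) (\<lambda>A. centre #>\<^bsub>SL2 R\<^esub> A)"
  using Z.r_coset_hom_Mod group_PSL2 group_SL2
  by (simp add: group_hom_def group_hom_axioms_def PSL2_eq)

lemma subgroup_congruence: "subgroup (congruence_subgroup p) (PSL2 R)"
  unfolding congruence_subgroup_def
  by (rule group_hom.subgroup_img_is_subgroup[OF group_hom_PSL2 subgroup_principal])

lemma congruence_proper:
  assumes "prime p"
  shows "congruence_subgroup p \<noteq> carrier (PSL2 R)"
proof
  assume eq: "congruence_subgroup p = carrier (PSL2 R)"
  have u: "upper 1 \<in> carrier (SL2 R)" by (rule elementary_mem(1)[OF one_mem])
  have "centre #>\<^bsub>SL2 R\<^esub> upper 1 \<in> congruence_subgroup p"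
    unfolding eq using group_hom.hom_closed[OF group_hom_PSL2 u] .
  then obtain B where B: "B \<in> principal p" "centre #>\<^bsub>SL2 R\<^esub> upper 1 = centre #>\<^bsub>SL2 R\<^esub> B"
    by (auto simp: congruence_subgroup_def)
  have "upper 1 \<in> centre #>\<^bsub>SL2 R\<^esub> upper 1" by (rule S.rcos_self[OF u subgroup_centre])
  then have "upper 1 \<in> centre #>\<^bsub>SL2 R\<^esub> B" unfolding B(2) .
  then obtain Z where Z: "Z \<in> centre" "upper 1 = Z ** B"
    unfolding r_coset_def mult_SL2(1) by blast
  then show False using upper_1_not_congruent[OF assms B(1) Z(1)] by simp
qed

text \<open>Cosets in the quotient are lifted to matrices, the problem is solved in SL2, and the
  solution is projected back. Enumerating the primes provides the indices of the windows.\<close>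

lemma independent_family_PSL2:
  "independent_family (PSL2 R) (\<lambda>i. congruence_subgroup (enumerate {p::nat. prime p} i))"
proof (intro independent_family.intro independent_family_axioms.intro group_PSL2 subgroup_congruence)
  fix F :: "nat set" and g
  assume F: "finite F" and g: "\<And>i. i \<in> F \<Longrightarrow> g i \<in> carrier (PSL2 R)"
  let ?p = "\<lambda>i. enumerate {p::nat. prime p} i"
  interpret h: group_hom "SL2 R" "PSL2 R" "\<lambda>A. centre #>\<^bsub>SL2 R\<^esub> A" by (rule group_hom_PSL2)
  have inf: "infinite {p::nat. prime p}" by (rule primes_infinite)
  have prime: "prime (?p i)" for i using enumerate_in_set[OF inf, of i] by simp
  have cop: "coprime (?p i) (?p j)" if "i \<noteq> j" for i j
  proof -
    have "?p i \<noteq> ?p j" using that strict_mono_enumerate[OF inf] by (simp add: strict_mono_eq)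
    then show ?thesis using prime by (intro primes_coprime)
  qed
  have "\<exists>A. A \<in> carrier (SL2 R) \<and> g i = centre #>\<^bsub>SL2 R\<^esub> A" if "i \<in> F" for i
    using g[OF that] unfolding PSL2_eq FactGroup_def RCOSETS_def by auto
  then obtain A where A: "\<And>i. i \<in> F \<Longrightarrow> A i \<in> carrier (SL2 R)" "\<And>i. i \<in> F \<Longrightarrow> g i = centre #>\<^bsub>SL2 R\<^esub> A i"
    by metis
  obtain B where B: "B \<in> carrier (SL2 R)" "\<forall>i\<in>F. inv\<^bsub>SL2 R\<^esub> (A i) \<otimes>\<^bsub>SL2 R\<^esub> B \<in> principal (?p i)"
    using independent_SL2[OF F, of ?p A] cop A(1) by blast
  have "inv\<^bsub>PSL2 R\<^esub> (g i) \<otimes>\<^bsub>PSL2 R\<^esub> (centre #>\<^bsub>SL2 R\<^esub> B) \<in> congruence_subgroup (?p i)" if i: "i \<in> F" for i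
  proof -
    have "centre #>\<^bsub>SL2 R\<^esub> (inv\<^bsub>SL2 R\<^esub> (A i) \<otimes>\<^bsub>SL2 R\<^esub> B) =
       inv\<^bsub>PSL2 R\<^esub> (g i) \<otimes>\<^bsub>PSL2 R\<^esub> (centre #>\<^bsub>SL2 R\<^esub> B)"
      using h.hom_mult[OF S.inv_closed[OF A(1)[OF i]] B(1)] h.hom_inv[OF A(1)[OF i]] A(2)[OF i] by simp
    then show ?thesis using B(2) i unfolding congruence_subgroup_def by blast
  qed
  then show "\<exists>y\<in>carrier (PSL2 R). \<forall>i\<in>F. inv\<^bsub>PSL2 R\<^esub> (g i) \<otimes>\<^bsub>PSL2 R\<^esub> y \<in> congruence_subgroup (?p i)"
    using h.hom_closed[OF B(1)] by blast
qed

theorem PSL2_hocolim_proper_subgroups: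
  "\<exists>P. (\<forall>U\<in>P. subgroup U (PSL2 R) \<and> U \<noteq> carrier (PSL2 R)) \<and>
    hocolim_classifying (PSL2 R) P homotopy_equivalent_space classifying_space (PSL2 R)"
proof -
  interpret I: independent_family "PSL2 R" "\<lambda>i. congruence_subgroup (enumerate {p::nat. prime p} i)"
    by (rule independent_family_PSL2)
  have "U \<noteq> carrier (PSL2 R)" if meets: "U \<in> I.meets" for U
  proof
    assume U: "U = carrier (PSL2 R)"
    obtain F where F: "F \<noteq> {}" "U = I.common F" using meets by (auto simp: I.meets_def)
    then obtain i where "i \<in> F" by blast
    then have "carrier (PSL2 R) \<subseteq> congruence_subgroup (enumerate {p::nat. prime p} i)"
      using F U by (auto simp: I.common_def)
    then have "congruence_subgroup (enumerate {p::nat. prime p} i) = carrier (PSL2 R)"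
      using subgroup.subset[OF subgroup_congruence] by blast
    moreover have "prime (enumerate {p::nat. prime p} i)"
      using enumerate_in_set[OF primes_infinite, of i] by simp
    ultimately show False using congruence_proper by blast
  qed
  then show ?thesis using I.hocolim_meets_homotopy_equivalent I.subgroups by blast
qed

end

section \<open>The rings of integers for d = 1 and d = 2\<close>

definition quadratic_ring :: "nat \<Rightarrow> complex set" where
  "quadratic_ring d = {of_int a + of_int b * csqrt (- of_nat d) | a b :: int. True}"

lemma csqrt_minus_of_nat: "csqrt (- of_nat d) = \<i> * of_real (sqrt (real d))"
  using csqrt_of_real_nonpos[of "- real d"] by simp

lemma cmod_quadratic: "(cmod (of_real a + of_real b * csqrt (- of_nat d)))\<^sup>2 = a\<^sup>2 + real d * b\<^sup>2"
  unfolding csqrt_minus_of_nat by (simp add: cmod_power2 power_mult_distrib)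

text \<open>Rounding both coordinates of \<open>x / y\<close> leaves an error of squared modulus at
  most \<open>1/4 + d/4\<close>, which is at most 3/4 for \<open>d \<le> 2\<close>.\<close>

lemma quadratic_ring_norm_euclidean:
  assumes "d = 1 \<or> d = 2"
  shows "norm_euclidean_subring (quadratic_ring d)"
proof
  let ?w = "csqrt (- of_nat d)"
  have w: "?w * ?w = - of_nat d" using power2_csqrt[of "- of_nat d"] by (simp add: power2_eq_square)
  have mem: "of_int a + of_int b * ?w \<in> quadratic_ring d" for a b by (auto simp: quadratic_ring_def)
  show "1 \<in> quadratic_ring d" using mem[of 1 0] by simp
  fix x assume "x \<in> quadratic_ring d"
  then obtain a b where x: "x = of_int a + of_int b * ?w" by (auto simp: quadratic_ring_def)
  show "- x \<in> quadratic_ring d" using mem[of "- a" "- b"] by (simp add: x)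
  have "(cmod x)\<^sup>2 = (real_of_int a)\<^sup>2 + real d * (real_of_int b)\<^sup>2"
    using cmod_quadratic[of "real_of_int a" "real_of_int b" d] by (simp add: x)
  also have "\<dots> = real (nat (a\<^sup>2 + int d * b\<^sup>2))" by simp
  finally show "\<exists>n::nat. (cmod x)\<^sup>2 = real n" by blast
  fix y assume "y \<in> quadratic_ring d"
  then obtain c e where y: "y = of_int c + of_int e * ?w" by (auto simp: quadratic_ring_def)
  show "x + y \<in> quadratic_ring d" using mem[of "a + c" "b + e"] by (simp add: x y algebra_simps)
  have "x * y = of_int (a * c - int d * (b * e)) + of_int (a * e + b * c) * ?w"
  proof -
    have "x * y = of_int a * of_int c + (of_int a * of_int e + of_int b * of_int c) * ?w + of_int b * of_int e * (?w * ?w)"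
      unfolding x y by (simp add: algebra_simps)
    then show ?thesis unfolding w by (simp add: algebra_simps)
  qed
  then show "x * y \<in> quadratic_ring d" using mem by metis
  show "\<exists>q\<in>quadratic_ring d. cmod (x - q * y) < cmod y" if y0: "y \<noteq> 0"
  proof -
    define z where "z = x / y"
    define u v where "u = Re z" and "v = Im z / sqrt (real d)"
    have d: "real d > 0" "real d \<le> 2" using assms by auto
    have z: "z = of_real u + of_real v * ?w"
      unfolding csqrt_minus_of_nat u_def v_def using d by (simp add: complex_eq_iff)
    define q where "q = of_int (round u) + of_int (round v) * ?w"
    have r: "(t - of_int (round t))\<^sup>2 \<le> 1/4" for t :: real
    proof -
      have "\<bar>t - of_int (round t)\<bar> \<le> 1/2" using of_int_round_abs_le[of t] by (simp add: abs_minus_commute)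
      then have "\<bar>t - of_int (round t)\<bar>\<^sup>2 \<le> (1/2)\<^sup>2" by (intro power_mono) auto
      then show ?thesis by (simp add: power2_eq_square)
    qed
    have "z - q = of_real (u - of_int (round u)) + of_real (v - of_int (round v)) * ?w"
      unfolding z q_def by (simp add: algebra_simps)
    then have "(cmod (z - q))\<^sup>2 = (u - of_int (round u))\<^sup>2 + real d * (v - of_int (round v))\<^sup>2"
      using cmod_quadratic by metis
    also have "\<dots> \<le> 1/4 + 2 * (1/4)" using r[of u] r[of v] d by (intro add_mono mult_mono) auto
    also have "\<dots> < 1\<^sup>2" by simp
    finally have "cmod (z - q) < 1" by (rule power2_less_imp_less) simp
    moreover have "x - q * y = (z - q) * y" using y0 by (simp add: z_def algebra_simps)
    ultimately have "cmod (x - q * y) < cmod y" using y0 by (simp add: norm_mult)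
    moreover have "q \<in> quadratic_ring d" unfolding q_def by (rule mem)
    ultimately show ?thesis by blast
  qed
qed

lemma algebraic_int_quadratic: "algebraic_int (of_int a + of_int b * csqrt (- of_nat d))"
proof -
  let ?w = "csqrt (- of_nat d)"
  have w: "?w * ?w = - of_nat d" using power2_csqrt[of "- of_nat d"] by (simp add: power2_eq_square)
  \<comment> \<open>The monic polynomial formed from trace \<open>2 * a\<close> and norm
    \<open>a\<^sup>2 + d * b\<^sup>2\<close>.\<close>
  define p :: "int poly" where "p = [:a\<^sup>2 + int d * b\<^sup>2, - 2 * a, 1:]"
  have "poly (map_poly of_int p) (of_int a + of_int b * ?w) = of_int b * of_int b * (?w * ?w + of_nat d)"
    by (simp add: p_def map_poly_pCons power2_eq_square algebra_simps)
  then have "poly (map_poly of_int p) (of_int a + of_int b * ?w) = 0" unfolding w by simp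
  moreover have "lead_coeff p = 1" by (simp add: p_def)
  ultimately show ?thesis using algebraic_int_altdef_ipoly by blast
qed

text \<open>The nontrivial inclusion holds because a Euclidean ring is integrally closed and the
  denominators of the two rational coordinates carry any field element into the ring.\<close>

lemma imag_quadratic_integers_eq:
  assumes "d = 1 \<or> d = 2"
  shows "imag_quadratic_integers d = quadratic_ring d"
proof
  let ?w = "csqrt (- of_nat d)"
  interpret norm_euclidean_subring "quadratic_ring d" by (rule quadratic_ring_norm_euclidean[OF assms])
  show "quadratic_ring d \<subseteq> imag_quadratic_integers d"
  proof
    fix z assume "z \<in> quadratic_ring d"
    then obtain a b where z: "z = of_int a + of_int b * ?w" by (auto simp: quadratic_ring_def)
    have "z = of_rat (of_int a) + of_rat (of_int b) * ?w" by (simp add: z)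
    then have "z \<in> imag_quadratic_field d" unfolding imag_quadratic_field_def by blast
    moreover have "algebraic_int z" unfolding z by (rule algebraic_int_quadratic)
    ultimately show "z \<in> imag_quadratic_integers d" unfolding imag_quadratic_integers_def by simp
  qed
  show "imag_quadratic_integers d \<subseteq> quadratic_ring d"
  proof
    fix z assume "z \<in> imag_quadratic_integers d"
    then obtain a b :: rat where z: "z = of_rat a + of_rat b * ?w" "algebraic_int z"
      unfolding imag_quadratic_integers_def imag_quadratic_field_def by blast
    obtain m n where a: "quotient_of a = (m, n)" by (cases "quotient_of a")
    obtain k l where b: "quotient_of b = (k, l)" by (cases "quotient_of b")
    have pos: "n > 0" "l > 0" using quotient_of_denom_pos a b by blast+
    have "of_rat a = (of_int m / of_int n :: complex)" "of_rat b = (of_int k / of_int l :: complex)"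
      using quotient_of_div[OF a] quotient_of_div[OF b] by (simp_all add: of_rat_divide)
    then have "of_int (n * l) * z = of_int (m * l) + of_int (k * n) * ?w"
      unfolding z(1) using pos by (simp add: field_simps)
    then have "of_int (n * l) * z \<in> quadratic_ring d" unfolding quadratic_ring_def by blast
    moreover have "of_int (n * l) \<noteq> (0 :: complex)" using pos by simp
    ultimately show "z \<in> quadratic_ring d" using integrally_closed[OF z(2) of_int_mem] by blast
  qed
qed

theorem theorem4:
  fixes d :: nat
  assumes "d = 1 \<or> d = 2"
  shows "\<exists>P. (\<forall>U\<in>P. subgroup U (bianchi_group d) \<and> U \<noteq> carrier (bianchi_group d)) \<and>
    hocolim_classifying (bianchi_group d) P homotopy_equivalent_space
      classifying_space (bianchi_group d)"
  unfolding bianchi_group_def imag_quadratic_integers_eq[OF assms]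
  by (rule norm_euclidean_subring.PSL2_hocolim_proper_subgroups[OF quadratic_ring_norm_euclidean[OF assms]])

end
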